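(* Let $\Gamma$ be a finite simplicial graph and let $\{G_v\}_{v\in\Gamma}$ be discrete groups, each of which is weakly amenable with Cowling–Haagerup constant $1$. Then the graph product $G(\Gamma)$ is weakly amenable with Cowling–Haagerup constant $1$.
   Context: The graph product $G(\Gamma)$ of groups $\{G_v\}_{v\in\Gamma}$ over a finite simplicial graph $\Gamma$ is the quotient of the free product $\ast_{v\in\Gamma}G_v$ by the normal subgroup generated by all commutators $[G_v,G_w]$ for which $v,w$ are joined by an edge of $\Gamma$. A function $\varphi:G\to\mathbb{C}$ on a discrete group is completely bounded if the associated multiplication operator $\sum a_g g\mapsto\sum a_g\varphi(g)g$ is a completely bounded map on the reduced group C$^*$-algebra $C^*_r(G)$; $\|\varphi\|_{cb}$ denotes its cb-norm. $G$ is weakly amenable with Cowling–Haagerup constant $1$ if there is a net $(\varphi_n)$ of finitely supported completely bounded functions on $G$ with $\varphi_n\to 1$ pointwise and $\limsup_n\|\varphi_n\|_{cb}\le 1$. *)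

theory Defs
  imports "HOL-Analysis.Analysis" "HOL-Algebra.Group" "HOL-Library.Liminf_Limsup"
begin

text \<open>Finitely supported functions on the carrier of a group: these are the
elements of the complex group algebra, a dense subalgebra of the reduced group
C*-algebra, embedded via the left regular representation on l2(G).\<close>

definition fin_supp :: "('a, 'b) monoid_scheme \<Rightarrow> ('a \<Rightarrow> complex) \<Rightarrow> bool" where
  "fin_supp G a \<longleftrightarrow> finite {g \<in> carrier G. a g \<noteq> 0}"

definition lreg :: "('a, 'b) monoid_scheme \<Rightarrow> ('a \<Rightarrow> complex) \<Rightarrow> ('a \<Rightarrow> complex) \<Rightarrow> 'a \<Rightarrow> complex" where
  "lreg G a xi h = (\<Sum>g \<in> {g \<in> carrier G. a g \<noteq> 0}. a g * xi (inv\<^bsub>G\<^esub> g \<otimes>\<^bsub>G\<^esub> h))"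

definition l2_vec :: "('a, 'b) monoid_scheme \<Rightarrow> ('a \<Rightarrow> complex) \<Rightarrow> bool" where
  "l2_vec G xi \<longleftrightarrow> (\<forall>g. g \<notin> carrier G \<longrightarrow> xi g = 0) \<and> (\<lambda>g. (cmod (xi g))\<^sup>2) summable_on carrier G"

definition l2_normsq :: "('a, 'b) monoid_scheme \<Rightarrow> ('a \<Rightarrow> complex) \<Rightarrow> real" where
  "l2_normsq G xi = infsum (\<lambda>g. (cmod (xi g))\<^sup>2) (carrier G)"

text \<open>Norm in M_n(C*_r(G)) of the matrix [lambda(A i j)], i,j < n, acting on l2(G)^n.\<close>
definition mat_norm :: "('a, 'b) monoid_scheme \<Rightarrow> nat \<Rightarrow> (nat \<Rightarrow> nat \<Rightarrow> 'a \<Rightarrow> complex) \<Rightarrow> ereal" where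
  "mat_norm G n A = Sup {ereal (sqrt (\<Sum>i<n. l2_normsq G (\<lambda>h. \<Sum>j<n. lreg G (A i j) (xi j) h))) | xi.
       (\<forall>j<n. l2_vec G (xi j)) \<and> (\<Sum>j<n. l2_normsq G (xi j)) \<le> 1}"

text \<open>cb-norm of the multiplication operator associated with phi, computed on the
dense subalgebras M_n(C[G]) of M_n(C*_r(G)); it is infinite iff phi is not
completely bounded.\<close>
definition cb_norm :: "('a, 'b) monoid_scheme \<Rightarrow> ('a \<Rightarrow> complex) \<Rightarrow> ereal" where
  "cb_norm G phi = Sup {mat_norm G n (\<lambda>i j g. phi g * A i j g) | n A.
       (\<forall>i<n. \<forall>j<n. fin_supp G (A i j)) \<and> mat_norm G n A \<le> 1}"

definition completely_bounded :: "('a, 'b) monoid_scheme \<Rightarrow> ('a \<Rightarrow> complex) \<Rightarrow> bool" where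
  "completely_bounded G phi \<longleftrightarrow> cb_norm G phi < \<infinity>"

text \<open>Weak amenability with Cowling-Haagerup constant 1. A net (phi_n) is
represented by its image filter F on the function space (F = map of the
index filter); conversely any proper filter is a net indexed by itself.\<close>
definition weakly_amenable_CH1 :: "('a, 'b) monoid_scheme \<Rightarrow> bool" where
  "weakly_amenable_CH1 G \<longleftrightarrow>
     (\<exists>F :: ('a \<Rightarrow> complex) filter. F \<noteq> bot \<and>
        (\<forall>\<^sub>F phi in F. fin_supp G phi \<and> completely_bounded G phi) \<and>
        (\<forall>g \<in> carrier G. ((\<lambda>phi. phi g) \<longlongrightarrow> 1) F) \<and>
        Limsup F (cb_norm G) \<le> 1)"

definition simplicial_graph :: "'v set \<Rightarrow> ('v \<Rightarrow> 'v \<Rightarrow> bool) \<Rightarrow> bool" where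
  "simplicial_graph V E \<longleftrightarrow> finite V \<and> (\<forall>v w. E v w \<longrightarrow> v \<in> V \<and> w \<in> V \<and> v \<noteq> w \<and> E w v)"

definition gp_words :: "'v set \<Rightarrow> ('v \<Rightarrow> ('g, 'c) monoid_scheme) \<Rightarrow> ('v \<times> 'g) list set" where
  "gp_words V G = {w. \<forall>(v, a) \<in> set w. v \<in> V \<and> a \<in> carrier (G v)}"

inductive gp_step :: "'v set \<Rightarrow> ('v \<Rightarrow> 'v \<Rightarrow> bool) \<Rightarrow> ('v \<Rightarrow> ('g, 'c) monoid_scheme)
    \<Rightarrow> ('v \<times> 'g) list \<Rightarrow> ('v \<times> 'g) list \<Rightarrow> bool"
  for V E G where
  drop_one: "v \<in> V \<Longrightarrow> gp_step V E G (xs @ [(v, \<one>\<^bsub>G v\<^esub>)] @ ys) (xs @ ys)"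
| merge: "v \<in> V \<Longrightarrow> a \<in> carrier (G v) \<Longrightarrow> b \<in> carrier (G v) \<Longrightarrow>
     gp_step V E G (xs @ [(v, a), (v, b)] @ ys) (xs @ [(v, a \<otimes>\<^bsub>G v\<^esub> b)] @ ys)"
| swap: "E v w \<Longrightarrow> a \<in> carrier (G v) \<Longrightarrow> b \<in> carrier (G w) \<Longrightarrow>
     gp_step V E G (xs @ [(v, a), (w, b)] @ ys) (xs @ [(w, b), (v, a)] @ ys)"

definition gp_equiv :: "'v set \<Rightarrow> ('v \<Rightarrow> 'v \<Rightarrow> bool) \<Rightarrow> ('v \<Rightarrow> ('g, 'c) monoid_scheme)
    \<Rightarrow> ('v \<times> 'g) list \<Rightarrow> ('v \<times> 'g) list \<Rightarrow> bool" where
  "gp_equiv V E G = (\<lambda>x y. gp_step V E G x y \<or> gp_step V E G y x)\<^sup>*\<^sup>*"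

definition gp_class :: "'v set \<Rightarrow> ('v \<Rightarrow> 'v \<Rightarrow> bool) \<Rightarrow> ('v \<Rightarrow> ('g, 'c) monoid_scheme)
    \<Rightarrow> ('v \<times> 'g) list \<Rightarrow> ('v \<times> 'g) list set" where
  "gp_class V E G w = {w'. gp_equiv V E G w w'}"

definition graph_product :: "'v set \<Rightarrow> ('v \<Rightarrow> 'v \<Rightarrow> bool) \<Rightarrow> ('v \<Rightarrow> ('g, 'c) monoid_scheme)
    \<Rightarrow> ('v \<times> 'g) list set monoid" where
  "graph_product V E G =
     \<lparr> carrier = gp_class V E G ` gp_words V G,
       mult = (\<lambda>X Y. gp_class V E G ((SOME x. x \<in> X) @ (SOME y. y \<in> Y))),
       one = gp_class V E G [] \<rparr>"

end

theory Submission
  imports Defs "HOL-Real_Asymp.Real_Asymp"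
begin

text \<open>A function \<open>\<phi>\<close> has cb-norm at most \<open>C\<close> iff all its kernels \<open>\<phi> (x\<inverse>y)\<close> on finite sets are of the form
  \<open>\<langle>\<alpha> x, \<beta> y\<rangle>\<close> with vectors of squared length about \<open>C\<close>; such kernels can be multiplied. For each vertex \<open>v\<close>
  there is a crossed homomorphism from the graph product to a free product of copies of \<open>G v\<close>, which sends
  \<open>x\<inverse>y\<close> to the left quotient of the images of \<open>x\<close> and \<open>y\<close> up to relabelling of the copies. On the free product, take
  \<open>\<phi>\<close> on \<open>G v\<close> with \<open>\<phi> 1 = 1\<close> and cb-norm close to 1, and multiply \<open>z \<phi>\<close> along reduced words. The resulting kernel
  has an explicit factorization, bounded uniformly in \<open>\<phi>\<close> on each circle \<open>\<bar>z\<bar> = R < 1\<close>, and with norm close to 1 when \<open>z = r\<close>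
  is real. Fourier analysis on the circle bounds the part of word length \<open>n\<close> by \<open>const * R ^ -n\<close>, so that for \<open>r < R\<close>
  the multiplier can be cut off at a large length at small cost. The product over all vertices of these
  truncated multipliers has finite support.\<close>

section \<open>Schur multipliers on finite sets\<close>

text \<open>The data at a vertex are good only up to a small error, and the free product multiplier
  has one factor per letter, so errors could accumulate along a word. Scaling by
  \<open>r < 1\<close> turns them into a geometric series. Each term of this series is small because
  normalizing \<phi> to take the value 1 at the identity, with norm close to 1, forces the two
  vectors attached to the identity to be almost conjugate: \<phi> is then almost positive definite.
  The bound on the circle serves the cut-off. Truncation by length is not contractive, and the
  cut-off length has to be fixed before the precision demanded of \<phi>, so the parts of long words
  need a bound that does not see \<phi>. No single vertex yields a finitely supported function,
  since all words without letters of \<open>v\<close> have trivial component at \<open>v\<close>.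
  The product over the vertices does, because in a shortest word each letter is visible in the
  component of its own vertex. As the graph is finite, a product of constants near 1 stays near
  1.\<close>

definition schur_rep ::
  "'a set \<Rightarrow> real \<Rightarrow> ('a \<Rightarrow> 'a \<Rightarrow> complex) \<Rightarrow> nat \<Rightarrow> ('a \<Rightarrow> nat \<Rightarrow> complex) \<Rightarrow> ('a \<Rightarrow> nat \<Rightarrow> complex) \<Rightarrow> bool" where
  "schur_rep F C K n \<alpha> \<beta> \<longleftrightarrow>
     (\<forall>x\<in>F. \<forall>y\<in>F. K x y = (\<Sum>k<n. \<alpha> x k * \<beta> y k)) \<and>
     (\<forall>x\<in>F. (\<Sum>k<n. (cmod (\<alpha> x k))\<^sup>2) \<le> C) \<and> (\<forall>x\<in>F. (\<Sum>k<n. (cmod (\<beta> x k))\<^sup>2) \<le> C)"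

lemma schur_repD:
  assumes "schur_rep F C K n \<alpha> \<beta>"
  shows "x \<in> F \<Longrightarrow> y \<in> F \<Longrightarrow> K x y = (\<Sum>k<n. \<alpha> x k * \<beta> y k)"
    and "x \<in> F \<Longrightarrow> (\<Sum>k<n. (cmod (\<alpha> x k))\<^sup>2) \<le> C"
    and "x \<in> F \<Longrightarrow> (\<Sum>k<n. (cmod (\<beta> x k))\<^sup>2) \<le> C"
  using assms unfolding schur_rep_def by auto

text \<open>The number of coordinates may depend on \<open>F\<close>; only \<open>C\<close> has to
  be uniform over finite sets. As \<open>C\<close> bounds squared lengths on both sides, it adds
  under sums and multiplies under products of kernels.\<close>

definition schur_factor :: "'a set \<Rightarrow> real \<Rightarrow> ('a \<Rightarrow> 'a \<Rightarrow> complex) \<Rightarrow> bool" where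
  "schur_factor F C K \<longleftrightarrow> (\<exists>n \<alpha> \<beta>. schur_rep F C K n \<alpha> \<beta>)"

lemma schur_factorI:
  fixes I :: "'i set"
  assumes "finite I"
    and "\<And>x y. x \<in> F \<Longrightarrow> y \<in> F \<Longrightarrow> K x y = (\<Sum>i\<in>I. \<alpha> x i * \<beta> y i)"
    and "\<And>x. x \<in> F \<Longrightarrow> (\<Sum>i\<in>I. (cmod (\<alpha> x i))\<^sup>2) \<le> C"
    and "\<And>x. x \<in> F \<Longrightarrow> (\<Sum>i\<in>I. (cmod (\<beta> x i))\<^sup>2) \<le> C"
  shows "schur_factor F C K"
proof -
  obtain h where h: "bij_betw h {..<card I} I"
    using ex_bij_betw_nat_finite[OF assms(1)] by (auto simp: atLeast0LessThan)
  have r: "(\<Sum>i\<in>I. f i) = (\<Sum>k<card I. f (h k))" for f :: "'i \<Rightarrow> 'z::comm_monoid_add"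
    by (rule sum.reindex_bij_betw[OF h, symmetric])
  show ?thesis
    unfolding schur_factor_def schur_rep_def
    by (rule exI[of _ "card I"], rule exI[of _ "\<lambda>x k. \<alpha> x (h k)"], rule exI[of _ "\<lambda>x k. \<beta> x (h k)"])
      (use assms(2-4) in \<open>simp add: r\<close>)
qed

lemma schur_factor_cong:
  assumes "schur_factor F C K" "\<And>x y. x \<in> F \<Longrightarrow> y \<in> F \<Longrightarrow> K x y = L x y"
  shows "schur_factor F C L"
proof -
  obtain n \<alpha> \<beta> where "schur_rep F C K n \<alpha> \<beta>"
    using assms(1) unfolding schur_factor_def by blast
  note 1 = schur_repD[OF this]
  show ?thesis
  proof (rule schur_factorI[where I="{..<n}" and \<alpha>=\<alpha> and \<beta>=\<beta>])
    show "L x y = (\<Sum>k<n. \<alpha> x k * \<beta> y k)" if "x \<in> F" "y \<in> F" for x y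
      using 1(1)[OF that] assms(2)[OF that] by simp
  qed (use 1 in auto)
qed

lemma schur_factor_mono:
  assumes "schur_factor F C K" "C \<le> D" "F' \<subseteq> F"
  shows "schur_factor F' D K"
proof -
  obtain n \<alpha> \<beta> where "schur_rep F C K n \<alpha> \<beta>"
    using assms(1) unfolding schur_factor_def by blast
  note 1 = schur_repD[OF this]
  show ?thesis
  proof (rule schur_factorI[where I="{..<n}" and \<alpha>=\<alpha> and \<beta>=\<beta>])
    show "K x y = (\<Sum>k<n. \<alpha> x k * \<beta> y k)" if "x \<in> F'" "y \<in> F'" for x y
      using 1(1) that assms(3) by auto
    show "(\<Sum>k<n. (cmod (\<alpha> x k))\<^sup>2) \<le> D" "(\<Sum>k<n. (cmod (\<beta> x k))\<^sup>2) \<le> D" if "x \<in> F'" for x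
      using 1(2,3) that assms(2,3) by (meson order_trans subsetD)+
  qed simp
qed

lemma schur_factor_pullback:
  assumes "schur_factor (f ` F) C K"
  shows "schur_factor F C (\<lambda>x y. K (f x) (f y))"
proof -
  obtain n \<alpha> \<beta> where "schur_rep (f ` F) C K n \<alpha> \<beta>"
    using assms(1) unfolding schur_factor_def by blast
  note 1 = schur_repD[OF this]
  show ?thesis
    by (rule schur_factorI[where I="{..<n}" and \<alpha>="\<lambda>x. \<alpha> (f x)" and \<beta>="\<lambda>x. \<beta> (f x)"]) (use 1 in auto)
qed

lemma schur_factor_rank_one:
  assumes "\<And>x. x \<in> F \<Longrightarrow> (cmod (a x))\<^sup>2 \<le> C" "\<And>x. x \<in> F \<Longrightarrow> (cmod (b x))\<^sup>2 \<le> C"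
  shows "schur_factor F C (\<lambda>x y. a x * b y)"
  by (rule schur_factorI[where I="{()}" and \<alpha>="\<lambda>x _. a x" and \<beta>="\<lambda>x _. b x"]) (use assms in auto)

lemma schur_factor_delta:
  assumes "finite F"
  shows "schur_factor F 1 (\<lambda>x y. if x = y then 1 else 0)"
proof -
  let ?d = "\<lambda>x i. if i = x then 1 else (0::complex)"
  have 1: "(\<Sum>i\<in>F. ?d x i * ?d y i) = (if x = y then 1 else 0)" if "x \<in> F" for x y
  proof -
    have "(\<Sum>i\<in>F. ?d x i * ?d y i) = (\<Sum>i\<in>F. if i = x then ?d y x else 0)"
      by (intro sum.cong) auto
    then show ?thesis using that assms by simp
  qed
  have 2: "(\<Sum>i\<in>F. (cmod (?d x i))\<^sup>2) \<le> 1" if "x \<in> F" for x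
  proof -
    have "(\<Sum>i\<in>F. (cmod (?d x i))\<^sup>2) = (\<Sum>i\<in>F. if i = x then 1 else 0)"
      by (intro sum.cong) auto
    then show ?thesis using that assms by simp
  qed
  show ?thesis
    by (rule schur_factorI[OF assms, where \<alpha>="?d" and \<beta>="?d"]) (use 1 2 in auto)
qed

lemma schur_factor_add:
  assumes "schur_factor F C K" "schur_factor F D L"
  shows "schur_factor F (C + D) (\<lambda>x y. K x y + L x y)"
proof -
  obtain n \<alpha> \<beta> where "schur_rep F C K n \<alpha> \<beta>"
    using assms(1) unfolding schur_factor_def by blast
  note 1 = schur_repD[OF this]
  obtain m \<alpha>' \<beta>' where "schur_rep F D L m \<alpha>' \<beta>'"
    using assms(2) unfolding schur_factor_def by blast
  note 2 = schur_repD[OF this]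
  show ?thesis
    by (rule schur_factorI[where I="{..<n} <+> {..<m}" and \<alpha>="\<lambda>x. case_sum (\<alpha> x) (\<alpha>' x)"
        and \<beta>="\<lambda>x. case_sum (\<beta> x) (\<beta>' x)"]) (use 1 2 in \<open>auto simp: sum.Plus add_mono\<close>)
qed

text \<open>The vectors are tensor products, so constants near 1 multiply to constants near 1; this
  is what later combines the vertices.\<close>

lemma schur_factor_mult:
  assumes "schur_factor F C K" "schur_factor F D L" "C \<ge> 0" "D \<ge> 0"
  shows "schur_factor F (C * D) (\<lambda>x y. K x y * L x y)"
proof -
  obtain n \<alpha> \<beta> where "schur_rep F C K n \<alpha> \<beta>"
    using assms(1) unfolding schur_factor_def by blast
  note 1 = schur_repD[OF this]
  obtain m \<alpha>' \<beta>' where "schur_rep F D L m \<alpha>' \<beta>'"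
    using assms(2) unfolding schur_factor_def by blast
  note 2 = schur_repD[OF this]
  have p: "(\<Sum>(i, j)\<in>{..<n} \<times> {..<m}. (cmod (a i * b j))\<^sup>2) = (\<Sum>i<n. (cmod (a i))\<^sup>2) * (\<Sum>j<m. (cmod (b j))\<^sup>2)"
    for a b by (simp add: norm_mult power_mult_distrib sum_product sum.cartesian_product)
  show ?thesis
  proof (rule schur_factorI[where I="{..<n} \<times> {..<m}" and \<alpha>="\<lambda>x (i, j). \<alpha> x i * \<alpha>' x j"
        and \<beta>="\<lambda>x (i, j). \<beta> x i * \<beta>' x j"])
    fix x y assume "x \<in> F" "y \<in> F"
    then show "K x y * L x y = (\<Sum>i\<in>{..<n} \<times> {..<m}. (case i of (i, j) \<Rightarrow> \<alpha> x i * \<alpha>' x j) * (case i of (i, j) \<Rightarrow> \<beta> y i * \<beta>' y j))"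
      unfolding 1(1)[OF \<open>x \<in> F\<close> \<open>y \<in> F\<close>] 2(1)[OF \<open>x \<in> F\<close> \<open>y \<in> F\<close>] sum_product sum.cartesian_product
      by (intro sum.cong) (auto simp: mult_ac)
  qed (use 1 2 assms(3,4) in \<open>auto simp: case_prod_unfold p[unfolded case_prod_unfold] intro!: mult_mono sum_nonneg\<close>)
qed

lemma schur_factor_const:
  assumes "cmod c \<le> C"
  shows "schur_factor F C (\<lambda>x y. c)"
proof -
  let ?s = "complex_of_real (sqrt (cmod c))"
  have "schur_factor F C (\<lambda>x y. (?s * sgn c) * ?s)"
  proof (rule schur_factor_rank_one)
    have "(cmod (?s * sgn c))\<^sup>2 \<le> cmod c"
      by (cases "c = 0") (auto simp: norm_mult power_mult_distrib norm_sgn)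
    then show "(cmod (?s * sgn c))\<^sup>2 \<le> C" using assms by linarith
    show "(cmod ?s)\<^sup>2 \<le> C" using assms by simp
  qed
  moreover have "?s * sgn c * ?s = c"
  proof -
    have "?s * ?s = of_real (cmod c)" by (simp flip: of_real_mult)
    moreover have "of_real (cmod c) * sgn c = c"
      by (cases "c = 0") (auto simp: sgn_div_norm scaleR_conv_of_real field_simps)
    ultimately show ?thesis by (metis mult.assoc mult.commute)
  qed
  ultimately show ?thesis by simp
qed

lemma schur_factor_scale:
  assumes "schur_factor F C K" "C \<ge> 0" "cmod c \<le> D"
  shows "schur_factor F (D * C) (\<lambda>x y. c * K x y)"
  by (rule schur_factor_mult[OF schur_factor_const[OF assms(3)] assms(1) order_trans[OF norm_ge_zero assms(3)] assms(2)])

lemma schur_factor_sum: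
  assumes "finite I" "\<And>i. i \<in> I \<Longrightarrow> schur_factor F (C i) (K i)"
  shows "schur_factor F (\<Sum>i\<in>I. C i) (\<lambda>x y. \<Sum>i\<in>I. K i x y)"
  using assms
proof (induction I)
  case empty
  show ?case using schur_factor_const[of 0 0] by simp
next
  case (insert i I)
  then show ?case using schur_factor_add[of F "C i" "K i"] by simp
qed

lemma schur_factor_prod:
  assumes "finite I" "\<And>i. i \<in> I \<Longrightarrow> schur_factor F (C i) (K i)" "\<And>i. i \<in> I \<Longrightarrow> C i \<ge> 0"
  shows "schur_factor F (\<Prod>i\<in>I. C i) (\<lambda>x y. \<Prod>i\<in>I. K i x y)"
  using assms
proof (induction I)
  case empty
  show ?case using schur_factor_const[of 1 1] by simp
next
  case (insert i I)
  then show ?case using schur_factor_mult[of F "C i" "K i"] by (simp add: prod_nonneg)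
qed

text \<open>Crude, but it only has to absorb an entrywise error that can be made arbitrarily small
  on a fixed finite set.\<close>

lemma schur_factor_entries:
  assumes "finite F"
  shows "schur_factor F (\<Sum>x\<in>F. \<Sum>y\<in>F. cmod (K x y)) K"
proof -
  have "schur_factor F (cmod (K a b) * 1) (\<lambda>x y. K a b * ((if x = a then 1 else 0) * (if y = b then 1 else 0)))" for a b
    by (rule schur_factor_scale[OF schur_factor_rank_one]) auto
  then have "schur_factor F (\<Sum>a\<in>F. \<Sum>b\<in>F. cmod (K a b))
      (\<lambda>x y. \<Sum>a\<in>F. \<Sum>b\<in>F. K a b * ((if x = a then 1 else 0) * (if y = b then 1 else 0)))"
    by (intro schur_factor_sum assms) simp
  then show ?thesis
  proof (rule schur_factor_cong)
    fix x y assume "x \<in> F" "y \<in> F"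
    have "(\<Sum>a\<in>F. \<Sum>b\<in>F. K a b * ((if x = a then 1 else 0) * (if y = b then 1 else 0)))
      = (\<Sum>a\<in>F. \<Sum>b\<in>F. if y = b then (if x = a then K a b else 0) else 0)"
      by (intro sum.cong) auto
    also have "\<dots> = K x y" using \<open>x \<in> F\<close> \<open>y \<in> F\<close> assms by simp
    finally show "(\<Sum>a\<in>F. \<Sum>b\<in>F. K a b * ((if x = a then 1 else 0) * (if y = b then 1 else 0))) = K x y" .
  qed
qed

section \<open>Gram matrices and separation from a cone\<close>

text \<open>Minimal distance from \<open>k\<close> to the closure of \<open>S\<close>: by the parallelogram law a minimising sequence
  is Cauchy, and the difference of \<open>k\<close> and its limit is the separating functional.\<close>

lemma cone_separation:
  fixes I :: "'i set" and S :: "('i \<Rightarrow> real) set"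
  assumes I: "finite I"
    and S0: "(\<lambda>_. 0) \<in> S"
    and Sadd: "\<And>f g. f \<in> S \<Longrightarrow> g \<in> S \<Longrightarrow> (\<lambda>i. f i + g i) \<in> S"
    and Sscale: "\<And>f t. f \<in> S \<Longrightarrow> t \<ge> 0 \<Longrightarrow> (\<lambda>i. t * f i) \<in> S"
    and "\<tau> > 0" and far: "\<And>s. s \<in> S \<Longrightarrow> (\<Sum>i\<in>I. (k i - s i)\<^sup>2) \<ge> \<tau>"
  obtains b where "\<And>s. s \<in> S \<Longrightarrow> (\<Sum>i\<in>I. b i * s i) \<le> 0" "(\<Sum>i\<in>I. b i * k i) > 0"
proof -
  define N where "N f = (\<Sum>i\<in>I. (f i)\<^sup>2)" for f :: "'i \<Rightarrow> real"
  define d where "d = (INF s\<in>S. N (\<lambda>i. k i - s i))"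
  have bdd: "bdd_below ((\<lambda>s. N (\<lambda>i. k i - s i)) ` S)"
    by (rule bdd_belowI[of _ 0]) (auto simp: N_def sum_nonneg)
  have d_le: "d \<le> N (\<lambda>i. k i - s i)" if "s \<in> S" for s
    unfolding d_def by (rule cINF_lower[OF bdd that])
  have d_pos: "\<tau> \<le> d" unfolding d_def
    by (rule cINF_greatest) (use S0 far in \<open>auto simp: N_def\<close>)
  have "\<exists>s\<in>S. N (\<lambda>i. k i - s i) < d + 1 / (real n + 1)" for n
  proof -
    have "(INF s\<in>S. N (\<lambda>i. k i - s i)) < d + 1 / (real n + 1)" by (simp add: d_def)
    then show ?thesis using cINF_less_iff[of S "\<lambda>s. N (\<lambda>i. k i - s i)"] S0 bdd by auto
  qed
  then obtain s where s: "\<And>n. s n \<in> S" "\<And>n. N (\<lambda>i. k i - s n i) < d + 1 / (real n + 1)"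
    by metis
  have par: "N (\<lambda>i. s m i - s n i) \<le> 2 / (real m + 1) + 2 / (real n + 1)" for m n
  proof -
    have "(\<lambda>i. (1/2) * (s m i + s n i)) \<in> S" using Sscale[OF Sadd[OF s(1)[of m] s(1)[of n]], of "1/2"] by simp
    from d_le[OF this] have "4 * d \<le> 4 * N (\<lambda>i. k i - 1/2 * (s m i + s n i))" by simp
    also have "\<dots> = 2 * N (\<lambda>i. k i - s m i) + 2 * N (\<lambda>i. k i - s n i) - N (\<lambda>i. s m i - s n i)"
      unfolding N_def sum_distrib_left sum.distrib[symmetric] sum_subtractf[symmetric]
      by (intro sum.cong) (auto simp: power2_eq_square field_simps)
    finally show ?thesis using s(2)[of m] s(2)[of n] by simp
  qed
  have "convergent (\<lambda>n. s n i)" if "i \<in> I" for i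
  proof -
    have le: "(s m i - s n i)\<^sup>2 \<le> 2 / (real m + 1) + 2 / (real n + 1)" for m n
    proof -
      have "(s m i - s n i)\<^sup>2 \<le> N (\<lambda>i. s m i - s n i)"
        unfolding N_def by (rule member_le_sum[OF that]) (auto simp: I)
      then show ?thesis using par[of m n] by linarith
    qed
    have "Cauchy (\<lambda>n. s n i)"
    proof (rule metric_CauchyI)
      fix e :: real assume "e > 0"
      obtain M :: nat where M: "4 / e\<^sup>2 < real M" using reals_Archimedean2 by blast
      have small: "2 / (real m + 1) < e\<^sup>2 / 2" if "m \<ge> M" for m
      proof -
        have "4 / e\<^sup>2 < real m + 1" using M that by linarith
        then show ?thesis using \<open>e > 0\<close> by (simp add: field_simps)
      qed
      have "dist (s m i) (s n i) < e" if "m \<ge> M" "n \<ge> M" for m n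
      proof -
        have "(s m i - s n i)\<^sup>2 < e\<^sup>2" using le[of m n] small[OF that(1)] small[OF that(2)] by linarith
        then show ?thesis using \<open>e > 0\<close> power2_less_imp_less[of "\<bar>s m i - s n i\<bar>" e]
          by (simp add: dist_real_def)
      qed
      then show "\<exists>M. \<forall>m\<ge>M. \<forall>n\<ge>M. dist (s m i) (s n i) < e" by blast
    qed
    then show ?thesis by (simp add: Cauchy_convergent_iff)
  qed
  then obtain l where l: "\<And>i. i \<in> I \<Longrightarrow> (\<lambda>n. s n i) \<longlonglongrightarrow> l i"
    unfolding convergent_def by metis
  define b where "b i = k i - l i" for i
  define dot where "dot f g = (\<Sum>i\<in>I. f i * g i)" for f g :: "'i \<Rightarrow> real"
  have Nb: "N b \<le> d"
  proof (rule LIMSEQ_le)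
    show "(\<lambda>n. N (\<lambda>i. k i - s n i)) \<longlonglongrightarrow> N b"
      unfolding N_def b_def by (intro tendsto_intros l)
    show "(\<lambda>n. d + 1 / (real n + 1)) \<longlonglongrightarrow> d"
      using tendsto_add[OF tendsto_const[of d] LIMSEQ_inverse_real_of_nat] by (simp add: inverse_eq_divide add.commute)
    show "\<exists>M. \<forall>n\<ge>M. N (\<lambda>i. k i - s n i) \<le> d + 1 / (real n + 1)"
      using s(2) less_imp_le by blast
  qed
  \<comment> \<open>The limit \<open>l\<close> need not lie in \<open>S\<close>, so the first
    variation is taken at \<open>s n\<close> and passed to the limit. The direction may depend on
    \<open>n\<close>: besides elements of \<open>S\<close> it is applied to \<open>- s n\<close>,
    admissible because \<open>(1 - t)\<close> times \<open>s n\<close> stays in the cone.\<close>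
  have var: "dot b g \<le> 0" if g: "\<And>t n. 0 < t \<Longrightarrow> t < 1 \<Longrightarrow> (\<lambda>i. s n i + t * u n i) \<in> S"
      and u: "\<And>i. i \<in> I \<Longrightarrow> (\<lambda>n. u n i) \<longlonglongrightarrow> g i" for g u
  proof -
    have *: "2 * dot b g \<le> t * N g" if t: "0 < t" "t < 1" for t
    proof -
      have "d \<le> N (\<lambda>i. b i - t * g i)"
      proof (rule LIMSEQ_le_const)
        have "(\<lambda>n. N (\<lambda>i. k i - (s n i + t * u n i))) \<longlonglongrightarrow> N (\<lambda>i. k i - (l i + t * g i))"
          unfolding N_def by (intro tendsto_intros l u)
        then show "(\<lambda>n. N (\<lambda>i. k i - (s n i + t * u n i))) \<longlonglongrightarrow> N (\<lambda>i. b i - t * g i)"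
          by (simp add: b_def algebra_simps)
      qed (use d_le[OF g[OF t]] in auto)
      also have "\<dots> = N b - t * (2 * dot b g - t * N g)"
        unfolding N_def dot_def sum_distrib_left sum.distrib[symmetric] sum_subtractf[symmetric]
        by (intro sum.cong) (auto simp: power2_eq_square algebra_simps)
      finally have "t * (2 * dot b g - t * N g) \<le> 0" using Nb by simp
      then show ?thesis using t by (simp add: mult_le_0_iff)
    qed
    have "(\<lambda>n. 1 / (real n + 2) * N g) \<longlonglongrightarrow> 0 * N g"
    proof (intro tendsto_mult tendsto_const)
      show "(\<lambda>n. 1 / (real n + 2)) \<longlonglongrightarrow> 0" by real_asymp
    qed
    then have "2 * dot b g \<le> 0 * N g"
    proof (rule LIMSEQ_le_const)
      show "\<exists>M. \<forall>n\<ge>M. 2 * dot b g \<le> 1 / (real n + 2) * N g"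
        by (intro exI[of _ 0] allI impI *) auto
    qed
    then show ?thesis by simp
  qed
  have "dot b f \<le> 0" if "f \<in> S" for f
    by (rule var[of "\<lambda>_. f"]) (use Sadd[OF s(1) Sscale[OF that]] in auto)
  moreover have "dot b k > 0"
  proof -
    have "dot b (\<lambda>i. - l i) \<le> 0"
    proof (rule var[of "\<lambda>n i. - s n i"])
      fix t :: real and n assume "0 < t" "t < 1"
      then show "(\<lambda>i. s n i + t * - s n i) \<in> S" using Sscale[OF s(1)[of n], of "1 - t"] by (simp add: algebra_simps)
    qed (intro tendsto_intros l)
    moreover have "dot b k = N b - dot b (\<lambda>i. - l i)"
      unfolding N_def dot_def sum_subtractf[symmetric] b_def
      by (intro sum.cong) (auto simp: power2_eq_square algebra_simps)
    moreover have "d \<le> N b"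
    proof (rule LIMSEQ_le_const)
      show "(\<lambda>n. N (\<lambda>i. k i - s n i)) \<longlonglongrightarrow> N b"
        unfolding N_def b_def by (intro tendsto_intros l)
    qed (use d_le[OF s(1)] in auto)
    ultimately show ?thesis using d_pos \<open>\<tau> > 0\<close> by linarith
  qed
  ultimately show thesis using that unfolding dot_def by blast
qed

text \<open>Multiplying \<open>s\<close> by the conjugate phase of the sum turns its real part into
  its modulus. The phase is 0 when the sum vanishes, which only decreases the right-hand side for
  nonnegative \<open>u\<close>.\<close>

lemma complex_sum_sgn_le:
  fixes s t :: "'a \<Rightarrow> complex"
  assumes "\<And>s t. Re (\<Sum>x\<in>F. \<Sum>y\<in>F. B x y * s x * t y) \<le> (\<Sum>x\<in>F. u x * (cmod (s x))\<^sup>2) + (\<Sum>y\<in>F. v y * (cmod (t y))\<^sup>2)"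
    and "\<And>x. x \<in> F \<Longrightarrow> u x \<ge> 0"
  shows "cmod (\<Sum>x\<in>F. \<Sum>y\<in>F. B x y * s x * t y) \<le> (\<Sum>x\<in>F. u x * (cmod (s x))\<^sup>2) + (\<Sum>y\<in>F. v y * (cmod (t y))\<^sup>2)"
proof -
  define z where "z = (\<Sum>x\<in>F. \<Sum>y\<in>F. B x y * s x * t y)"
  define c where "c = cnj (sgn z)"
  have "(\<Sum>x\<in>F. \<Sum>y\<in>F. B x y * (c * s x) * t y) = c * z"
    unfolding z_def sum_distrib_left by (intro sum.cong) (auto simp: mult_ac)
  moreover have "c * z = of_real (cmod z)"
  proof (cases "z = 0")
    case False
    have "cnj z * z = of_real ((cmod z)\<^sup>2)" by (metis complex_norm_square mult.commute of_real_power)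
    then show ?thesis using False
      by (simp add: c_def sgn_div_norm scaleR_conv_of_real field_simps power2_eq_square)
  qed simp
  ultimately have "cmod z = Re (\<Sum>x\<in>F. \<Sum>y\<in>F. B x y * (c * s x) * t y)" by simp
  also have "\<dots> \<le> (\<Sum>x\<in>F. u x * (cmod (c * s x))\<^sup>2) + (\<Sum>y\<in>F. v y * (cmod (t y))\<^sup>2)"
    by (rule assms(1))
  also have "(\<Sum>x\<in>F. u x * (cmod (c * s x))\<^sup>2) \<le> (\<Sum>x\<in>F. u x * (cmod (s x))\<^sup>2)"
  proof (intro sum_mono mult_left_mono assms(2) power_mono)
    fix x
    have "cmod c \<le> 1" by (simp add: c_def norm_sgn)
    then show "cmod (c * s x) \<le> cmod (s x)" using mult_right_mono[of "cmod c" 1 "cmod (s x)"] by (simp add: norm_mult)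
  qed auto
  finally show ?thesis by (simp add: z_def)
qed

text \<open>Coordinates of the triples \<open>(L, p, q)\<close>: \<open>Inl (x, y, False)\<close> and \<open>Inl (x, y, True)\<close> are the real and
  imaginary part of \<open>L x y\<close>, while \<open>Inr (x, False)\<close> and \<open>Inr (x, True)\<close> are \<open>p x\<close> and \<open>q x\<close>.\<close>

definition gram_cone :: "'a set \<Rightarrow> (('a \<times> 'a \<times> bool) + ('a \<times> bool) \<Rightarrow> real) set" where
  "gram_cone F = {f. \<exists>L p q. (\<forall>x y. f (Inl (x, y, False)) = Re (L x y) \<and> f (Inl (x, y, True)) = Im (L x y)) \<and>
     (\<forall>x. f (Inr (x, False)) = p x \<and> f (Inr (x, True)) = q x) \<and>
     (\<exists>(n::nat) \<alpha> \<beta>. (\<forall>x\<in>F. \<forall>y\<in>F. L x y = (\<Sum>k<n. \<alpha> x k * \<beta> y k)) \<and>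
        (\<forall>x\<in>F. (\<Sum>k<n. (cmod (\<alpha> x k))\<^sup>2) \<le> p x) \<and> (\<forall>x\<in>F. (\<Sum>k<n. (cmod (\<beta> x k))\<^sup>2) \<le> q x))}"

definition gram_coord :: "('a \<Rightarrow> 'a \<Rightarrow> complex) \<Rightarrow> ('a \<Rightarrow> real) \<Rightarrow> ('a \<Rightarrow> real) \<Rightarrow> ('a \<times> 'a \<times> bool) + ('a \<times> bool) \<Rightarrow> real" where
  "gram_coord L p q i = (case i of Inl (x, y, im) \<Rightarrow> if im then Im (L x y) else Re (L x y)
     | Inr (x, right) \<Rightarrow> if right then q x else p x)"

lemma gram_coordI:
  assumes "finite I" "\<And>x y. x \<in> F \<Longrightarrow> y \<in> F \<Longrightarrow> L x y = (\<Sum>k\<in>I. \<alpha> x k * \<beta> y k)"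
    "\<And>x. x \<in> F \<Longrightarrow> (\<Sum>k\<in>I. (cmod (\<alpha> x k))\<^sup>2) \<le> p x" "\<And>x. x \<in> F \<Longrightarrow> (\<Sum>k\<in>I. (cmod (\<beta> x k))\<^sup>2) \<le> q x"
  shows "gram_coord L p q \<in> gram_cone F"
proof -
  obtain h where h: "bij_betw h {..<card I} I"
    using ex_bij_betw_nat_finite[OF assms(1)] by (auto simp: atLeast0LessThan)
  have r: "(\<Sum>i\<in>I. f i) = (\<Sum>k<card I. f (h k))" for f :: "_ \<Rightarrow> 'z::comm_monoid_add"
    by (rule sum.reindex_bij_betw[OF h, symmetric])
  have "\<exists>(n::nat) \<alpha> \<beta>. (\<forall>x\<in>F. \<forall>y\<in>F. L x y = (\<Sum>k<n. \<alpha> x k * \<beta> y k)) \<and>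
        (\<forall>x\<in>F. (\<Sum>k<n. (cmod (\<alpha> x k))\<^sup>2) \<le> p x) \<and> (\<forall>x\<in>F. (\<Sum>k<n. (cmod (\<beta> x k))\<^sup>2) \<le> q x)"
    by (rule exI[of _ "card I"], rule exI[of _ "\<lambda>x k. \<alpha> x (h k)"], rule exI[of _ "\<lambda>x k. \<beta> x (h k)"])
      (use assms(2-4) in \<open>simp add: r\<close>)
  then show ?thesis unfolding gram_cone_def
    by (intro CollectI exI[of _ L] exI[of _ p] exI[of _ q]) (auto simp: gram_coord_def)
qed

lemma gram_coneE:
  assumes "f \<in> gram_cone F"
  obtains L p q n \<alpha> \<beta> where "f = gram_coord L p q"
    "\<forall>x\<in>F. \<forall>y\<in>F. L x y = (\<Sum>k<n. \<alpha> x k * \<beta> y k)"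
    "\<forall>x\<in>F. (\<Sum>k<(n::nat). (cmod (\<alpha> x k))\<^sup>2) \<le> p x" "\<forall>x\<in>F. (\<Sum>k<n. (cmod (\<beta> x k))\<^sup>2) \<le> q x"
proof -
  from assms[unfolded gram_cone_def, THEN CollectD] show thesis
  proof (elim exE conjE)
    fix L p q n \<alpha> \<beta>
    assume *: "\<forall>x y. f (Inl (x, y, False)) = Re (L x y) \<and> f (Inl (x, y, True)) = Im (L x y)"
      "\<forall>x. f (Inr (x, False)) = p x \<and> f (Inr (x, True)) = q x"
      and **: "\<forall>x\<in>F. \<forall>y\<in>F. L x y = (\<Sum>k<n. \<alpha> x k * \<beta> y k)"
      "\<forall>x\<in>F. (\<Sum>k<(n::nat). (cmod (\<alpha> x k))\<^sup>2) \<le> p x" "\<forall>x\<in>F. (\<Sum>k<n. (cmod (\<beta> x k))\<^sup>2) \<le> q x"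
    have "f i = gram_coord L p q i" for i
      using * by (auto simp: gram_coord_def split: sum.split prod.split)
    then show thesis by (intro that[OF _ **] ext)
  qed
qed

lemma gram_cone_add:
  assumes "f \<in> gram_cone F" "g \<in> gram_cone F"
  shows "(\<lambda>i. f i + g i) \<in> gram_cone F"
proof -
  obtain L p q n \<alpha> \<beta> where 1: "f = gram_coord L p q"
    "\<forall>x\<in>F. \<forall>y\<in>F. L x y = (\<Sum>k<n. \<alpha> x k * \<beta> y k)"
    "\<forall>x\<in>F. (\<Sum>k<(n::nat). (cmod (\<alpha> x k))\<^sup>2) \<le> p x" "\<forall>x\<in>F. (\<Sum>k<n. (cmod (\<beta> x k))\<^sup>2) \<le> q x"
    by (rule gram_coneE[OF assms(1)])
  obtain L' p' q' m \<alpha>' \<beta>' where 2: "g = gram_coord L' p' q'"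
    "\<forall>x\<in>F. \<forall>y\<in>F. L' x y = (\<Sum>k<m. \<alpha>' x k * \<beta>' y k)"
    "\<forall>x\<in>F. (\<Sum>k<(m::nat). (cmod (\<alpha>' x k))\<^sup>2) \<le> p' x" "\<forall>x\<in>F. (\<Sum>k<m. (cmod (\<beta>' x k))\<^sup>2) \<le> q' x"
    by (rule gram_coneE[OF assms(2)])
  have "gram_coord (\<lambda>x y. L x y + L' x y) (\<lambda>x. p x + p' x) (\<lambda>x. q x + q' x) \<in> gram_cone F"
    by (rule gram_coordI[where I="{..<n} <+> {..<m}" and \<alpha>="\<lambda>x. case_sum (\<alpha> x) (\<alpha>' x)"
        and \<beta>="\<lambda>x. case_sum (\<beta> x) (\<beta>' x)"]) (use 1 2 in \<open>auto simp: sum.Plus add_mono\<close>)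
  also have "gram_coord (\<lambda>x y. L x y + L' x y) (\<lambda>x. p x + p' x) (\<lambda>x. q x + q' x) = (\<lambda>i. f i + g i)"
    by (rule ext) (auto simp: gram_coord_def 1(1) 2(1) split: sum.split prod.split)
  finally show ?thesis .
qed

lemma gram_cone_scale:
  assumes "f \<in> gram_cone F" "t \<ge> 0"
  shows "(\<lambda>i. t * f i) \<in> gram_cone F"
proof -
  obtain L p q n \<alpha> \<beta> where 1: "f = gram_coord L p q"
    "\<forall>x\<in>F. \<forall>y\<in>F. L x y = (\<Sum>k<n. \<alpha> x k * \<beta> y k)"
    "\<forall>x\<in>F. (\<Sum>k<(n::nat). (cmod (\<alpha> x k))\<^sup>2) \<le> p x" "\<forall>x\<in>F. (\<Sum>k<n. (cmod (\<beta> x k))\<^sup>2) \<le> q x"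
    by (rule gram_coneE[OF assms(1)])
  let ?r = "complex_of_real (sqrt t)"
  have rr: "?r * ?r = of_real t" using assms(2) by (simp flip: of_real_mult)
  have "gram_coord (\<lambda>x y. of_real t * L x y) (\<lambda>x. t * p x) (\<lambda>x. t * q x) \<in> gram_cone F"
  proof (rule gram_coordI[where I="{..<n}" and \<alpha>="\<lambda>x k. ?r * \<alpha> x k" and \<beta>="\<lambda>x k. ?r * \<beta> x k"])
    fix x y assume "x \<in> F" "y \<in> F"
    then show "of_real t * L x y = (\<Sum>k<n. ?r * \<alpha> x k * (?r * \<beta> y k))"
      unfolding rr[symmetric] using 1(2) by (simp add: sum_distrib_left mult_ac)
  qed (use 1 assms(2) in \<open>auto simp: norm_mult power_mult_distrib sum_distrib_left[symmetric] intro!: mult_left_mono\<close>)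
  also have "gram_coord (\<lambda>x y. of_real t * L x y) (\<lambda>x. t * p x) (\<lambda>x. t * q x) = (\<lambda>i. t * f i)"
    by (rule ext) (auto simp: gram_coord_def 1(1) split: sum.split prod.split)
  finally show ?thesis .
qed

text \<open>With this sign in the imaginary part of the coefficients, the real pairing of
  coordinates is the real part of a complex bilinear one.\<close>

lemma sum_gram_coord:
  assumes "finite F"
  shows "(\<Sum>i\<in>(F \<times> F \<times> UNIV) <+> (F \<times> UNIV). b i * gram_coord L p q i) =
    Re (\<Sum>x\<in>F. \<Sum>y\<in>F. Complex (b (Inl (x, y, False))) (- b (Inl (x, y, True))) * L x y) +
    (\<Sum>x\<in>F. b (Inr (x, False)) * p x) + (\<Sum>x\<in>F. b (Inr (x, True)) * q x)"
proof -
  have 1: "(\<Sum>i\<in>F \<times> F \<times> UNIV. f i) = (\<Sum>x\<in>F. \<Sum>y\<in>F. f (x, y, False) + f (x, y, True))" for f :: "_ \<Rightarrow> real"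
    using sum.cartesian_product[of "\<lambda>x yz. f (x, yz)" "F \<times> UNIV" F, symmetric]
      sum.cartesian_product[of "\<lambda>y z. f (x, y, z)" UNIV F for x, symmetric]
    by (simp add: UNIV_bool case_prod_unfold)
  have 2: "(\<Sum>i\<in>F \<times> UNIV. f i) = (\<Sum>x\<in>F. f (x, False) + f (x, True))" for f :: "_ \<Rightarrow> real"
    using sum.cartesian_product[of "\<lambda>x y. f (x, y)" UNIV F, symmetric] by (simp add: UNIV_bool case_prod_unfold)
  show ?thesis
    using assms by (simp add: sum.Plus finite_cartesian_product 1 2 gram_coord_def sum.distrib algebra_simps)
qed

text \<open>A Schur multiplier on a finite set that is contractive up to the factor \<open>C\<close> factors through vectors of
  squared length \<open>C + e\<close>. Otherwise a functional separates \<open>(K, C, C)\<close> from the cone of all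
  \<open>(L, p, q)\<close> where \<open>L\<close> is a Gram matrix of vectors bounded by \<open>p\<close> and \<open>q\<close>; its \<open>L\<close>-part, divided by the square
  roots of its weights, is a contraction contradicting the hypothesis.\<close>

lemma schur_multiplier_factor:
  assumes F: "finite F" and C: "C \<ge> 0" and e: "e > 0"
    and mult: "\<And>a s t. (\<And>s t. cmod (\<Sum>x\<in>F. \<Sum>y\<in>F. a x y * s x * t y) \<le> ((\<Sum>x\<in>F. (cmod (s x))\<^sup>2) + (\<Sum>y\<in>F. (cmod (t y))\<^sup>2)) / 2) \<Longrightarrow>
      cmod (\<Sum>x\<in>F. \<Sum>y\<in>F. K x y * a x y * s x * t y) \<le> C * (((\<Sum>x\<in>F. (cmod (s x))\<^sup>2) + (\<Sum>y\<in>F. (cmod (t y))\<^sup>2)) / 2)"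
  shows "schur_factor F (C + e) K"
proof -
  define I :: "(('a \<times> 'a \<times> bool) + ('a \<times> bool)) set" where "I = (F \<times> F \<times> UNIV) <+> (F \<times> UNIV)"
  have I: "finite I" using F by (simp add: I_def)
  define k where "k = gram_coord K (\<lambda>_. C) (\<lambda>_. C)"
  have near: "\<exists>s\<in>gram_cone F. (\<Sum>i\<in>I. (k i - s i)\<^sup>2) < \<tau>" if "\<tau> > 0" for \<tau>
  proof (rule ccontr)
    assume "\<not> (\<exists>s\<in>gram_cone F. (\<Sum>i\<in>I. (k i - s i)\<^sup>2) < \<tau>)"
    then have far: "\<And>s. s \<in> gram_cone F \<Longrightarrow> (\<Sum>i\<in>I. (k i - s i)\<^sup>2) \<ge> \<tau>" by force
    have zero: "(\<lambda>_. 0) \<in> gram_cone F"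
    proof -
      have "gram_coord (\<lambda>_ _. 0) (\<lambda>_. 0) (\<lambda>_. 0) \<in> gram_cone F"
        by (rule gram_coordI[where I="{} :: nat set"]) auto
      also have "gram_coord (\<lambda>_ _. 0) (\<lambda>_. 0) (\<lambda>_. 0) = (\<lambda>_. 0)"
        by (rule ext) (auto simp: gram_coord_def split: sum.split prod.split)
      finally show ?thesis .
    qed
    note \<tau> = that
    obtain b where b: "\<And>s. s \<in> gram_cone F \<Longrightarrow> (\<Sum>i\<in>I. b i * s i) \<le> 0" and bk: "(\<Sum>i\<in>I. b i * k i) > 0"
      using cone_separation[OF I zero gram_cone_add gram_cone_scale \<tau> far] by blast
    define B where "B x y = Complex (b (Inl (x, y, False))) (- b (Inl (x, y, True)))" for x y
    define u where "u x = - b (Inr (x, False))" for x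
    define v where "v x = - b (Inr (x, True))" for x
    have sb: "(\<Sum>i\<in>I. b i * gram_coord L p q i) = Re (\<Sum>x\<in>F. \<Sum>y\<in>F. B x y * L x y) - (\<Sum>x\<in>F. u x * p x) - (\<Sum>x\<in>F. v x * q x)" for L p q
      unfolding I_def sum_gram_coord[OF F] by (simp add: B_def u_def v_def sum_negf)
    \<comment> \<open>The cone only asks \<open>p\<close> and \<open>q\<close> to be upper bounds,
      so it contains the directions that raise one of them, and the functional is nonpositive
      there.\<close>
    have u0: "u a \<ge> 0" and v0: "v a \<ge> 0" if "a \<in> F" for a
    proof -
      have "gram_coord (\<lambda>_ _. 0) (\<lambda>x. if x = a then 1 else 0) (\<lambda>_. 0) \<in> gram_cone F"
        by (rule gram_coordI[where I="{} :: nat set"]) auto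
      from b[OF this] that F show "u a \<ge> 0" by (simp add: sb mult_delta_right)
      have "gram_coord (\<lambda>_ _. 0) (\<lambda>_. 0) (\<lambda>x. if x = a then 1 else 0) \<in> gram_cone F"
        by (rule gram_coordI[where I="{} :: nat set"]) auto
      from b[OF this] that F show "v a \<ge> 0" by (simp add: sb mult_delta_right)
    qed
    \<comment> \<open>Rank-one kernels lie in the cone; testing on them bounds the form
      \<open>B\<close> by the weights.\<close>
    have form: "cmod (\<Sum>x\<in>F. \<Sum>y\<in>F. B x y * s x * t y) \<le> (\<Sum>x\<in>F. u x * (cmod (s x))\<^sup>2) + (\<Sum>y\<in>F. v y * (cmod (t y))\<^sup>2)" for s t
    proof (rule complex_sum_sgn_le)
      fix s t :: "'a \<Rightarrow> complex"
      have "gram_coord (\<lambda>x y. s x * t y) (\<lambda>x. (cmod (s x))\<^sup>2) (\<lambda>x. (cmod (t x))\<^sup>2) \<in> gram_cone F"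
        by (rule gram_coordI[where I="{()}" and \<alpha>="\<lambda>x _. s x" and \<beta>="\<lambda>x _. t x"]) auto
      from b[OF this] show "Re (\<Sum>x\<in>F. \<Sum>y\<in>F. B x y * s x * t y) \<le> (\<Sum>x\<in>F. u x * (cmod (s x))\<^sup>2) + (\<Sum>y\<in>F. v y * (cmod (t y))\<^sup>2)"
        unfolding sb by (simp add: mult.assoc)
    qed (use u0 in auto)
    have "Re (\<Sum>x\<in>F. \<Sum>y\<in>F. B x y * K x y) \<le> C * ((\<Sum>x\<in>F. u x) + (\<Sum>x\<in>F. v x)) + \<delta>" if "\<delta> > 0" for \<delta>
    proof -
      \<comment> \<open>The weights may vanish, so \<open>\<epsilon>\<close> is added before
        dividing by their square roots; its size keeps the loss
        \<open>2 * C * card F * \<epsilon>\<close> below \<open>\<delta>\<close>. The factor 2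
        inside \<open>S\<close> and \<open>T\<close> matches the division by 2 in the contraction
        condition.\<close>
      define \<epsilon> where "\<epsilon> = \<delta> / (2 * (C + 1) * (card F + 1))"
      have \<epsilon>: "\<epsilon> > 0" unfolding \<epsilon>_def using that C by (intro divide_pos_pos mult_pos_pos) auto
      define u' where "u' x = u x + \<epsilon>" for x
      define v' where "v' x = v x + \<epsilon>" for x
      define S where "S x = complex_of_real (sqrt (2 * u' x))" for x
      define T where "T x = complex_of_real (sqrt (2 * v' x))" for x
      have pos: "u' x > 0" "v' x > 0" if "x \<in> F" for x using u0[OF that] v0[OF that] \<epsilon> by (auto simp: u'_def v'_def)
      have ST: "(cmod (S x))\<^sup>2 = 2 * u' x" "(cmod (T x))\<^sup>2 = 2 * v' x" "S x \<noteq> 0" "T x \<noteq> 0" if "x \<in> F" for x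
        using pos[OF that] by (auto simp: S_def T_def)
      define a where "a x y = B x y / (S x * T y)" for x y
      have contr: "cmod (\<Sum>x\<in>F. \<Sum>y\<in>F. a x y * s x * t y) \<le> ((\<Sum>x\<in>F. (cmod (s x))\<^sup>2) + (\<Sum>y\<in>F. (cmod (t y))\<^sup>2)) / 2" for s t
      proof -
        have "(\<Sum>x\<in>F. \<Sum>y\<in>F. a x y * s x * t y) = (\<Sum>x\<in>F. \<Sum>y\<in>F. B x y * (s x / S x) * (t y / T y))"
          by (intro sum.cong) (auto simp: a_def)
        then have "cmod (\<Sum>x\<in>F. \<Sum>y\<in>F. a x y * s x * t y) \<le> (\<Sum>x\<in>F. u x * (cmod (s x / S x))\<^sup>2) + (\<Sum>y\<in>F. v y * (cmod (t y / T y))\<^sup>2)"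
          using form[of "\<lambda>x. s x / S x" "\<lambda>x. t x / T x"] by simp
        also have "\<dots> \<le> (\<Sum>x\<in>F. (cmod (s x))\<^sup>2 / 2) + (\<Sum>y\<in>F. (cmod (t y))\<^sup>2 / 2)"
        proof (intro add_mono sum_mono)
          fix x assume x: "x \<in> F"
          have "u x * ((cmod (s x))\<^sup>2 / (2 * u' x)) \<le> u' x * ((cmod (s x))\<^sup>2 / (2 * u' x))"
            using pos[OF x] \<epsilon> by (intro mult_right_mono) (auto simp: u'_def)
          then show "u x * (cmod (s x / S x))\<^sup>2 \<le> (cmod (s x))\<^sup>2 / 2"
            using pos[OF x] by (simp add: norm_divide power_divide ST x)
          have "v x * ((cmod (t x))\<^sup>2 / (2 * v' x)) \<le> v' x * ((cmod (t x))\<^sup>2 / (2 * v' x))"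
            using pos[OF x] \<epsilon> by (intro mult_right_mono) (auto simp: v'_def)
          then show "v x * (cmod (t x / T x))\<^sup>2 \<le> (cmod (t x))\<^sup>2 / 2"
            using pos[OF x] by (simp add: norm_divide power_divide ST x)
        qed
        finally show ?thesis by (simp add: sum_divide_distrib add_divide_distrib)
      qed
      have "Re (\<Sum>x\<in>F. \<Sum>y\<in>F. B x y * K x y) \<le> cmod (\<Sum>x\<in>F. \<Sum>y\<in>F. K x y * a x y * S x * T y)"
      proof -
        have "(\<Sum>x\<in>F. \<Sum>y\<in>F. K x y * a x y * S x * T y) = (\<Sum>x\<in>F. \<Sum>y\<in>F. B x y * K x y)"
          by (intro sum.cong) (auto simp: a_def ST)
        then show ?thesis unfolding \<open>(\<Sum>x\<in>F. \<Sum>y\<in>F. K x y * a x y * S x * T y) = _\<close> by (intro complex_Re_le_cmod)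
      qed
      also have "\<dots> \<le> C * (((\<Sum>x\<in>F. (cmod (S x))\<^sup>2) + (\<Sum>y\<in>F. (cmod (T y))\<^sup>2)) / 2)"
        by (rule mult[OF contr])
      also have "(\<Sum>x\<in>F. (cmod (S x))\<^sup>2) = 2 * ((\<Sum>x\<in>F. u x) + card F * \<epsilon>)"
        by (simp add: ST sum.distrib u'_def flip: sum_distrib_left)
      also have "(\<Sum>x\<in>F. (cmod (T x))\<^sup>2) = 2 * ((\<Sum>x\<in>F. v x) + card F * \<epsilon>)"
        by (simp add: ST sum.distrib v'_def flip: sum_distrib_left)
      also have "C * ((2 * ((\<Sum>x\<in>F. u x) + card F * \<epsilon>) + 2 * ((\<Sum>x\<in>F. v x) + card F * \<epsilon>)) / 2) =
          C * ((\<Sum>x\<in>F. u x) + (\<Sum>x\<in>F. v x)) + 2 * C * card F * \<epsilon>" by (simp add: algebra_simps)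
      also have "2 * C * card F * \<epsilon> \<le> 2 * (C + 1) * (card F + 1) * \<epsilon>"
        using C \<epsilon> by (intro mult_right_mono mult_mono) auto
      also have "\<dots> = \<delta>" using C by (simp add: \<epsilon>_def)
      finally show ?thesis by simp
    qed
    then have "Re (\<Sum>x\<in>F. \<Sum>y\<in>F. B x y * K x y) \<le> C * ((\<Sum>x\<in>F. u x) + (\<Sum>x\<in>F. v x))"
      by (rule field_le_epsilon)
    moreover have "C * (\<Sum>x\<in>F. u x) = (\<Sum>x\<in>F. u x * C)" "C * (\<Sum>x\<in>F. v x) = (\<Sum>x\<in>F. v x * C)"
      by (simp_all add: sum_distrib_left mult.commute)
    ultimately show False using bk unfolding k_def sb by (simp add: distrib_left)
  qed
  \<comment> \<open>Squared lengths are off by at most \<open>\<sigma>\<close> and entries by at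
    most \<open>2 * \<sigma>\<close>, one for the real and one for the imaginary part. Together this
    is \<open>(2 * (card F)\<^sup>2 + 1) * \<sigma> = e\<close>.\<close>
  define \<sigma> where "\<sigma> = e / (2 * (card F)\<^sup>2 + 1)"
  have card_pos: "0 < 2 * (real (card F))\<^sup>2 + 1" by (rule add_nonneg_pos) auto
  have \<sigma>: "\<sigma> > 0" using e card_pos by (simp add: \<sigma>_def)
  obtain s where s: "s \<in> gram_cone F" "(\<Sum>i\<in>I. (k i - s i)\<^sup>2) < \<sigma>\<^sup>2" using near[of "\<sigma>\<^sup>2"] \<sigma> by auto
  have close: "\<bar>k i - s i\<bar> \<le> \<sigma>" if "i \<in> I" for i
  proof -
    have "(k i - s i)\<^sup>2 \<le> (\<Sum>i\<in>I. (k i - s i)\<^sup>2)" by (rule member_le_sum[OF that]) (auto simp: I)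
    then have "(k i - s i)\<^sup>2 \<le> \<sigma>\<^sup>2" using s(2) by linarith
    then show ?thesis using \<sigma> by (metis abs_le_square_iff abs_of_pos)
  qed
  obtain L p q n \<alpha> \<beta> where L: "s = gram_coord L p q"
    "\<forall>x\<in>F. \<forall>y\<in>F. L x y = (\<Sum>k<n. \<alpha> x k * \<beta> y k)"
    "\<forall>x\<in>F. (\<Sum>k<(n::nat). (cmod (\<alpha> x k))\<^sup>2) \<le> p x" "\<forall>x\<in>F. (\<Sum>k<n. (cmod (\<beta> x k))\<^sup>2) \<le> q x"
    by (rule gram_coneE[OF s(1)])
  have pq: "p x \<le> C + \<sigma>" "q x \<le> C + \<sigma>" if "x \<in> F" for x
    using close[of "Inr (x, False)"] close[of "Inr (x, True)"] that
    by (auto simp: I_def k_def L(1) gram_coord_def InrI)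
  have ent: "cmod (K x y - L x y) \<le> 2 * \<sigma>" if "x \<in> F" "y \<in> F" for x y
  proof -
    have "\<bar>Re (K x y - L x y)\<bar> \<le> \<sigma>" "\<bar>Im (K x y - L x y)\<bar> \<le> \<sigma>"
      using close[of "Inl (x, y, False)"] close[of "Inl (x, y, True)"] that
      by (auto simp: I_def k_def L(1) gram_coord_def InlI)
    then show ?thesis using cmod_le[of "K x y - L x y"] by linarith
  qed
  have 1: "schur_factor F (C + \<sigma>) L"
    by (rule schur_factorI[where I="{..<n}" and \<alpha>=\<alpha> and \<beta>=\<beta>]) (use L pq in \<open>auto intro: order_trans\<close>)
  have "(\<Sum>x\<in>F. \<Sum>y\<in>F. cmod (K x y - L x y)) \<le> (\<Sum>x\<in>F. \<Sum>y\<in>F. 2 * \<sigma>)"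
    by (intro sum_mono ent)
  also have "\<dots> = 2 * (card F)\<^sup>2 * \<sigma>" by (simp add: power2_eq_square)
  finally have "(C + \<sigma>) + (\<Sum>x\<in>F. \<Sum>y\<in>F. cmod (K x y - L x y)) \<le> C + (2 * (card F)\<^sup>2 + 1) * \<sigma>" by (simp add: algebra_simps)
  also have "(2 * (card F)\<^sup>2 + 1) * \<sigma> = e"
    using card_pos by (simp add: \<sigma>_def)
  finally have 2: "(C + \<sigma>) + (\<Sum>x\<in>F. \<Sum>y\<in>F. cmod (K x y - L x y)) \<le> C + e" .
  have "schur_factor F ((C + \<sigma>) + (\<Sum>x\<in>F. \<Sum>y\<in>F. cmod (K x y - L x y))) (\<lambda>x y. L x y + (K x y - L x y))"
    by (rule schur_factor_add[OF 1 schur_factor_entries[OF F]])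
  from schur_factor_mono[OF this 2 order_refl] show ?thesis by simp
qed

section \<open>The cb-norm in terms of Schur multipliers\<close>

lemma cmod_sum_mult_le:
  fixes a b :: "'i \<Rightarrow> complex"
  shows "(cmod (\<Sum>k\<in>I. a k * b k))\<^sup>2 \<le> (\<Sum>k\<in>I. (cmod (a k))\<^sup>2) * (\<Sum>k\<in>I. (cmod (b k))\<^sup>2)"
proof -
  have "cmod (\<Sum>k\<in>I. a k * b k) \<le> (\<Sum>k\<in>I. cmod (a k) * cmod (b k))"
    by (metis (no_types, lifting) norm_mult norm_sum sum.cong)
  then have "(cmod (\<Sum>k\<in>I. a k * b k))\<^sup>2 \<le> (\<Sum>k\<in>I. cmod (a k) * cmod (b k))\<^sup>2"
    by (rule power_mono) simp
  also have "\<dots> \<le> (\<Sum>k\<in>I. (cmod (a k))\<^sup>2) * (\<Sum>k\<in>I. (cmod (b k))\<^sup>2)"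
    by (rule Cauchy_Schwarz_ineq_sum)
  finally show ?thesis .
qed

lemma infsum_finite_support:
  fixes f :: "'a \<Rightarrow> real"
  assumes "finite W" "W \<subseteq> X" "\<And>x. x \<in> X - W \<Longrightarrow> f x = 0"
  shows "f summable_on X" "infsum f X = sum f W"
proof -
  have "(f has_sum sum f W) W" using assms(1) by (rule has_sum_finite)
  then have "(f has_sum sum f W) X"
    by (rule has_sum_cong_neutral[THEN iffD1, rotated -1]) (use assms in auto)
  then show "f summable_on X" "infsum f X = sum f W" unfolding summable_on_def using infsumI by blast+
qed

text \<open>Reduces l2 estimates to finite partial sums; summability follows from the uniform bound
  and need not be known beforehand.\<close>

lemma sum_infsum_le:
  fixes f :: "'i \<Rightarrow> 'a \<Rightarrow> real"
  assumes I: "finite I" and nn: "\<And>i x. i \<in> I \<Longrightarrow> f i x \<ge> 0"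
    and le: "\<And>W. finite W \<Longrightarrow> W \<subseteq> X \<Longrightarrow> (\<Sum>i\<in>I. \<Sum>x\<in>W. f i x) \<le> B"
  shows "(\<Sum>i\<in>I. infsum (f i) X) \<le> B"
proof -
  have summ: "f i summable_on X" if "i \<in> I" for i
  proof (rule nonneg_bdd_above_summable_on)
    have "sum (f i) W \<le> B" if "W \<subseteq> X" "finite W" for W
    proof -
      have "sum (f i) W \<le> (\<Sum>i\<in>I. \<Sum>x\<in>W. f i x)"
        using member_le_sum[OF \<open>i \<in> I\<close>, of "\<lambda>i. sum (f i) W"] nn I by (simp add: sum_nonneg)
      then show ?thesis using le[OF that(2,1)] by linarith
    qed
    then show "bdd_above (sum (f i) ` {F. F \<subseteq> X \<and> finite F})" by (auto intro!: bdd_aboveI[of _ B])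
  qed (use nn that in auto)
  have hs: "((\<lambda>x. \<Sum>i\<in>J. f i x) has_sum (\<Sum>i\<in>J. infsum (f i) X)) X" if "J \<subseteq> I" for J
    using finite_subset[OF that I] that
  proof (induction J)
    case (insert i J)
    then have "(f i has_sum infsum (f i) X) X" "((\<lambda>x. \<Sum>i\<in>J. f i x) has_sum (\<Sum>i\<in>J. infsum (f i) X)) X"
      using summ[of i] by auto
    from has_sum_add[OF this] show ?case using insert.hyps by simp
  qed simp
  show ?thesis
    by (rule has_sum_le_finite_sums[OF hs[OF order_refl]]) (use le in \<open>simp add: sum.swap[of _ I]\<close>)
qed

lemma l2_normsq_nonneg: "l2_normsq G \<xi> \<ge> 0"
  unfolding l2_normsq_def by (rule infsum_nonneg) auto

lemma l2_normsq_scale: "l2_normsq G (\<lambda>h. c * \<xi> h) = (cmod c)\<^sup>2 * l2_normsq G \<xi>"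
  unfolding l2_normsq_def by (simp add: norm_mult power_mult_distrib infsum_cmult_right')

lemma l2_vec_scale: "l2_vec G \<xi> \<Longrightarrow> l2_vec G (\<lambda>h. c * \<xi> h)"
  unfolding l2_vec_def by (auto simp: norm_mult power_mult_distrib intro: summable_on_cmult_right)

lemma lreg_scale: "lreg G a (\<lambda>h. c * \<xi> h) k = c * lreg G a \<xi> k"
  unfolding lreg_def sum_distrib_left by (intro sum.cong) (auto simp: mult_ac)

lemma lreg_eq_sum:
  assumes "finite S" "S \<subseteq> carrier G" "\<And>g. g \<in> carrier G \<Longrightarrow> a g \<noteq> 0 \<Longrightarrow> g \<in> S"
  shows "lreg G a \<xi> k = (\<Sum>g\<in>S. a g * \<xi> (inv\<^bsub>G\<^esub> g \<otimes>\<^bsub>G\<^esub> k))"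
  unfolding lreg_def by (rule sum.mono_neutral_left) (use assms in auto)

lemma lreg_single:
  assumes "g0 \<in> carrier G"
  shows "lreg G (\<lambda>g. if g = g0 then c else 0) \<xi> k = c * \<xi> (inv\<^bsub>G\<^esub> g0 \<otimes>\<^bsub>G\<^esub> k)"
  by (subst lreg_eq_sum[of "{g0}"]) (use assms in \<open>auto split: if_splits\<close>)

lemma mat_norm_leI:
  assumes "C \<ge> 0"
    and "\<And>xi. (\<And>j. j < n \<Longrightarrow> l2_vec G (xi j)) \<Longrightarrow> (\<Sum>j<n. l2_normsq G (xi j)) \<le> 1 \<Longrightarrow>
      (\<Sum>i<n. l2_normsq G (\<lambda>h. \<Sum>j<n. lreg G (A i j) (xi j) h)) \<le> C\<^sup>2"
  shows "mat_norm G n A \<le> ereal C"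
  unfolding mat_norm_def
proof (rule Sup_least, elim CollectE exE conjE)
  fix z xi
  assume z: "z = ereal (sqrt (\<Sum>i<n. l2_normsq G (\<lambda>h. \<Sum>j<n. lreg G (A i j) (xi j) h)))"
    and "\<forall>j<n. l2_vec G (xi j)" "(\<Sum>j<n. l2_normsq G (xi j)) \<le> 1"
  then have "(\<Sum>i<n. l2_normsq G (\<lambda>h. \<Sum>j<n. lreg G (A i j) (xi j) h)) \<le> C\<^sup>2" by (intro assms(2)) auto
  then show "z \<le> ereal C" unfolding z ereal_less_eq by (rule real_le_lsqrt[OF assms(1)])
qed

lemma mat_normD:
  assumes norm: "mat_norm G n A \<le> ereal C" and C: "C \<ge> 0" and xi: "\<And>j. j < n \<Longrightarrow> l2_vec G (xi j)"
  shows "(\<Sum>i<n. l2_normsq G (\<lambda>h. \<Sum>j<n. lreg G (A i j) (xi j) h)) \<le> C\<^sup>2 * (\<Sum>j<n. l2_normsq G (xi j))"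
proof -
  define L where "L = (\<Sum>i<n. l2_normsq G (\<lambda>h. \<Sum>j<n. lreg G (A i j) (xi j) h))"
  define N where "N = (\<Sum>j<n. l2_normsq G (xi j))"
  have N0: "N \<ge> 0" unfolding N_def by (intro sum_nonneg l2_normsq_nonneg)
  \<comment> \<open>\<open>N\<close> may be 0, so the vectors are normalized with
    \<open>N + \<epsilon>\<close>.\<close>
  have *: "L \<le> C\<^sup>2 * (N + \<epsilon>)" if "\<epsilon> > 0" for \<epsilon>
  proof -
    define c where "c = complex_of_real (1 / sqrt (N + \<epsilon>))"
    have c2: "(cmod c)\<^sup>2 = 1 / (N + \<epsilon>)" using N0 that by (simp add: c_def power_divide norm_divide)
    have "(\<Sum>j<n. l2_normsq G (\<lambda>h. c * xi j h)) = (cmod c)\<^sup>2 * N"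
      by (simp add: l2_normsq_scale N_def sum_distrib_left)
    also have "\<dots> \<le> 1" using c2 N0 that by simp
    finally have "ereal (sqrt (\<Sum>i<n. l2_normsq G (\<lambda>h. \<Sum>j<n. lreg G (A i j) (\<lambda>h. c * xi j h) h))) \<le> mat_norm G n A"
      unfolding mat_norm_def using xi by (intro Sup_upper CollectI exI[of _ "\<lambda>j h. c * xi j h"] conjI refl) (simp_all add: l2_vec_scale)
    also have "(\<Sum>i<n. l2_normsq G (\<lambda>h. \<Sum>j<n. lreg G (A i j) (\<lambda>h. c * xi j h) h)) = (cmod c)\<^sup>2 * L"
      by (simp add: lreg_scale sum_distrib_left[symmetric] l2_normsq_scale L_def)
    finally have "ereal (sqrt ((cmod c)\<^sup>2 * L)) \<le> ereal C" using norm by (rule order_trans)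
    then have "(cmod c)\<^sup>2 * L \<le> C\<^sup>2" using sqrt_le_D by simp
    then show ?thesis using N0 that unfolding c2 by (simp add: field_simps)
  qed
  have "L \<le> C\<^sup>2 * N + \<delta>" if "\<delta> > 0" for \<delta>
  proof -
    have p: "C\<^sup>2 + 1 > 0" by (simp add: add_nonneg_pos)
    have "L \<le> C\<^sup>2 * (N + \<delta> / (C\<^sup>2 + 1))" using that p by (intro *) (rule divide_pos_pos)
    also have "\<dots> = C\<^sup>2 * N + \<delta> * (C\<^sup>2 / (C\<^sup>2 + 1))" by (simp add: algebra_simps)
    also have "\<delta> * (C\<^sup>2 / (C\<^sup>2 + 1)) \<le> \<delta> * 1" using that p by (intro mult_left_mono) auto
    finally show ?thesis by simp
  qed
  then have "L \<le> C\<^sup>2 * N" by (rule field_le_epsilon)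
  then show ?thesis by (simp add: L_def N_def)
qed

text \<open>Taking for \<open>s\<close> the conjugate of the image of \<open>t\<close> makes the
  form equal to the squared norm \<open>X\<close> of the image, and
  \<open>X \<le> (X + T) / 2\<close> gives \<open>X \<le> T\<close>, where \<open>T\<close> is the
  squared norm of \<open>t\<close>.\<close>

lemma contraction_norm_le:
  fixes t :: "'a \<Rightarrow> complex"
  assumes "\<And>s t. cmod (\<Sum>x\<in>F. \<Sum>y\<in>F. a x y * s x * t y) \<le> ((\<Sum>x\<in>F. (cmod (s x))\<^sup>2) + (\<Sum>y\<in>F. (cmod (t y))\<^sup>2)) / 2"
  shows "(\<Sum>x\<in>F. (cmod (\<Sum>y\<in>F. a x y * t y))\<^sup>2) \<le> (\<Sum>y\<in>F. (cmod (t y))\<^sup>2)"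
proof -
  define w where "w x = (\<Sum>y\<in>F. a x y * t y)" for x
  have "cnj (w x) * (\<Sum>y\<in>F. a x y * t y) = (\<Sum>y\<in>F. a x y * cnj (w x) * t y)" for x
    by (simp add: sum_distrib_left mult_ac)
  then have "(\<Sum>x\<in>F. \<Sum>y\<in>F. a x y * cnj (w x) * t y) = (\<Sum>x\<in>F. w x * cnj (w x))"
    unfolding w_def[symmetric] by (metis (no_types, lifting) mult.commute sum.cong)
  also have "\<dots> = of_real (\<Sum>x\<in>F. (cmod (w x))\<^sup>2)"
    by (simp add: complex_norm_square del: of_real_power)
  finally have "cmod (of_real (\<Sum>x\<in>F. (cmod (w x))\<^sup>2)) \<le> ((\<Sum>x\<in>F. (cmod (cnj (w x)))\<^sup>2) + (\<Sum>y\<in>F. (cmod (t y))\<^sup>2)) / 2"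
    using assms[of "\<lambda>x. cnj (w x)" t] by simp
  moreover have "cmod (of_real (\<Sum>x\<in>F. (cmod (w x))\<^sup>2)) = (\<Sum>x\<in>F. (cmod (w x))\<^sup>2)"
    unfolding norm_of_real by (simp add: sum_nonneg)
  moreover have "cmod (cnj (w x)) = cmod (w x)" for x by simp
  ultimately have "(\<Sum>x\<in>F. (cmod (w x))\<^sup>2) \<le> (\<Sum>y\<in>F. (cmod (t y))\<^sup>2)" by simp
  then show ?thesis unfolding w_def .
qed

text \<open>The scalar matrix \<open>a\<close> on a finite set \<open>F\<close> is turned into the matrix with entries
  \<open>a x y\<close> times the group element \<open>x\<inverse>y\<close>, which is unitarily equivalent to the amplification of \<open>a\<close>.\<close>

lemma cb_norm_schur_bound:
  fixes G (structure)
  assumes G: "group G" and cb: "cb_norm G \<phi> \<le> ereal C" and C: "C \<ge> 0"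
    and F: "finite F" "F \<subseteq> carrier G"
    and a: "\<And>s t. cmod (\<Sum>x\<in>F. \<Sum>y\<in>F. a x y * s x * t y) \<le> ((\<Sum>x\<in>F. (cmod (s x))\<^sup>2) + (\<Sum>y\<in>F. (cmod (t y))\<^sup>2)) / 2"
  shows "(\<Sum>x\<in>F. (cmod (\<Sum>y\<in>F. \<phi> (inv\<^bsub>G\<^esub> x \<otimes>\<^bsub>G\<^esub> y) * a x y * t y))\<^sup>2) \<le> C\<^sup>2 * (\<Sum>y\<in>F. (cmod (t y))\<^sup>2)"
proof -
  interpret group G by (rule G)
  define n where "n = card F"
  obtain p where p: "bij_betw p {..<n} F"
    using ex_bij_betw_nat_finite[OF F(1)] by (auto simp: atLeast0LessThan n_def)
  have re: "(\<Sum>i\<in>F. f i) = (\<Sum>k<n. f (p k))" for f :: "_ \<Rightarrow> 'z::comm_monoid_add"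
    by (rule sum.reindex_bij_betw[OF p, symmetric])
  have pF: "p i \<in> F" "p i \<in> carrier G" if "i < n" for i using p that F by (auto simp: bij_betw_def)
  define q where "q i j = inv (p i) \<otimes> p j" for i j
  have q: "q i j \<in> carrier G" if "i < n" "j < n" for i j using pF that by (simp add: q_def)
  have q_mult: "inv (q i j) \<otimes> (inv (p i) \<otimes> m) = inv (p j) \<otimes> m" if "i < n" "j < n" "m \<in> carrier G" for i j m
  proof -
    have "inv (q i j) \<otimes> (inv (p i) \<otimes> m) = inv (p j) \<otimes> (p i \<otimes> (inv (p i) \<otimes> m))"
      using pF(2) that by (simp add: q_def inv_mult_group m_assoc)
    also have "p i \<otimes> (inv (p i) \<otimes> m) = m" using pF(2) that by (simp flip: m_assoc)
    finally show ?thesis .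
  qed
  define A where "A i j = (\<lambda>g. if g = q i j then a (p i) (p j) else 0)" for i j
  have "mat_norm G n A \<le> ereal 1"
  proof (rule mat_norm_leI)
    fix xi assume xi: "\<And>j. j < n \<Longrightarrow> l2_vec G (xi j)" and le1: "(\<Sum>j<n. l2_normsq G (xi j)) \<le> 1"
    \<comment> \<open>Translating row \<open>i\<close> by \<open>p i\<close> removes the group
      elements: for each fixed \<open>m\<close>, only the scalar matrix \<open>a\<close> acts, on
      the numbers \<open>xi j (inv (p j) \<otimes> m)\<close>.\<close>
    define f where "f i m = (cmod (\<Sum>j<n. a (p i) (p j) * xi j (inv (p j) \<otimes> m)))\<^sup>2" for i m
    have tr: "bij_betw (\<lambda>m. inv x \<otimes> m) (carrier G) (carrier G)" if "x \<in> carrier G" for x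
      by (rule bij_betw_byWitness[where f'="\<lambda>m. x \<otimes> m"]) (use that in \<open>auto simp flip: m_assoc\<close>)
    have "l2_normsq G (\<lambda>h. \<Sum>j<n. lreg G (A i j) (xi j) h) = infsum (f i) (carrier G)" if "i < n" for i
    proof -
      have "l2_normsq G (\<lambda>h. \<Sum>j<n. lreg G (A i j) (xi j) h) =
        infsum (\<lambda>m. (cmod (\<Sum>j<n. lreg G (A i j) (xi j) (inv (p i) \<otimes> m)))\<^sup>2) (carrier G)"
        unfolding l2_normsq_def
        by (rule infsum_reindex_bij_betw[OF tr[OF pF(2)[OF that]], symmetric])
      also have "\<dots> = infsum (f i) (carrier G)"
        using that q by (intro infsum_cong) (simp add: f_def A_def lreg_single q_mult)
      finally show ?thesis .
    qed
    then have "(\<Sum>i<n. l2_normsq G (\<lambda>h. \<Sum>j<n. lreg G (A i j) (xi j) h)) = (\<Sum>i<n. infsum (f i) (carrier G))"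
      by simp
    also have "\<dots> \<le> 1"
    proof (rule sum_infsum_le)
      fix W assume W: "finite W" "W \<subseteq> carrier G"
      have "(\<Sum>i<n. \<Sum>m\<in>W. f i m) = (\<Sum>m\<in>W. \<Sum>i<n. f i m)" by (rule sum.swap)
      also have "\<dots> \<le> (\<Sum>m\<in>W. \<Sum>j<n. (cmod (xi j (inv (p j) \<otimes> m)))\<^sup>2)"
      proof (rule sum_mono)
        fix m assume "m \<in> W"
        define t where "t x = xi (the_inv_into {..<n} p x) (inv x \<otimes> m)" for x
        have "t (p j) = xi j (inv (p j) \<otimes> m)" if "j < n" for j
          using p that by (simp add: t_def bij_betw_def the_inv_into_f_f)
        then show "(\<Sum>i<n. f i m) \<le> (\<Sum>j<n. (cmod (xi j (inv (p j) \<otimes> m)))\<^sup>2)"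
          using contraction_norm_le[OF a, of t] by (simp add: re f_def)
      qed
      also have "\<dots> = (\<Sum>j<n. \<Sum>m\<in>W. (cmod (xi j (inv (p j) \<otimes> m)))\<^sup>2)" by (rule sum.swap)
      also have "\<dots> \<le> (\<Sum>j<n. l2_normsq G (xi j))"
      proof (rule sum_mono)
        fix j assume "j \<in> {..<n}"
        then have j: "j < n" by simp
        have inj: "inj_on (\<lambda>m. inv (p j) \<otimes> m) W" using tr[OF pF(2)[OF j]] W by (auto simp: bij_betw_def inj_on_subset)
        have "(\<Sum>m\<in>W. (cmod (xi j (inv (p j) \<otimes> m)))\<^sup>2) = (\<Sum>k\<in>(\<lambda>m. inv (p j) \<otimes> m) ` W. (cmod (xi j k))\<^sup>2)"
          by (simp add: sum.reindex[OF inj])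
        also have "\<dots> \<le> l2_normsq G (xi j)"
          unfolding l2_normsq_def using xi[OF j] W pF(2)[OF j]
          by (intro finite_sum_le_infsum) (auto simp: l2_vec_def)
        finally show "(\<Sum>m\<in>W. (cmod (xi j (inv (p j) \<otimes> m)))\<^sup>2) \<le> l2_normsq G (xi j)" .
      qed
      also have "\<dots> \<le> 1" by (rule le1)
      finally show "(\<Sum>i<n. \<Sum>m\<in>W. f i m) \<le> 1" .
    qed (auto simp: f_def)
    finally show "(\<Sum>i<n. l2_normsq G (\<lambda>h. \<Sum>j<n. lreg G (A i j) (xi j) h)) \<le> 1\<^sup>2" by simp
  qed simp
  moreover have "\<forall>i<n. \<forall>j<n. fin_supp G (A i j)" by (auto simp: fin_supp_def A_def intro: finite_subset[of _ "{_}"])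
  ultimately have "mat_norm G n (\<lambda>i j g. \<phi> g * A i j g) \<le> cb_norm G \<phi>"
    unfolding cb_norm_def by (intro Sup_upper CollectI exI[of _ n] exI[of _ A]) (simp add: one_ereal_def)
  then have norm: "mat_norm G n (\<lambda>i j g. \<phi> g * A i j g) \<le> ereal C" using cb by (rule order_trans)
  \<comment> \<open>The group element \<open>q i j\<close> moves \<open>inv (p j)\<close> to
    \<open>inv (p i)\<close>. With these point masses all terms of row \<open>i\<close> land on the
    same basis vector, so the scalars add up.\<close>
  define xi where "xi j k = (if k = inv (p j) then t (p j) else 0)" for j k
  have xi_supp: "xi j k = 0" if "k \<notin> {inv (p j)}" for j k using that by (simp add: xi_def)
  have "l2_vec G (xi j)" if "j < n" for j
  proof -
    have "(\<lambda>g. (cmod (xi j g))\<^sup>2) summable_on carrier G"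
      by (rule infsum_finite_support[of "{inv (p j)}"]) (use pF that in \<open>auto simp: xi_def\<close>)
    then show ?thesis using pF(2)[OF that] by (auto simp: l2_vec_def xi_def)
  qed
  note D = mat_normD[OF norm C this, of "\<lambda>j. j"]
  have "l2_normsq G (xi j) = (cmod (t (p j)))\<^sup>2" if "j < n" for j
    unfolding l2_normsq_def
    by (subst infsum_finite_support(2)[of "{inv (p j)}"]) (use pF that in \<open>auto simp: xi_def\<close>)
  then have R: "(\<Sum>j<n. l2_normsq G (xi j)) = (\<Sum>y\<in>F. (cmod (t y))\<^sup>2)" by (simp add: re)
  have "l2_normsq G (\<lambda>h. \<Sum>j<n. lreg G (\<lambda>g. \<phi> g * A i j g) (xi j) h) =
      (cmod (\<Sum>j<n. \<phi> (q i j) * a (p i) (p j) * t (p j)))\<^sup>2" if i: "i < n" for i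
  proof -
    have lr: "lreg G (\<lambda>g. \<phi> g * A i j g) (xi j) k = (\<phi> (q i j) * a (p i) (p j)) * xi j (inv (q i j) \<otimes> k)" if "j < n" for j k
    proof -
      have "(\<lambda>g. \<phi> g * A i j g) = (\<lambda>g. if g = q i j then \<phi> (q i j) * a (p i) (p j) else 0)"
        by (auto simp: A_def)
      then show ?thesis using lreg_single[OF q[OF i that]] by metis
    qed
    have only: "xi j (inv (q i j) \<otimes> k) = (if k = inv (p i) then t (p j) else 0)" if "j < n" "k \<in> carrier G" for j k
    proof -
      have "inv (q i j) \<otimes> k = inv (p j) \<longleftrightarrow> k = inv (p i)"
      proof -
        have 1: "inv (q i j) \<otimes> inv (p i) = inv (p j)" using q_mult[OF i that(1) one_closed] pF that i by simp
        have "inv (q i j) \<otimes> k = inv (q i j) \<otimes> inv (p i) \<longleftrightarrow> k = inv (p i)"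
          using q[OF i that(1)] pF(2)[OF i] that by simp
        then show ?thesis unfolding 1 .
      qed
      then show ?thesis by (simp add: xi_def)
    qed
    show ?thesis unfolding l2_normsq_def
      by (subst infsum_finite_support(2)[of "{inv (p i)}"])
        (use pF i in \<open>auto simp: lr only sum_distrib_left[symmetric] intro!: sum.neutral\<close>)
  qed
  then have "(\<Sum>i<n. l2_normsq G (\<lambda>h. \<Sum>j<n. lreg G (\<lambda>g. \<phi> g * A i j g) (xi j) h)) =
      (\<Sum>x\<in>F. (cmod (\<Sum>y\<in>F. \<phi> (inv x \<otimes> y) * a x y * t y))\<^sup>2)"
    by (simp add: re q_def)
  then show ?thesis using D unfolding R by simp
qed

lemma schur_factor_if_cb_norm:
  assumes G: "group G" and cb: "cb_norm G \<phi> \<le> ereal C" and C: "C > 0" and "e > 0"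
    and F: "finite F" "F \<subseteq> carrier G"
  shows "schur_factor F (C + e) (\<lambda>x y. \<phi> (inv\<^bsub>G\<^esub> x \<otimes>\<^bsub>G\<^esub> y))"
proof (rule schur_multiplier_factor)
  fix a and s t :: "_ \<Rightarrow> complex"
  assume a: "\<And>s t. cmod (\<Sum>x\<in>F. \<Sum>y\<in>F. a x y * s x * t y) \<le> ((\<Sum>x\<in>F. (cmod (s x))\<^sup>2) + (\<Sum>y\<in>F. (cmod (t y))\<^sup>2)) / 2"
  define w where "w x = (\<Sum>y\<in>F. \<phi> (inv\<^bsub>G\<^esub> x \<otimes>\<^bsub>G\<^esub> y) * a x y * t y)" for x
  have W: "(\<Sum>x\<in>F. (cmod (w x))\<^sup>2) \<le> C\<^sup>2 * (\<Sum>y\<in>F. (cmod (t y))\<^sup>2)"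
    unfolding w_def using cb_norm_schur_bound[OF G cb _ F a] C by simp
  have "(\<Sum>x\<in>F. \<Sum>y\<in>F. \<phi> (inv\<^bsub>G\<^esub> x \<otimes>\<^bsub>G\<^esub> y) * a x y * s x * t y) = (\<Sum>x\<in>F. s x * w x)"
    unfolding w_def sum_distrib_left by (intro sum.cong) (auto simp: mult_ac)
  then have "cmod (\<Sum>x\<in>F. \<Sum>y\<in>F. \<phi> (inv\<^bsub>G\<^esub> x \<otimes>\<^bsub>G\<^esub> y) * a x y * s x * t y) \<le> (\<Sum>x\<in>F. cmod (s x) * cmod (w x))"
    by (metis (no_types, lifting) norm_mult norm_sum sum.cong)
  \<comment> \<open>The arithmetic-geometric mean inequality with weights \<open>C\<close> and
    \<open>1 / C\<close>: by the bound \<open>C\<^sup>2\<close> for \<open>w\<close>, both halves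
    end up with the same factor \<open>C\<close>.\<close>
  also have "\<dots> \<le> (\<Sum>x\<in>F. (C * (cmod (s x))\<^sup>2 + (cmod (w x))\<^sup>2 / C) / 2)"
  proof (rule sum_mono)
    fix x
    have "0 \<le> (C * cmod (s x) - cmod (w x))\<^sup>2" by simp
    then have "2 * C * (cmod (s x) * cmod (w x)) \<le> C\<^sup>2 * (cmod (s x))\<^sup>2 + (cmod (w x))\<^sup>2"
      by (simp add: power2_eq_square algebra_simps)
    then show "cmod (s x) * cmod (w x) \<le> (C * (cmod (s x))\<^sup>2 + (cmod (w x))\<^sup>2 / C) / 2"
      using C by (simp add: field_simps power2_eq_square)
  qed
  also have "\<dots> = (C * (\<Sum>x\<in>F. (cmod (s x))\<^sup>2) + (\<Sum>x\<in>F. (cmod (w x))\<^sup>2) / C) / 2"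
    by (simp add: sum_divide_distrib[symmetric] sum.distrib sum_distrib_left)
  also have "(\<Sum>x\<in>F. (cmod (w x))\<^sup>2) / C \<le> C * (\<Sum>y\<in>F. (cmod (t y))\<^sup>2)"
    using W C by (simp add: field_simps power2_eq_square)
  finally show "cmod (\<Sum>x\<in>F. \<Sum>y\<in>F. \<phi> (inv\<^bsub>G\<^esub> x \<otimes>\<^bsub>G\<^esub> y) * a x y * s x * t y) \<le>
     C * (((\<Sum>x\<in>F. (cmod (s x))\<^sup>2) + (\<Sum>y\<in>F. (cmod (t y))\<^sup>2)) / 2)"
    by (simp add: distrib_left divide_right_mono)
qed (use assms in auto)

text \<open>Writing \<open>\<phi> g\<close> as the pairing of a vector at \<open>inv h\<close> with
  one at the inverse of \<open>inv g \<otimes> h\<close> expresses the multiplied operator as a sum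
  over \<open>m\<close> of the original one placed between diagonal operators. Cauchy-Schwarz in
  \<open>m\<close> costs one factor \<open>C\<close> on the left, and the bound on the \<beta>
  vectors another on the right.\<close>

lemma cb_norm_le_if_schur_factor:
  fixes G (structure)
  assumes G: "group G" and C: "C \<ge> 0"
    and fac: "\<And>F. finite F \<Longrightarrow> F \<subseteq> carrier G \<Longrightarrow> schur_factor F C (\<lambda>x y. \<phi> (inv\<^bsub>G\<^esub> x \<otimes>\<^bsub>G\<^esub> y))"
  shows "cb_norm G \<phi> \<le> ereal C"
  unfolding cb_norm_def
proof (rule Sup_least, elim CollectE exE conjE)
  interpret group G by (rule G)
  fix z n A
  assume z: "z = mat_norm G n (\<lambda>i j g. \<phi> g * A i j g)"
    and supp: "\<forall>i<n. \<forall>j<n. fin_supp G (A i j)" and A1: "mat_norm G n A \<le> 1"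
  have "mat_norm G n (\<lambda>i j g. \<phi> g * A i j g) \<le> ereal C"
  proof (rule mat_norm_leI[OF C])
    fix xi assume xi: "\<And>j. j < n \<Longrightarrow> l2_vec G (xi j)" and le1: "(\<Sum>j<n. l2_normsq G (xi j)) \<le> 1"
    show "(\<Sum>i<n. l2_normsq G (\<lambda>h. \<Sum>j<n. lreg G (\<lambda>g. \<phi> g * A i j g) (xi j) h)) \<le> C\<^sup>2"
      unfolding l2_normsq_def
    proof (rule sum_infsum_le)
      fix W assume W: "finite W" "W \<subseteq> carrier G"
      define S where "S = (\<Union>i<n. \<Union>j<n. {g \<in> carrier G. A i j g \<noteq> 0})"
      have S: "finite S" "S \<subseteq> carrier G" using supp by (auto simp: S_def fin_supp_def)
      \<comment> \<open>Only these input coordinates can reach an output in \<open>W\<close>, so a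
        factorization on a finite set suffices.\<close>
      define F where "F = (\<lambda>(g, h). inv g \<otimes> h) ` (S \<times> W)"
      have F: "finite F" "F \<subseteq> carrier G" using S W by (auto simp: F_def)
      have "schur_factor ((\<lambda>x. inv x) ` (W \<union> F)) C (\<lambda>x y. \<phi> (inv x \<otimes> y))"
        by (rule fac) (use F W in auto)
      then obtain N \<alpha> \<beta> where "schur_rep ((\<lambda>x. inv x) ` (W \<union> F)) C (\<lambda>x y. \<phi> (inv x \<otimes> y)) N \<alpha> \<beta>"
        unfolding schur_factor_def by blast
      note rep = schur_repD[OF this]
      have phi: "\<phi> g = (\<Sum>m<N. \<alpha> (inv h) m * \<beta> (inv (inv g \<otimes> h)) m)" if "g \<in> S" "h \<in> W" for g h
      proof -
        have c: "g \<in> carrier G" "h \<in> carrier G" using that S W by auto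
        have "inv (inv h) \<otimes> inv (inv g \<otimes> h) = h \<otimes> (inv h \<otimes> g)" using c by (simp add: inv_mult_group)
        also have "\<dots> = g" using c by (simp flip: m_assoc)
        finally have "\<phi> g = \<phi> (inv (inv h) \<otimes> inv (inv g \<otimes> h))" by simp
        also have "\<dots> = (\<Sum>m<N. \<alpha> (inv h) m * \<beta> (inv (inv g \<otimes> h)) m)"
          by (rule rep(1)) (use that in \<open>auto simp: F_def\<close>)
        finally show ?thesis .
      qed
      define v where "v m j k = (if k \<in> F then \<beta> (inv k) m * xi j k else 0)" for m j k
      define y where "y m i h = (\<Sum>j<n. lreg G (A i j) (v m j) h)" for m i h
      have v: "l2_vec G (v m j)" "l2_normsq G (v m j) = (\<Sum>k\<in>F. (cmod (v m j k))\<^sup>2)" if "j < n" for m j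
        using infsum_finite_support[OF F, of "\<lambda>k. (cmod (v m j k))\<^sup>2"] F
        by (auto simp: l2_vec_def l2_normsq_def v_def)
      have lrS: "lreg G (A i j) \<eta> h = (\<Sum>g\<in>S. A i j g * \<eta> (inv g \<otimes> h))"
        "lreg G (\<lambda>g. \<phi> g * A i j g) \<eta> h = (\<Sum>g\<in>S. \<phi> g * A i j g * \<eta> (inv g \<otimes> h))" if "i < n" "j < n" for i j \<eta> h
        using that by (intro lreg_eq_sum[OF S]; auto simp: S_def)+
      have fact: "(\<Sum>j<n. lreg G (\<lambda>g. \<phi> g * A i j g) (xi j) h) = (\<Sum>m<N. \<alpha> (inv h) m * y m i h)"
        if i: "i < n" and h: "h \<in> W" for i h
      proof -
        have "(\<Sum>j<n. lreg G (\<lambda>g. \<phi> g * A i j g) (xi j) h) =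
            (\<Sum>j<n. \<Sum>g\<in>S. \<Sum>m<N. \<alpha> (inv h) m * (A i j g * v m j (inv g \<otimes> h)))"
        proof (intro sum.cong refl)
          fix j assume "j \<in> {..<n}"
          then have "lreg G (\<lambda>g. \<phi> g * A i j g) (xi j) h = (\<Sum>g\<in>S. \<phi> g * A i j g * xi j (inv g \<otimes> h))"
            using lrS(2) i by simp
          also have "\<dots> = (\<Sum>g\<in>S. \<Sum>m<N. \<alpha> (inv h) m * (A i j g * v m j (inv g \<otimes> h)))"
          proof (rule sum.cong[OF refl])
            fix g assume g: "g \<in> S"
            then have "inv g \<otimes> h \<in> F" using h by (auto simp: F_def)
            then show "\<phi> g * A i j g * xi j (inv g \<otimes> h) = (\<Sum>m<N. \<alpha> (inv h) m * (A i j g * v m j (inv g \<otimes> h)))"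
              by (simp add: phi[OF g h] v_def sum_distrib_left sum_distrib_right mult_ac)
          qed
          finally show "lreg G (\<lambda>g. \<phi> g * A i j g) (xi j) h = (\<Sum>g\<in>S. \<Sum>m<N. \<alpha> (inv h) m * (A i j g * v m j (inv g \<otimes> h)))" .
        qed
        also have "\<dots> = (\<Sum>j<n. \<Sum>m<N. \<Sum>g\<in>S. \<alpha> (inv h) m * (A i j g * v m j (inv g \<otimes> h)))"
          by (intro sum.cong refl sum.swap)
        also have "\<dots> = (\<Sum>m<N. \<Sum>j<n. \<Sum>g\<in>S. \<alpha> (inv h) m * (A i j g * v m j (inv g \<otimes> h)))"
          by (rule sum.swap)
        also have "\<dots> = (\<Sum>m<N. \<alpha> (inv h) m * y m i h)"
          using i by (simp add: y_def lrS sum_distrib_left)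
        finally show ?thesis .
      qed
      have y_le: "(\<Sum>i<n. \<Sum>h\<in>W. (cmod (y m i h))\<^sup>2) \<le> (\<Sum>j<n. \<Sum>k\<in>F. (cmod (v m j k))\<^sup>2)" for m
      proof -
        \<comment> \<open>\<open>R\<close> contains \<open>W\<close> and the whole support of
          \<open>y m i\<close>, so the sum over \<open>W\<close> is dominated by a full squared
          norm, to which \<open>mat_normD\<close> applies.\<close>
        define R where "R = W \<union> (\<lambda>(g, k). g \<otimes> k) ` (S \<times> F)"
        have R: "finite R" "R \<subseteq> carrier G" using S F W by (auto simp: R_def)
        have y0: "y m i h = 0" if "i < n" "h \<in> carrier G - R" for i h
        proof -
          have "v m j (inv g \<otimes> h) = 0" if g: "g \<in> S" for j g
          proof -
            have "inv g \<otimes> h \<notin> F"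
            proof
              assume "inv g \<otimes> h \<in> F"
              then have "g \<otimes> (inv g \<otimes> h) \<in> R" using g unfolding R_def by force
              moreover have "g \<otimes> (inv g \<otimes> h) = h"
                using g S \<open>h \<in> carrier G - R\<close> by (subst m_assoc[symmetric]) auto
              ultimately show False using \<open>h \<in> carrier G - R\<close> by simp
            qed
            then show ?thesis by (simp add: v_def)
          qed
          then show ?thesis using that by (simp add: y_def lrS)
        qed
        have "(\<Sum>h\<in>W. (cmod (y m i h))\<^sup>2) \<le> l2_normsq G (y m i)" if "i < n" for i
        proof -
          have "(\<Sum>h\<in>W. (cmod (y m i h))\<^sup>2) \<le> (\<Sum>h\<in>R. (cmod (y m i h))\<^sup>2)"
            by (rule sum_mono2) (use R in \<open>auto simp: R_def\<close>)
          also have "\<dots> = l2_normsq G (y m i)" unfolding l2_normsq_def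
            by (rule infsum_finite_support(2)[OF R, symmetric]) (use y0 that in auto)
          finally show ?thesis .
        qed
        then have "(\<Sum>i<n. \<Sum>h\<in>W. (cmod (y m i h))\<^sup>2) \<le> (\<Sum>i<n. l2_normsq G (y m i))"
          by (intro sum_mono) auto
        also have "\<dots> \<le> 1\<^sup>2 * (\<Sum>j<n. l2_normsq G (v m j))"
          unfolding y_def using A1 v(1) by (intro mat_normD) (auto simp: one_ereal_def)
        finally show ?thesis by (simp add: v(2))
      qed
      have "(\<Sum>i<n. \<Sum>h\<in>W. (cmod (\<Sum>j<n. lreg G (\<lambda>g. \<phi> g * A i j g) (xi j) h))\<^sup>2) \<le>
        (\<Sum>i<n. \<Sum>h\<in>W. C * (\<Sum>m<N. (cmod (y m i h))\<^sup>2))"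
      proof (intro sum_mono)
        fix i h assume i: "i \<in> {..<n}" and h: "h \<in> W"
        have "(cmod (\<Sum>m<N. \<alpha> (inv h) m * y m i h))\<^sup>2 \<le> (\<Sum>m<N. (cmod (\<alpha> (inv h) m))\<^sup>2) * (\<Sum>m<N. (cmod (y m i h))\<^sup>2)"
          by (rule cmod_sum_mult_le)
        also have "\<dots> \<le> C * (\<Sum>m<N. (cmod (y m i h))\<^sup>2)"
          using rep(2)[of "inv h"] h by (intro mult_right_mono) (auto simp: sum_nonneg)
        finally show "(cmod (\<Sum>j<n. lreg G (\<lambda>g. \<phi> g * A i j g) (xi j) h))\<^sup>2 \<le> C * (\<Sum>m<N. (cmod (y m i h))\<^sup>2)"
          using fact i h by simp
      qed
      also have "\<dots> = C * (\<Sum>m<N. \<Sum>i<n. \<Sum>h\<in>W. (cmod (y m i h))\<^sup>2)"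
        by (simp add: sum_distrib_left[symmetric] sum.swap[of _ W "{..<N}"] sum.swap[of _ "{..<n}" "{..<N}"])
      also have "\<dots> \<le> C * (\<Sum>m<N. \<Sum>j<n. \<Sum>k\<in>F. (cmod (v m j k))\<^sup>2)"
        by (intro mult_left_mono sum_mono y_le C)
      also have "(\<Sum>m<N. \<Sum>j<n. \<Sum>k\<in>F. (cmod (v m j k))\<^sup>2) = (\<Sum>j<n. \<Sum>k\<in>F. (\<Sum>m<N. (cmod (\<beta> (inv k) m))\<^sup>2) * (cmod (xi j k))\<^sup>2)"
        by (simp add: sum.swap[of _ "{..<N}"] v_def norm_mult power_mult_distrib sum_distrib_right)
      also have "\<dots> \<le> (\<Sum>j<n. \<Sum>k\<in>F. C * (cmod (xi j k))\<^sup>2)"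
        using rep(3) by (intro sum_mono mult_right_mono) auto
      also have "\<dots> = C * (\<Sum>j<n. \<Sum>k\<in>F. (cmod (xi j k))\<^sup>2)" by (simp add: sum_distrib_left)
      also have "(\<Sum>j<n. \<Sum>k\<in>F. (cmod (xi j k))\<^sup>2) \<le> (\<Sum>j<n. l2_normsq G (xi j))"
        unfolding l2_normsq_def using xi F by (intro sum_mono finite_sum_le_infsum) (auto simp: l2_vec_def)
      also have "\<dots> \<le> 1" by (rule le1)
      finally show "(\<Sum>i<n. \<Sum>h\<in>W. (cmod (\<Sum>j<n. lreg G (\<lambda>g. \<phi> g * A i j g) (xi j) h))\<^sup>2) \<le> C\<^sup>2"
        using C by (simp add: power2_eq_square mult_left_mono)
    qed auto
  qed
  then show "z \<le> ereal C" by (simp add: z)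
qed

section \<open>Reduced words of a free product\<close>

text \<open>Elements of the free product of copies of \<open>H\<close> indexed by labels are reduced lists of labelled letters;
  \<open>fp_act\<close> is left multiplication by one letter.\<close>

fun fp_act :: "('h, 'm) monoid_scheme \<Rightarrow> 'c \<times> 'h \<Rightarrow> ('c \<times> 'h) list \<Rightarrow> ('c \<times> 'h) list" where
  "fp_act H (c, a) [] = (if a = \<one>\<^bsub>H\<^esub> then [] else [(c, a)])"
| "fp_act H (c, a) ((d, b) # s) = (if a = \<one>\<^bsub>H\<^esub> then (d, b) # s
     else if c = d then (if a \<otimes>\<^bsub>H\<^esub> b = \<one>\<^bsub>H\<^esub> then s else (c, a \<otimes>\<^bsub>H\<^esub> b) # s)
     else (c, a) # (d, b) # s)"

fun fp_red :: "('h, 'm) monoid_scheme \<Rightarrow> ('c \<times> 'h) list \<Rightarrow> bool" where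
  "fp_red H [] = True"
| "fp_red H ((c, a) # s) = (a \<in> carrier H \<and> a \<noteq> \<one>\<^bsub>H\<^esub> \<and> (s \<noteq> [] \<longrightarrow> fst (hd s) \<noteq> c) \<and> fp_red H s)"

definition fp_mul :: "('h, 'm) monoid_scheme \<Rightarrow> ('c \<times> 'h) list \<Rightarrow> ('c \<times> 'h) list \<Rightarrow> ('c \<times> 'h) list" where
  "fp_mul H s X = foldr (fp_act H) s X"

definition fp_inv :: "('h, 'm) monoid_scheme \<Rightarrow> ('c \<times> 'h) list \<Rightarrow> ('c \<times> 'h) list" where
  "fp_inv H s = rev (map (\<lambda>(c, a). (c, inv\<^bsub>H\<^esub> a)) s)"

definition fp_val :: "('h \<Rightarrow> complex) \<Rightarrow> ('c \<times> 'h) list \<Rightarrow> complex" where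
  "fp_val \<psi> s = prod_list (map (\<lambda>x. \<psi> (snd x)) s)"

text \<open>The value of the free product multiplier at the quotient of \<open>s\<close> and
  \<open>t\<close>, computed without multiplying: equal first letters cancel, different letters with
  the same label merge, and after that nothing cancels any more.\<close>

fun fp_ker :: "('h, 'm) monoid_scheme \<Rightarrow> ('h \<Rightarrow> complex) \<Rightarrow> ('c \<times> 'h) list \<Rightarrow> ('c \<times> 'h) list \<Rightarrow> complex" where
  "fp_ker H \<psi> ((c, a) # s) ((d, b) # t) =
     (if c = d then (if a = b then fp_ker H \<psi> s t
        else \<psi> (inv\<^bsub>H\<^esub> a \<otimes>\<^bsub>H\<^esub> b) * fp_val (\<lambda>h. \<psi> (inv\<^bsub>H\<^esub> h)) s * fp_val \<psi> t)
      else fp_val (\<lambda>h. \<psi> (inv\<^bsub>H\<^esub> h)) ((c, a) # s) * fp_val \<psi> ((d, b) # t))"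
| "fp_ker H \<psi> s t = fp_val (\<lambda>h. \<psi> (inv\<^bsub>H\<^esub> h)) s * fp_val \<psi> t"

lemma fp_mul_simps [simp]:
  "fp_mul H [] X = X" "fp_mul H (x # s) X = fp_act H x (fp_mul H s X)"
  "fp_mul H (s @ t) X = fp_mul H s (fp_mul H t X)"
  by (simp_all add: fp_mul_def)

lemma fp_inv_simps [simp]:
  "fp_inv H [] = []" "fp_inv H ((c, a) # s) = fp_inv H s @ [(c, inv\<^bsub>H\<^esub> a)]"
  by (simp_all add: fp_inv_def)

lemma fp_val_simps [simp]:
  "fp_val \<psi> [] = 1" "fp_val \<psi> (x # s) = \<psi> (snd x) * fp_val \<psi> s"
  "fp_val \<psi> (s @ t) = fp_val \<psi> s * fp_val \<psi> t"
  by (simp_all add: fp_val_def)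

context group
begin

lemma fp_act_one: "fp_act G (c, \<one>) s = s"
  by (cases s) auto

lemma fp_act_red:
  assumes "a \<in> carrier G" "fp_red G s"
  shows "fp_red G (fp_act G (c, a) s)"
  using assms by (cases s) auto

text \<open>Van der Waerden's trick: letters act on reduced words compatibly with multiplication in
  the group. All identities in the free product are derived from this, without forming a
  quotient.\<close>

lemma fp_act_act:
  assumes "a \<in> carrier G" "b \<in> carrier G" "fp_red G s"
  shows "fp_act G (c, a) (fp_act G (c, b) s) = fp_act G (c, a \<otimes> b) s"
proof (cases "b = \<one> \<or> a = \<one>")
  case True
  then show ?thesis using assms by (auto simp: fp_act_one)
next
  case False
  show ?thesis
  proof (cases s)
    case Nil
    then show ?thesis using False assms by auto
  next
    case (Cons x s')
    obtain d h where x: "x = (d, h)" by force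
    have h: "h \<in> carrier G" "h \<noteq> \<one>" "s' \<noteq> [] \<longrightarrow> fst (hd s') \<noteq> d" using assms(3) Cons x by auto
    show ?thesis
    proof (cases "c = d")
      case False
      then show ?thesis using \<open>\<not> (b = \<one> \<or> a = \<one>)\<close> assms Cons x by auto
    next
      case True
      have assoc: "a \<otimes> b \<otimes> h = a \<otimes> (b \<otimes> h)" using assms h by (simp add: m_assoc)
      show ?thesis
      proof (cases "b \<otimes> h = \<one>")
        case bh: True
        have "act_s' = (c, a) # s'" if "act_s' = fp_act G (c, a) s'" for act_s'
          using that h(3) \<open>c = d\<close> \<open>\<not> (b = \<one> \<or> a = \<one>)\<close> by (cases s') auto
        moreover have "a = h" if "a \<otimes> b = \<one>" using assoc bh that assms h by simp
        moreover have "a \<otimes> b \<otimes> h = a" using assoc bh assms by simp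
        ultimately show ?thesis using Cons x bh \<open>c = d\<close> \<open>\<not> (b = \<one> \<or> a = \<one>)\<close> by auto
      next
        case False
        have "a \<otimes> (b \<otimes> h) = h" if "a \<otimes> b = \<one>" using assoc that h by simp
        then show ?thesis using Cons x False h \<open>c = d\<close> \<open>\<not> (b = \<one> \<or> a = \<one>)\<close> assoc by auto
      qed
    qed
  qed
qed

lemma fp_mul_red:
  assumes "snd ` set s \<subseteq> carrier G" "fp_red G X"
  shows "fp_red G (fp_mul G s X)"
  using assms by (induction s) (auto simp: fp_act_red)

lemma fp_red_carrier: "fp_red G s \<Longrightarrow> snd ` set s \<subseteq> carrier G"
  by (induction s) (force simp: image_subset_iff)+

lemma fp_red_mul_Nil: "fp_red G s \<Longrightarrow> fp_mul G s [] = s"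
proof (induction s)
  case (Cons x s)
  then show ?case by (cases x; cases s) auto
qed simp

lemma fp_mul_act:
  assumes a: "a \<in> carrier G" and s: "fp_red G s" and X: "fp_red G X"
  shows "fp_mul G (fp_act G (c, a) s) X = fp_act G (c, a) (fp_mul G s X)"
proof (cases s)
  case Nil
  then show ?thesis by (auto simp: fp_act_one)
next
  case (Cons x s')
  obtain d b where x: "x = (d, b)" by force
  have b: "b \<in> carrier G" "fp_red G (fp_mul G s' X)"
    using s X Cons x fp_red_carrier[of s'] by (auto intro: fp_mul_red)
  show ?thesis
    using fp_act_act[OF a b, of c] Cons x by (auto simp: fp_act_one)
qed

lemma fp_mul_assoc:
  assumes "snd ` set l \<subseteq> carrier G" "fp_red G s" "fp_red G X"
  shows "fp_mul G (fp_mul G l s) X = fp_mul G l (fp_mul G s X)"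
  using assms
proof (induction l)
  case (Cons x l)
  obtain c a where x: "x = (c, a)" by force
  show ?case using Cons x by (simp add: fp_mul_act fp_mul_red)
qed simp

lemma fp_inv_carrier: "snd ` set s \<subseteq> carrier G \<Longrightarrow> snd ` set (fp_inv G s) \<subseteq> carrier G"
  by (auto simp: fp_inv_def)

lemma fp_mul_inv_cancel:
  assumes "snd ` set l \<subseteq> carrier G" "fp_red G X"
  shows "fp_mul G (fp_inv G l) (fp_mul G l X) = X"
  using assms
proof (induction l)
  case (Cons x l)
  obtain c a where x: "x = (c, a)" by force
  show ?case using Cons x by (simp add: fp_act_act fp_mul_red fp_act_one)
qed simp

lemma fp_mul_inv_no_merge:
  assumes "fp_red G s" "fp_red G X" "s = [] \<or> X = [] \<or> fst (hd s) \<noteq> fst (hd X)"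
  shows "fp_mul G (fp_inv G s) X = fp_inv G s @ X"
  using assms
proof (induction s arbitrary: X)
  case (Cons x s)
  obtain c a where x: "x = (c, a)" by force
  have a: "a \<in> carrier G" "a \<noteq> \<one>" "inv a \<noteq> \<one>" using Cons.prems x by (auto simp: inv_eq_1_iff)
  have "fp_act G (c, inv a) X = (c, inv a) # X" using Cons.prems(3) a x by (cases X) auto
  moreover have "fp_red G ((c, inv a) # X)" using Cons.prems(2,3) a x by auto
  moreover have "s = [] \<or> fst (hd s) \<noteq> c" "fp_red G s" using Cons.prems(1) x by auto
  ultimately show ?case using Cons.IH[of "(c, inv a) # X"] x by simp
qed simp

lemma fp_val_inv: "fp_val \<psi> (fp_inv G s) = fp_val (\<lambda>h. \<psi> (inv h)) s"
  by (induction s) (auto simp: fp_inv_def)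

lemma fp_val_inv_mul:
  assumes "fp_red G s" "fp_red G t"
  shows "fp_val \<psi> (fp_mul G (fp_inv G s) t) = fp_ker G \<psi> s t"
  using assms
proof (induction s arbitrary: t)
  case Nil
  then show ?case by simp
next
  case (Cons x s)
  obtain c a where x: "x = (c, a)" by force
  show ?case
  proof (cases t)
    case Nil
    then show ?thesis using fp_mul_inv_no_merge[OF Cons.prems(1), of "[]"] fp_val_inv[of \<psi> "x # s"] by simp
  next
    case t: (Cons y t')
    obtain d b where y: "y = (d, b)" by force
    have c: "a \<in> carrier G" "b \<in> carrier G" "fp_red G s" "fp_red G t'" "s = [] \<or> fst (hd s) \<noteq> c"
      "a \<noteq> \<one>" "inv a \<noteq> \<one>" "t' = [] \<or> fst (hd t') \<noteq> d"
      using Cons.prems x y t by auto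
    show ?thesis
    proof (cases "c = d")
      case False
      then show ?thesis
        using fp_mul_inv_no_merge[OF Cons.prems, unfolded x t y] fp_val_inv[of \<psi> "(c, a) # s"]
        by (simp add: x t y del: fp_inv_simps)
    next
      case True
      have ab: "inv a \<otimes> b = \<one> \<longleftrightarrow> a = b"
        using c by (metis inv_closed inv_inv l_inv inv_equality)
      show ?thesis
      proof (cases "a = b")
        case True
        then show ?thesis using Cons.IH[OF c(3,4)] \<open>c = d\<close> c ab by (simp add: x t y)
      next
        case False
        have "fp_red G ((c, inv a \<otimes> b) # t')" using c ab False \<open>c = d\<close> by auto
        from fp_mul_inv_no_merge[OF c(3) this] c(5) 
        have "fp_mul G (fp_inv G s) ((c, inv a \<otimes> b) # t') = fp_inv G s @ (c, inv a \<otimes> b) # t'" by auto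
        then show ?thesis using \<open>c = d\<close> c ab False by (simp add: x t y fp_val_inv)
      qed
    qed
  qed
qed

end

text \<open>Multiplication only asks whether two labels are equal, so injective relabelling commutes
  with it. The second conjunct keeps the labels inside the set where \<open>f\<close> is injective
  and is needed for the induction.\<close>

lemma fp_mul_map_label:
  assumes "inj_on f (fst ` set (s @ X))"
  shows "fp_mul H (map (\<lambda>(c, a). (f c, a)) s) (map (\<lambda>(c, a). (f c, a)) X) = map (\<lambda>(c, a). (f c, a)) (fp_mul H s X) \<and>
    fst ` set (fp_mul H s X) \<subseteq> fst ` set (s @ X)"
  using assms
proof (induction s)
  case (Cons x s)
  obtain c a where x: "x = (c, a)" by force
  have IH: "fp_mul H (map (\<lambda>(c, a). (f c, a)) s) (map (\<lambda>(c, a). (f c, a)) X) = map (\<lambda>(c, a). (f c, a)) (fp_mul H s X)"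
    "fst ` set (fp_mul H s X) \<subseteq> fst ` set (s @ X)"
    using Cons.IH[OF inj_on_subset[OF Cons.prems]] by auto
  show ?case
  proof (cases "fp_mul H s X")
    case Nil
    then show ?thesis using IH x by auto
  next
    case (Cons y t)
    obtain d b where y: "y = (d, b)" by force
    have "d \<in> fst ` set (s @ X)" using IH(2) Cons y by auto
    then have "f c = f d \<longleftrightarrow> c = d" using Cons.prems x by (auto simp: inj_on_def)
    then show ?thesis using IH x Cons y by auto
  qed
qed auto

section \<open>Vectors indexed by prefixes\<close>

fun fp_feat :: "('h \<Rightarrow> nat \<Rightarrow> complex) \<Rightarrow> ('h \<Rightarrow> complex) \<Rightarrow> ('c \<times> 'h) list \<Rightarrow> ('c \<times> 'h) list \<Rightarrow> 'c \<Rightarrow> nat \<Rightarrow> complex" where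
  "fp_feat \<gamma> \<theta> [] p c k = 0"
| "fp_feat \<gamma> \<theta> ((d, b) # s) [] c k = (if c = d then \<gamma> b k * fp_val \<theta> s else 0)"
| "fp_feat \<gamma> \<theta> ((d, b) # s) (q # p) c k = (if q = (d, b) then fp_feat \<gamma> \<theta> s p c k else 0)"

text \<open>The strict bound fits proper prefixes: a prefix of a word of length at most
  \<open>m\<close> that is followed by a further letter has length below \<open>m\<close>.\<close>

definition short_lists :: "'a set \<Rightarrow> nat \<Rightarrow> 'a list set" where
  "short_lists A m = {p. set p \<subseteq> A \<and> length p < m}"

lemma finite_short_lists: "finite A \<Longrightarrow> finite (short_lists A m)"
  unfolding short_lists_def
  by (rule finite_subset[OF _ finite_lists_length_le[of A m]]) auto

lemma sum_short_lists_Suc: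
  assumes "finite A"
  shows "(\<Sum>p\<in>short_lists A (Suc m). f p) = f [] + (\<Sum>a\<in>A. \<Sum>p\<in>short_lists A m. f (a # p))"
proof -
  have eq: "short_lists A (Suc m) = insert [] ((\<lambda>(a, p). a # p) ` (A \<times> short_lists A m))"
  proof (intro equalityI subsetI)
    fix p assume "p \<in> short_lists A (Suc m)"
    then show "p \<in> insert [] ((\<lambda>(a, p). a # p) ` (A \<times> short_lists A m))"
      by (cases p) (auto simp: short_lists_def)
  qed (auto simp: short_lists_def)
  have inj: "inj_on (\<lambda>(a, p). a # p) (A \<times> short_lists A m)" by (auto simp: inj_on_def)
  have "(\<Sum>p\<in>(\<lambda>(a, p). a # p) ` (A \<times> short_lists A m). f p) = (\<Sum>a\<in>A. \<Sum>p\<in>short_lists A m. f (a # p))"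
    unfolding sum.reindex[OF inj] by (simp add: sum.cartesian_product case_prod_unfold)
  moreover have "[] \<notin> (\<lambda>(a, p). a # p) ` (A \<times> short_lists A m)" by auto
  ultimately show ?thesis unfolding eq using assms finite_short_lists[OF assms, of m] by simp
qed

text \<open>At the empty prefix, first letters with a common label contribute
  \<open>\<psi> (inv h \<otimes> h') - \<psi> (inv h) * \<psi> h'\<close> times the values of the
  tails. For equal letters this is the product of the tail values minus that of the word values, so
  the sum telescopes until the words diverge.\<close>

lemma fp_feat_inner:
  assumes A: "finite A" and C: "finite C" "fst ` A \<subseteq> C" and one: "\<psi> \<one>\<^bsub>H\<^esub> = 1"
    and linv: "\<And>h. h \<in> snd ` A \<Longrightarrow> inv\<^bsub>H\<^esub> h \<otimes>\<^bsub>H\<^esub> h = \<one>\<^bsub>H\<^esub>"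
    and ker: "\<And>h h'. h \<in> snd ` A \<Longrightarrow> h' \<in> snd ` A \<Longrightarrow>
      \<psi> (inv\<^bsub>H\<^esub> h \<otimes>\<^bsub>H\<^esub> h') - \<psi> (inv\<^bsub>H\<^esub> h) * \<psi> h' = (\<Sum>k<n. \<alpha> h k * \<beta> h' k)"
    and "set s \<subseteq> A" "set t \<subseteq> A" "length s \<le> m" "length t \<le> m"
  shows "(\<Sum>p\<in>short_lists A m. \<Sum>c\<in>C. \<Sum>k<n.
      fp_feat \<alpha> (\<lambda>h. \<psi> (inv\<^bsub>H\<^esub> h)) s p c k * fp_feat \<beta> \<psi> t p c k) +
      fp_val (\<lambda>h. \<psi> (inv\<^bsub>H\<^esub> h)) s * fp_val \<psi> t = fp_ker H \<psi> s t"
  using assms(7-)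
proof (induction s arbitrary: t m)
  case Nil
  then show ?case by simp
next
  case (Cons x s)
  obtain d b where x: "x = (d, b)" by force
  show ?case
  proof (cases t)
    case Nil
    then show ?thesis by (simp add: x)
  next
    case t: (Cons y t')
    obtain e h where y: "y = (e, h)" by force
    obtain m' where m: "m = Suc m'" using Cons.prems(3) by (cases m) auto
    have mem: "d \<in> C" "e \<in> C" "(d, b) \<in> A" "(e, h) \<in> A" "b \<in> snd ` A" "h \<in> snd ` A"
      using Cons.prems C(2) x y t by force+
    define \<theta> where "\<theta> h = \<psi> (inv\<^bsub>H\<^esub> h)" for h
    let ?f = "\<lambda>p c k. fp_feat \<alpha> \<theta> (x # s) p c k * fp_feat \<beta> \<psi> t p c k"
    let ?g = "\<lambda>p c k. fp_feat \<alpha> \<theta> s p c k * fp_feat \<beta> \<psi> t' p c k"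
    have "(\<Sum>c\<in>C. \<Sum>k<n. ?f [] c k) = (\<Sum>c\<in>C. if c = d then (if d = e then (\<Sum>k<n. \<alpha> b k * \<beta> h k) * (fp_val \<theta> s * fp_val \<psi> t') else 0) else 0)"
      by (intro sum.cong refl) (auto simp: x y t sum_distrib_left mult_ac)
    also have "\<dots> = (if d = e then (\<psi> (inv\<^bsub>H\<^esub> b \<otimes>\<^bsub>H\<^esub> h) - \<theta> b * \<psi> h) * (fp_val \<theta> s * fp_val \<psi> t') else 0)"
      using C(1) mem ker[OF mem(5,6)] by (simp add: \<theta>_def)
    finally have 1: "(\<Sum>c\<in>C. \<Sum>k<n. ?f [] c k) = (if d = e then (\<psi> (inv\<^bsub>H\<^esub> b \<otimes>\<^bsub>H\<^esub> h) - \<theta> b * \<psi> h) * (fp_val \<theta> s * fp_val \<psi> t') else 0)" .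
    have "(\<Sum>a\<in>A. \<Sum>p\<in>short_lists A m'. \<Sum>c\<in>C. \<Sum>k<n. ?f (a # p) c k) =
      (\<Sum>a\<in>A. if a = x then (if x = y then (\<Sum>p\<in>short_lists A m'. \<Sum>c\<in>C. \<Sum>k<n. ?g p c k) else 0) else 0)"
      by (intro sum.cong refl) (auto simp: x y t)
    also have "\<dots> = (if x = y then (\<Sum>p\<in>short_lists A m'. \<Sum>c\<in>C. \<Sum>k<n. ?g p c k) else 0)"
      using A mem x by simp
    finally have 2: "(\<Sum>a\<in>A. \<Sum>p\<in>short_lists A m'. \<Sum>c\<in>C. \<Sum>k<n. ?f (a # p) c k) =
      (if x = y then (\<Sum>p\<in>short_lists A m'. \<Sum>c\<in>C. \<Sum>k<n. ?g p c k) else 0)" .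
    have 3: "(\<Sum>p\<in>short_lists A m'. \<Sum>c\<in>C. \<Sum>k<n. ?g p c k) + fp_val \<theta> s * fp_val \<psi> t' = fp_ker H \<psi> s t'"
      using Cons.IH[of t' m'] Cons.prems unfolding \<theta>_def m t by simp
    have "(\<Sum>p\<in>short_lists A m. \<Sum>c\<in>C. \<Sum>k<n. ?f p c k) + fp_val \<theta> (x # s) * fp_val \<psi> t = fp_ker H \<psi> (x # s) t"
      unfolding m sum_short_lists_Suc[OF A] 1 2
      using 3 linv[OF mem(5)] one by (auto simp: x y t algebra_simps simp flip: \<theta>_def)
    then show ?thesis unfolding \<theta>_def .
  qed
qed

lemma fp_val_le:
  assumes "\<And>h. h \<in> snd ` set s \<Longrightarrow> cmod (\<theta> h) \<le> \<rho>" "\<rho> \<ge> 0"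
  shows "cmod (fp_val \<theta> s) \<le> \<rho> ^ length s"
  using assms(1) by (induction s) (auto simp: norm_mult intro!: mult_mono assms(2))

text \<open>With \<open>\<delta> = 0\<close> the squared length never exceeds 1. In general each
  letter adds at most \<delta> times the squared value of the tail behind it, and tail values decay
  like powers of \<rho>, so the excess is a geometric series independent of the word length.\<close>

lemma fp_feat_norm:
  assumes A: "finite A" and C: "finite C" "fst ` A \<subseteq> C"
    and norm: "\<And>h. h \<in> snd ` A \<Longrightarrow> (\<Sum>k<n. (cmod (\<gamma> h k))\<^sup>2) + (cmod (\<theta> h))\<^sup>2 \<le> 1 + \<delta>"
    and \<rho>: "\<And>h. h \<in> snd ` A \<Longrightarrow> cmod (\<theta> h) \<le> \<rho>" "0 \<le> \<rho>" "\<rho> < 1" and \<delta>: "\<delta> \<ge> 0"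
    and "set s \<subseteq> A" "length s \<le> m"
  shows "(\<Sum>p\<in>short_lists A m. \<Sum>c\<in>C. \<Sum>k<n. (cmod (fp_feat \<gamma> \<theta> s p c k))\<^sup>2) + (cmod (fp_val \<theta> s))\<^sup>2
    \<le> 1 + \<delta> / (1 - \<rho>\<^sup>2)"
proof -
  have \<rho>2: "\<rho>\<^sup>2 < 1" using \<rho> by (simp add: power_less_one_iff abs_square_less_1)
  have "(\<Sum>p\<in>short_lists A m. \<Sum>c\<in>C. \<Sum>k<n. (cmod (fp_feat \<gamma> \<theta> s p c k))\<^sup>2) + (cmod (fp_val \<theta> s))\<^sup>2
      \<le> 1 + \<delta> * (\<Sum>i<length s. (\<rho>\<^sup>2) ^ i)"
    using assms(9-)
  proof (induction s arbitrary: m)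
    case Nil
    then show ?case by simp
  next
    case (Cons x s)
    obtain d b where x: "x = (d, b)" by force
    obtain m' where m: "m = Suc m'" using Cons.prems(2) by (cases m) auto
    have mem: "d \<in> C" "(d, b) \<in> A" "b \<in> snd ` A" using Cons.prems C(2) x by force+
    let ?Q = "(\<Sum>p\<in>short_lists A m'. \<Sum>c\<in>C. \<Sum>k<n. (cmod (fp_feat \<gamma> \<theta> s p c k))\<^sup>2)"
    let ?v = "(cmod (fp_val \<theta> s))\<^sup>2"
    have "(\<Sum>c\<in>C. \<Sum>k<n. (cmod (fp_feat \<gamma> \<theta> (x # s) [] c k))\<^sup>2) =
        (\<Sum>c\<in>C. if c = d then (\<Sum>k<n. (cmod (\<gamma> b k))\<^sup>2) * ?v else 0)"
      by (intro sum.cong refl) (auto simp: x sum_distrib_right norm_mult power_mult_distrib)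
    then have 1: "(\<Sum>c\<in>C. \<Sum>k<n. (cmod (fp_feat \<gamma> \<theta> (x # s) [] c k))\<^sup>2) = (\<Sum>k<n. (cmod (\<gamma> b k))\<^sup>2) * ?v"
      using C(1) mem by simp
    have "(\<Sum>a\<in>A. \<Sum>p\<in>short_lists A m'. \<Sum>c\<in>C. \<Sum>k<n. (cmod (fp_feat \<gamma> \<theta> (x # s) (a # p) c k))\<^sup>2) =
        (\<Sum>a\<in>A. if a = x then ?Q else 0)"
      by (intro sum.cong refl) (auto simp: x)
    then have 2: "(\<Sum>a\<in>A. \<Sum>p\<in>short_lists A m'. \<Sum>c\<in>C. \<Sum>k<n. (cmod (fp_feat \<gamma> \<theta> (x # s) (a # p) c k))\<^sup>2) = ?Q"
      using A mem x by simp
    have "?v \<le> (\<rho> ^ length s)\<^sup>2"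
      using Cons.prems(1) by (intro power_mono fp_val_le) (auto intro!: \<rho>)
    then have v: "\<delta> * ?v \<le> \<delta> * (\<rho>\<^sup>2) ^ length s" using \<delta> by (intro mult_left_mono) (simp_all flip: power_mult add: mult.commute)
    have IH: "?Q + ?v \<le> 1 + \<delta> * (\<Sum>i<length s. (\<rho>\<^sup>2) ^ i)"
      using Cons.IH[of m'] Cons.prems m by simp
    have "((\<Sum>k<n. (cmod (\<gamma> b k))\<^sup>2) + (cmod (\<theta> b))\<^sup>2) * ?v \<le> (1 + \<delta>) * ?v"
      using norm[OF mem(3)] by (intro mult_right_mono) auto
    then have "(\<Sum>k<n. (cmod (\<gamma> b k))\<^sup>2) * ?v + ?Q + (cmod (\<theta> b))\<^sup>2 * ?v \<le> ?Q + ?v + \<delta> * ?v"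
      by (simp add: algebra_simps)
    also have "\<dots> \<le> 1 + \<delta> * (\<Sum>i<length (x # s). (\<rho>\<^sup>2) ^ i)"
      using IH v by (simp add: algebra_simps)
    finally show ?case
      unfolding m sum_short_lists_Suc[OF A] 1 2 by (simp add: x norm_mult power_mult_distrib)
  qed
  also have "(\<Sum>i<length s. (\<rho>\<^sup>2) ^ i) \<le> 1 / (1 - \<rho>\<^sup>2)"
  proof -
    have "(\<Sum>i<length s. (\<rho>\<^sup>2) ^ i) = (1 - (\<rho>\<^sup>2) ^ length s) / (1 - \<rho>\<^sup>2)"
      using \<rho>2 by (simp add: sum_gp_strict)
    also have "\<dots> \<le> 1 / (1 - \<rho>\<^sup>2)" using \<rho>2 by (intro divide_right_mono) auto
    finally show ?thesis .
  qed
  finally show ?thesis using \<delta> by (simp add: mult_left_mono)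
qed

text \<open>A kernel on a free product telescopes along the common prefix: the vector of a word \<open>s\<close> has one component for
  each prefix \<open>p\<close> and label \<open>c\<close> with \<open>s = p (c, h) q\<close>, namely the component of \<open>h\<close> orthogonal to the unit
  times the value of \<open>q\<close>.\<close>

lemma fp_ker_schur_factor:
  fixes n :: nat
  assumes F: "finite F" and one: "\<psi> \<one>\<^bsub>H\<^esub> = 1"
    and W: "\<And>s. s \<in> F \<Longrightarrow> snd ` set s \<subseteq> W"
    and linv: "\<And>h. h \<in> W \<Longrightarrow> inv\<^bsub>H\<^esub> h \<otimes>\<^bsub>H\<^esub> h = \<one>\<^bsub>H\<^esub>"
    and ker: "\<And>h h'. h \<in> W \<Longrightarrow> h' \<in> W \<Longrightarrow>
      \<psi> (inv\<^bsub>H\<^esub> h \<otimes>\<^bsub>H\<^esub> h') - \<psi> (inv\<^bsub>H\<^esub> h) * \<psi> h' = (\<Sum>k<n. \<alpha> h k * \<beta> h' k)"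
    and \<alpha>: "\<And>h. h \<in> W \<Longrightarrow> (\<Sum>k<n. (cmod (\<alpha> h k))\<^sup>2) + (cmod (\<psi> (inv\<^bsub>H\<^esub> h)))\<^sup>2 \<le> 1 + \<delta>"
    and \<beta>: "\<And>h. h \<in> W \<Longrightarrow> (\<Sum>k<n. (cmod (\<beta> h k))\<^sup>2) + (cmod (\<psi> h))\<^sup>2 \<le> 1 + \<delta>"
    and \<rho>: "\<And>h. h \<in> W \<Longrightarrow> cmod (\<psi> h) \<le> \<rho>" "\<And>h. h \<in> W \<Longrightarrow> cmod (\<psi> (inv\<^bsub>H\<^esub> h)) \<le> \<rho>"
      "0 \<le> \<rho>" "\<rho> < 1" and \<delta>: "\<delta> \<ge> 0"
  shows "schur_factor F (1 + \<delta> / (1 - \<rho>\<^sup>2)) (fp_ker H \<psi>)"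
proof -
  define A where "A = (\<Union>s\<in>F. set s)"
  define C where "C = fst ` A"
  obtain m where m: "\<And>s. s \<in> F \<Longrightarrow> length s \<le> m"
    using finite_nat_set_iff_bounded_le[of "length ` F"] F by auto
  have A: "finite A" "finite C" "fst ` A \<subseteq> C" "snd ` A \<subseteq> W" "\<And>s. s \<in> F \<Longrightarrow> set s \<subseteq> A"
    using F W by (auto simp: A_def C_def)
  define \<theta> where "\<theta> = (\<lambda>h. \<psi> (inv\<^bsub>H\<^esub> h))"
  let ?I = "short_lists A m \<times> C \<times> {..<n}"
  have I: "finite ?I" by (intro finite_cartesian_product finite_short_lists A) auto
  have cart: "(\<Sum>i\<in>?I. case i of (p, c, k) \<Rightarrow> f p c k) = (\<Sum>p\<in>short_lists A m. \<Sum>c\<in>C. \<Sum>k<n. f p c k)" for f :: "_ \<Rightarrow> _ \<Rightarrow> _ \<Rightarrow> 'z::comm_monoid_add"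
    by (simp add: sum.cartesian_product)
  show ?thesis
  proof (rule schur_factorI[where I="?I <+> {()}" and \<alpha>="\<lambda>s. case_sum (\<lambda>(p, c, k). fp_feat \<alpha> \<theta> s p c k) (\<lambda>_. fp_val \<theta> s)"
        and \<beta>="\<lambda>s. case_sum (\<lambda>(p, c, k). fp_feat \<beta> \<psi> s p c k) (\<lambda>_. fp_val \<psi> s)"])
    show "finite (?I <+> {()})" using I by simp
    fix s t assume s: "s \<in> F" and t: "t \<in> F"
    have "fp_ker H \<psi> s t = (\<Sum>p\<in>short_lists A m. \<Sum>c\<in>C. \<Sum>k<n. fp_feat \<alpha> \<theta> s p c k * fp_feat \<beta> \<psi> t p c k) + fp_val \<theta> s * fp_val \<psi> t"
      unfolding \<theta>_def
      by (rule fp_feat_inner[symmetric]) (use A s t m one linv ker in \<open>auto simp: subset_iff\<close>)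
    then show "fp_ker H \<psi> s t = (\<Sum>i\<in>?I <+> {()}. (case i of Inl x \<Rightarrow> (\<lambda>(p, c, k). fp_feat \<alpha> \<theta> s p c k) x | Inr _ \<Rightarrow> fp_val \<theta> s) *
       (case i of Inl x \<Rightarrow> (\<lambda>(p, c, k). fp_feat \<beta> \<psi> t p c k) x | Inr _ \<Rightarrow> fp_val \<psi> t))"
      using I by (simp add: sum.Plus flip: cart) (simp add: case_prod_unfold)
  next
    fix s assume s: "s \<in> F"
    have "(\<Sum>p\<in>short_lists A m. \<Sum>c\<in>C. \<Sum>k<n. (cmod (fp_feat \<alpha> \<theta> s p c k))\<^sup>2) + (cmod (fp_val \<theta> s))\<^sup>2 \<le> 1 + \<delta> / (1 - \<rho>\<^sup>2)"
      by (rule fp_feat_norm) (use A s m \<alpha> \<rho> \<delta> in \<open>auto simp: \<theta>_def subset_iff\<close>)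
    then show "(\<Sum>i\<in>?I <+> {()}. (cmod (case i of Inl x \<Rightarrow> (\<lambda>(p, c, k). fp_feat \<alpha> \<theta> s p c k) x | Inr _ \<Rightarrow> fp_val \<theta> s))\<^sup>2) \<le> 1 + \<delta> / (1 - \<rho>\<^sup>2)"
      using I by (simp add: sum.Plus flip: cart) (simp add: case_prod_unfold)
  next
    fix s assume s: "s \<in> F"
    have "(\<Sum>p\<in>short_lists A m. \<Sum>c\<in>C. \<Sum>k<n. (cmod (fp_feat \<beta> \<psi> s p c k))\<^sup>2) + (cmod (fp_val \<psi> s))\<^sup>2 \<le> 1 + \<delta> / (1 - \<rho>\<^sup>2)"
      by (rule fp_feat_norm) (use A s m \<beta> \<rho> \<delta> in \<open>auto simp: subset_iff\<close>)
    then show "(\<Sum>i\<in>?I <+> {()}. (cmod (case i of Inl x \<Rightarrow> (\<lambda>(p, c, k). fp_feat \<beta> \<psi> s p c k) x | Inr _ \<Rightarrow> fp_val \<psi> s))\<^sup>2) \<le> 1 + \<delta> / (1 - \<rho>\<^sup>2)"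
      using I by (simp add: sum.Plus flip: cart) (simp add: case_prod_unfold)
  qed
qed

section \<open>Kernels close to a positive definite one\<close>

lemma schur_factor_bound:
  assumes "schur_factor F C K" "x \<in> F" "y \<in> F"
  shows "cmod (K x y) \<le> C"
proof -
  obtain n \<alpha> \<beta> where "schur_rep F C K n \<alpha> \<beta>"
    using assms(1) unfolding schur_factor_def by blast
  note rep = schur_repD[OF this]
  have C: "0 \<le> C" using rep(2)[OF assms(2)] sum_nonneg[of "{..<n}" "\<lambda>k. (cmod (\<alpha> x k))\<^sup>2"] by simp
  have "(cmod (K x y))\<^sup>2 \<le> (\<Sum>k<n. (cmod (\<alpha> x k))\<^sup>2) * (\<Sum>k<n. (cmod (\<beta> y k))\<^sup>2)"
    using cmod_sum_mult_le[of "\<alpha> x" "\<beta> y" "{..<n}"] rep(1)[OF assms(2,3)] by simp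
  also have "\<dots> \<le> C * C"
    using rep(2)[OF assms(2)] rep(3)[OF assms(3)] C by (intro mult_mono) (auto simp: sum_nonneg)
  finally show ?thesis using power2_le_imp_le[of "cmod (K x y)" C] C by (simp only: power2_eq_square)
qed

text \<open>The vectors \<open>a0\<close> and \<open>cnj b0\<close> are at distance at most \<open>sqrt 2 * \<tau>\<close>, so that removing from \<open>a\<close> its component along
  \<open>a0\<close>, measured by \<open>b0\<close>, is almost an orthogonal projection.\<close>

lemma oblique_projection_norm:
  fixes a a0 b0 :: "'i \<Rightarrow> complex" and \<tau> :: real
  assumes \<tau>: "0 < \<tau>" "\<tau> \<le> 1"
    and a: "(\<Sum>k\<in>I. (cmod (a k))\<^sup>2) \<le> 1 + \<tau>\<^sup>2"
    and a0: "(\<Sum>k\<in>I. (cmod (a0 k))\<^sup>2) \<le> 1 + \<tau>\<^sup>2"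
    and b0: "(\<Sum>k\<in>I. (cmod (b0 k))\<^sup>2) \<le> 1 + \<tau>\<^sup>2"
    and one: "(\<Sum>k\<in>I. a0 k * b0 k) = 1"
    and c: "c = (\<Sum>k\<in>I. a k * b0 k)"
  shows "(\<Sum>k\<in>I. (cmod (a k - c * a0 k))\<^sup>2) + (cmod c)\<^sup>2 \<le> 1 + 27 * \<tau>"
proof -
  define C where "C = (cmod c)\<^sup>2"
  \<comment> \<open>\<open>u\<close> is the residual when the component is removed along
    \<open>cnj b0\<close>, where the cross term can be computed exactly; \<open>v\<close> is the
    price for removing it along \<open>a0\<close> instead.\<close>
  define u where "u k = a k - c * cnj (b0 k)" for k
  define v where "v k = c * (cnj (b0 k) - a0 k)" for k
  have \<tau>2: "\<tau>\<^sup>2 \<le> \<tau>" using \<tau> by (simp add: power2_eq_square mult_left_le_one_le)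
  have "C \<le> (\<Sum>k\<in>I. (cmod (a k))\<^sup>2) * (\<Sum>k\<in>I. (cmod (b0 k))\<^sup>2)"
    unfolding C_def c by (rule cmod_sum_mult_le)
  also have "\<dots> \<le> 2 * 2" using a b0 \<tau> \<tau>2 by (intro mult_mono) (auto simp: sum_nonneg)
  finally have C: "0 \<le> C" "C \<le> 4" by (simp_all add: C_def)
  have R: "(\<Sum>k\<in>I. Re (cnj c * (a k * b0 k))) = Re (cnj c * c)"
    by (simp only: Re_sum[symmetric] sum_distrib_left[symmetric] c[symmetric])
  have "(\<Sum>k\<in>I. (cmod (u k))\<^sup>2) = (\<Sum>k\<in>I. (cmod (a k))\<^sup>2 - 2 * Re (cnj c * (a k * b0 k)) + C * (cmod (b0 k))\<^sup>2)"
    unfolding u_def C_def by (intro sum.cong refl, unfold cmod_power2) (simp add: power2_eq_square algebra_simps)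
  also have "\<dots> = (\<Sum>k\<in>I. (cmod (a k))\<^sup>2) - 2 * Re (cnj c * c) + C * (\<Sum>k\<in>I. (cmod (b0 k))\<^sup>2)"
    by (simp only: sum.distrib sum_subtractf sum_distrib_left[symmetric] R)
  also have "Re (cnj c * c) = C" unfolding C_def cmod_power2 by (simp add: power2_eq_square)
  also have "C * (\<Sum>k\<in>I. (cmod (b0 k))\<^sup>2) \<le> C * (1 + \<tau>\<^sup>2)" by (rule mult_left_mono[OF b0 C(1)])
  finally have X: "(\<Sum>k\<in>I. (cmod (u k))\<^sup>2) \<le> 1 + \<tau>\<^sup>2 - C + C * \<tau>\<^sup>2" using a by (simp add: algebra_simps)
  have "(\<Sum>k\<in>I. (cmod (v k))\<^sup>2) = (\<Sum>k\<in>I. C * ((cmod (b0 k))\<^sup>2 + (cmod (a0 k))\<^sup>2 - 2 * Re (a0 k * b0 k)))"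
    unfolding v_def C_def norm_mult power_mult_distrib
    by (intro sum.cong refl arg_cong2[where f="(*)"], unfold cmod_power2) (simp add: power2_eq_square algebra_simps)
  also have "\<dots> = C * ((\<Sum>k\<in>I. (cmod (b0 k))\<^sup>2) + (\<Sum>k\<in>I. (cmod (a0 k))\<^sup>2) - 2 * Re (\<Sum>k\<in>I. a0 k * b0 k))"
    by (simp only: sum_distrib_left[symmetric] sum.distrib sum_subtractf Re_sum[symmetric])
  also have "\<dots> \<le> C * (2 * \<tau>\<^sup>2)" unfolding one using a0 b0 by (intro mult_left_mono C) simp
  finally have Y: "(\<Sum>k\<in>I. (cmod (v k))\<^sup>2) \<le> C * (2 * \<tau>\<^sup>2)" .
  \<comment> \<open>The squared length of \<open>v\<close> is of order
    \<open>\<tau>\<^sup>2\<close>, so even with the large weight \<open>1 + 1 / \<tau>\<close> it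
    contributes only order \<open>\<tau>\<close>.\<close>
  have "(\<Sum>k\<in>I. (cmod (a k - c * a0 k))\<^sup>2) \<le> (\<Sum>k\<in>I. (1 + \<tau>) * (cmod (u k))\<^sup>2 + (1 + 1 / \<tau>) * (cmod (v k))\<^sup>2)"
  proof (rule sum_mono)
    fix k
    have "a k - c * a0 k = u k + v k" by (simp add: u_def v_def algebra_simps)
    then have "cmod (a k - c * a0 k) \<le> cmod (u k) + cmod (v k)" using norm_triangle_ineq by metis
    then have "(cmod (a k - c * a0 k))\<^sup>2 \<le> (cmod (u k) + cmod (v k))\<^sup>2" by (rule power_mono) simp
    moreover have "2 * cmod (u k) * cmod (v k) \<le> \<tau> * (cmod (u k))\<^sup>2 + (cmod (v k))\<^sup>2 / \<tau>"
    proof -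
      have "0 \<le> (\<tau> * cmod (u k) - cmod (v k))\<^sup>2 / \<tau>" using \<tau> by simp
      also have "\<dots> = \<tau> * (cmod (u k))\<^sup>2 + (cmod (v k))\<^sup>2 / \<tau> - 2 * cmod (u k) * cmod (v k)"
        using \<tau> by (simp add: power2_diff field_simps power2_eq_square)
      finally show ?thesis by simp
    qed
    ultimately show "(cmod (a k - c * a0 k))\<^sup>2 \<le> (1 + \<tau>) * (cmod (u k))\<^sup>2 + (1 + 1 / \<tau>) * (cmod (v k))\<^sup>2"
      by (simp add: power2_sum algebra_simps)
  qed
  also have "\<dots> = (1 + \<tau>) * (\<Sum>k\<in>I. (cmod (u k))\<^sup>2) + (1 + 1 / \<tau>) * (\<Sum>k\<in>I. (cmod (v k))\<^sup>2)"
    by (simp add: sum.distrib sum_distrib_left)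
  also have "\<dots> \<le> (1 + \<tau>) * (1 + \<tau>\<^sup>2 - C + C * \<tau>\<^sup>2) + (1 + 1 / \<tau>) * (C * (2 * \<tau>\<^sup>2))"
    using \<tau> X Y by (intro add_mono mult_left_mono) auto
  also have "\<dots> = 1 + \<tau>\<^sup>2 - C + C * \<tau>\<^sup>2 + \<tau> + \<tau> * \<tau>\<^sup>2 - C * \<tau> + \<tau> * (C * \<tau>\<^sup>2) + 2 * (C * \<tau>\<^sup>2) + 2 * (C * \<tau>)"
    using \<tau> by (simp add: field_simps power2_eq_square)
  finally have Z: "(\<Sum>k\<in>I. (cmod (a k - c * a0 k))\<^sup>2) + C \<le>
      1 + \<tau>\<^sup>2 + C * \<tau>\<^sup>2 + \<tau> + \<tau> * \<tau>\<^sup>2 + \<tau> * (C * \<tau>\<^sup>2) + 2 * (C * \<tau>\<^sup>2) + C * \<tau>" by simp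
  have 1: "C * \<tau>\<^sup>2 \<le> 4 * \<tau>" using C \<tau> \<tau>2 by (intro mult_mono) auto
  have 2: "C * \<tau> \<le> 4 * \<tau>" using C \<tau> by (intro mult_right_mono) auto
  have 3: "\<tau> * \<tau>\<^sup>2 \<le> 1 * \<tau>" using \<tau> \<tau>2 by (intro mult_mono) auto
  have 4: "\<tau> * (C * \<tau>\<^sup>2) \<le> 1 * (4 * \<tau>)" by (rule mult_mono[OF \<tau>(2) 1]) (use \<tau> C in auto)
  \<comment> \<open>The collected error terms sum to at most \<open>23 * \<tau>\<close>, so the
    constant 27 leaves room.\<close>
  show ?thesis using Z 1 2 3 4 \<tau>2 \<tau>(1) unfolding C_def[symmetric] by linarith
qed

lemma roots_of_unity_orthogonal:
  assumes "i < N" "j < N"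
  shows "(\<Sum>k<N. cis (2 * pi * real k / real N) ^ i * cnj (cis (2 * pi * real k / real N)) ^ j) = (if i = j then of_nat N else 0)"
proof -
  define \<omega> where "\<omega> k = cis (2 * pi * real k / real N)" for k
  have bij: "bij_betw \<omega> {..<N} {z. z ^ N = 1}" 
    using Complex.bij_betw_roots_unity[of N] assms by (simp add: \<omega>_def[abs_def])
  have sw: "\<omega> k ^ i = \<omega> i ^ k" for i k unfolding \<omega>_def Complex.DeMoivre by (intro arg_cong[where f=cis]) (simp add: mult_ac)
  define w where "w = \<omega> i * cnj (\<omega> j)"
  have n1: "\<omega> k * cnj (\<omega> k) = 1" for k by (simp add: \<omega>_def cis_cnj cis_mult)
  have "\<omega> i ^ N = 1" "\<omega> j ^ N = 1" using bij assms by (auto simp: bij_betw_def)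
  then have wN: "w ^ N = 1" by (simp add: w_def power_mult_distrib flip: complex_cnj_power)
  have "(\<Sum>k<N. \<omega> k ^ i * cnj (\<omega> k) ^ j) = (\<Sum>k<N. w ^ k)"
    by (simp add: w_def power_mult_distrib flip: complex_cnj_power) (simp add: sw)
  also have "\<dots> = (if i = j then of_nat N else 0)"
  proof (cases "i = j")
    case True
    then show ?thesis using n1 by (simp add: w_def)
  next
    case False
    have "w \<noteq> 1"
    proof
      assume "w = 1"
      have "\<omega> i = \<omega> i * (\<omega> j * cnj (\<omega> j))" by (simp only: n1 mult_1_right)
      also have "\<dots> = w * \<omega> j" by (simp only: w_def mult_ac)
      finally have "\<omega> i = \<omega> j" unfolding \<open>w = 1\<close> by (simp only: mult_1_left)
      then show False using bij assms False by (auto simp: bij_betw_def inj_on_def)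
    qed
    then show ?thesis using False wN by (simp add: geometric_sum)
  qed
  finally show ?thesis unfolding \<omega>_def .
qed

text \<open>The identity keeps the value 1, as telescoping along a common prefix requires. Letters
  of a reduced word differ from the identity, so each of them contributes one factor
  \<open>z\<close>.\<close>

definition unit_scale :: "('h, 'm) monoid_scheme \<Rightarrow> complex \<Rightarrow> ('h \<Rightarrow> complex) \<Rightarrow> 'h \<Rightarrow> complex" where
  "unit_scale H z \<phi> h = (if h = \<one>\<^bsub>H\<^esub> then 1 else z * \<phi> h)"

lemma fp_val_unit_scale:
  "fp_red H s \<Longrightarrow> fp_val (unit_scale H z \<phi>) s = z ^ length s * fp_val \<phi> s"
  by (induction H s rule: fp_red.induct) (auto simp: unit_scale_def)

lemma fp_red_letter: "fp_red H s \<Longrightarrow> h \<in> snd ` set s \<Longrightarrow> h \<in> carrier H \<and> h \<noteq> \<one>\<^bsub>H\<^esub>"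
  by (induction H s rule: fp_red.induct) auto

context group
begin

text \<open>The scaled function is \<open>z\<close> times \<phi> plus \<open>1 - z\<close> times the
  point mass at the identity, whose kernel is the identity matrix. For \<open>z\<close> in the unit
  interval this is a convex combination; for complex \<open>z\<close> it costs only a
  constant.\<close>

lemma unit_scale_schur_factor:
  assumes W: "finite W" "W \<subseteq> carrier G" and one: "\<phi> \<one> = 1"
    and fac: "schur_factor W C (\<lambda>x y. \<phi> (inv x \<otimes> y))" and C: "C \<ge> 0"
  shows "schur_factor W (cmod z * C + cmod (1 - z)) (\<lambda>x y. unit_scale G z \<phi> (inv x \<otimes> y))"
proof -
  have "schur_factor W (cmod z * C + cmod (1 - z) * 1) (\<lambda>x y. z * \<phi> (inv x \<otimes> y) + (1 - z) * (if x = y then 1 else 0))"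
    by (intro schur_factor_add schur_factor_scale fac schur_factor_delta C W) auto
  then have "schur_factor W (cmod z * C + cmod (1 - z)) (\<lambda>x y. z * \<phi> (inv x \<otimes> y) + (1 - z) * (if x = y then 1 else 0))"
    by simp
  then show ?thesis
  proof (rule schur_factor_cong)
    fix x y assume "x \<in> W" "y \<in> W"
    then have c: "x \<in> carrier G" "y \<in> carrier G" using W by auto
    then have "inv x \<otimes> y = \<one> \<longleftrightarrow> x = y"
      by (metis inv_closed inv_inv l_inv inv_equality)
    then show "z * \<phi> (inv x \<otimes> y) + (1 - z) * (if x = y then 1 else 0) = unit_scale G z \<phi> (inv x \<otimes> y)"
      using c one by (auto simp: unit_scale_def)
  qed
qed

text \<open>Removing from the vectors of \<psi> their components along the vectors at the identity
  leaves exactly the kernel \<open>\<psi> (inv h \<otimes> h') - \<psi> (inv h) * \<psi> h'\<close>.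
  As those two vectors are almost conjugate, lengths exceed 1 only by order
  \<open>\<tau>\<close>.\<close>

lemma fp_val_schur_factor_real:
  assumes F: "finite F" "\<And>s. s \<in> F \<Longrightarrow> fp_red G s" and one: "\<phi> \<one> = 1"
    and \<tau>: "0 < \<tau>" "\<tau> \<le> 1"
    and fac: "\<And>W. finite W \<Longrightarrow> W \<subseteq> carrier G \<Longrightarrow> schur_factor W (1 + \<tau>\<^sup>2) (\<lambda>x y. \<phi> (inv x \<otimes> y))"
    and r: "0 \<le> r" "r * (1 + \<tau>\<^sup>2) \<le> \<rho>" "\<rho> < 1"
  shows "schur_factor F (1 + 27 * \<tau> / (1 - \<rho>\<^sup>2))
    (\<lambda>s t. fp_val (unit_scale G (of_real r) \<phi>) (fp_mul G (fp_inv G s) t))"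
proof -
  define \<psi> where "\<psi> = unit_scale G (of_real r) \<phi>"
  have \<phi>_le: "cmod (\<phi> h) \<le> 1 + \<tau>\<^sup>2" if "h \<in> carrier G" for h
    using schur_factor_bound[OF fac, of "{\<one>, h}" \<one> h] that by simp
  have \<tau>2: "1 + \<tau>\<^sup>2 \<ge> 1" by simp
  have \<rho>0: "0 \<le> \<rho>" "r \<le> \<rho>" 
    using r(1,2) mult_left_mono[OF \<tau>2 r(1)] by auto
  define L where "L = (\<Union>s\<in>F. snd ` set s)"
  \<comment> \<open>No reduced word contains the identity, but its vectors \<open>a \<one>\<close>
    and \<open>b \<one>\<close> are the axes of the projection.\<close>
  define W where "W = insert \<one> L"
  have L: "finite L" "\<And>h. h \<in> L \<Longrightarrow> h \<in> carrier G \<and> h \<noteq> \<one>" "\<And>s. s \<in> F \<Longrightarrow> snd ` set s \<subseteq> L"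
  proof -
    show "finite L" using F(1) by (simp add: L_def)
    show "h \<in> carrier G \<and> h \<noteq> \<one>" if h: "h \<in> L" for h
    proof -
      from h obtain s where s: "s \<in> F" "h \<in> snd ` set s" unfolding L_def by blast
      show ?thesis by (rule fp_red_letter[OF F(2)[OF s(1)] s(2)])
    qed
  qed (auto simp: L_def)
  have W: "finite W" "W \<subseteq> carrier G" "\<one> \<in> W" using L by (auto simp: W_def)
  have "schur_factor W (cmod (of_real r) * (1 + \<tau>\<^sup>2) + cmod (1 - of_real r)) (\<lambda>x y. \<psi> (inv x \<otimes> y))"
    unfolding \<psi>_def by (rule unit_scale_schur_factor[OF W(1,2) one fac]) (use W in auto)
  moreover have "cmod (of_real r) * (1 + \<tau>\<^sup>2) + cmod (1 - of_real r) \<le> 1 + \<tau>\<^sup>2"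
  proof -
    have "r \<le> 1" using \<rho>0 r by simp
    then have "cmod (1 - of_real r) = 1 - r" by (metis abs_of_nonneg diff_ge_0_iff_ge norm_of_real of_real_1 of_real_diff)
    moreover have "r * \<tau>\<^sup>2 \<le> 1 * \<tau>\<^sup>2" using \<open>r \<le> 1\<close> by (intro mult_right_mono) auto
    ultimately show ?thesis using r by (simp add: algebra_simps)
  qed
  ultimately have "schur_factor W (1 + \<tau>\<^sup>2) (\<lambda>x y. \<psi> (inv x \<otimes> y))"
    by (rule schur_factor_mono) simp
  then obtain n a b where "schur_rep W (1 + \<tau>\<^sup>2) (\<lambda>x y. \<psi> (inv x \<otimes> y)) n a b"
    unfolding schur_factor_def by blast
  note rep = schur_repD[OF this]
  have \<psi>1: "\<psi> \<one> = 1" by (simp add: \<psi>_def unit_scale_def)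
  have rl: "\<psi> (inv h) = (\<Sum>k<n. a h k * b \<one> k)" "\<psi> h = (\<Sum>k<n. a \<one> k * b h k)" if "h \<in> W" for h
    using rep(1)[OF that W(3)] rep(1)[OF W(3) that] that W(2) by (auto simp: subset_iff)
  have one1: "(\<Sum>k<n. a \<one> k * b \<one> k) = 1" using rl(2)[OF W(3)] \<psi>1 by simp
  have "schur_factor F (1 + (27 * \<tau>) / (1 - \<rho>\<^sup>2)) (fp_ker G \<psi>)"
  proof (rule fp_ker_schur_factor[where W=L and \<alpha>="\<lambda>h k. a h k - \<psi> (inv h) * a \<one> k" and \<beta>="\<lambda>h k. b h k - \<psi> h * b \<one> k" and n=n])
    fix h h' assume h: "h \<in> L" "h' \<in> L"
    then have hW: "h \<in> W" "h' \<in> W" by (auto simp: W_def)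
    have "(\<Sum>k<n. (a h k - \<psi> (inv h) * a \<one> k) * (b h' k - \<psi> h' * b \<one> k)) =
      (\<Sum>k<n. a h k * b h' k) - \<psi> h' * (\<Sum>k<n. a h k * b \<one> k) - \<psi> (inv h) * (\<Sum>k<n. a \<one> k * b h' k)
        + \<psi> (inv h) * \<psi> h' * (\<Sum>k<n. a \<one> k * b \<one> k)"
      unfolding sum_distrib_left sum_subtractf[symmetric] sum.distrib[symmetric]
      by (intro sum.cong refl) (simp add: algebra_simps)
    also have "\<dots> = \<psi> (inv h \<otimes> h') - \<psi> (inv h) * \<psi> h'"
      unfolding one1 using rl(1)[OF hW(1)] rl(2)[OF hW(2)] rep(1)[OF hW] by simp
    finally show "\<psi> (inv h \<otimes> h') - \<psi> (inv h) * \<psi> h' = (\<Sum>k<n. (a h k - \<psi> (inv h) * a \<one> k) * (b h' k - \<psi> h' * b \<one> k))" by simp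
  next
    fix h assume "h \<in> L"
    then have h: "h \<in> W" "h \<in> carrier G" "h \<noteq> \<one>" "inv h \<noteq> \<one>" using L by (auto simp: W_def inv_eq_1_iff)
    show "(\<Sum>k<n. (cmod (a h k - \<psi> (inv h) * a \<one> k))\<^sup>2) + (cmod (\<psi> (inv h)))\<^sup>2 \<le> 1 + 27 * \<tau>"
      by (rule oblique_projection_norm[OF \<tau> rep(2) rep(2) rep(3) one1 rl(1)]) (use h W in auto)
    show "(\<Sum>k<n. (cmod (b h k - \<psi> h * b \<one> k))\<^sup>2) + (cmod (\<psi> h))\<^sup>2 \<le> 1 + 27 * \<tau>"
      by (rule oblique_projection_norm[OF \<tau> rep(3) rep(3) rep(2)]) (use h W one1 rl(2)[OF h(1)] in \<open>auto simp: mult.commute\<close>)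
    have le: "r * cmod (\<phi> x) \<le> \<rho>" if "x \<in> carrier G" for x
      using mult_left_mono[OF \<phi>_le[OF that] r(1)] r(2) by simp
    show "cmod (\<psi> h) \<le> \<rho>" "cmod (\<psi> (inv h)) \<le> \<rho>"
      using h le[of h] le[of "inv h"] r(1) by (simp_all add: \<psi>_def unit_scale_def norm_mult)
    show "inv h \<otimes> h = \<one>" using h by simp
  qed (use F L \<psi>1 \<rho>0 r \<tau> in auto)
  then show ?thesis
    by (rule schur_factor_cong) (use F in \<open>simp add: fp_val_inv_mul \<psi>_def\<close>)
qed

text \<open>For complex \<open>z\<close> there is no positivity to exploit, and the product
  \<open>\<psi> (inv h) * \<psi> h'\<close> is simply subtracted as a rank-one kernel. The constant
  is far from 1 but depends only on \<rho>.\<close>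

lemma fp_val_schur_factor_complex:
  assumes F: "finite F" "\<And>s. s \<in> F \<Longrightarrow> fp_red G s" and one: "\<phi> \<one> = 1"
    and C: "0 \<le> C" "C \<le> 2"
    and fac: "\<And>W. finite W \<Longrightarrow> W \<subseteq> carrier G \<Longrightarrow> schur_factor W C (\<lambda>x y. \<phi> (inv x \<otimes> y))"
    and z: "cmod z * C \<le> \<rho>" "cmod z \<le> 1" "\<rho> < 1"
  shows "schur_factor F (1 + 11 / (1 - \<rho>\<^sup>2)) (\<lambda>s t. fp_val (unit_scale G z \<phi>) (fp_mul G (fp_inv G s) t))"
proof -
  define \<psi> where "\<psi> = unit_scale G z \<phi>"
  have \<rho>0: "0 \<le> \<rho>" using z C by (meson mult_nonneg_nonneg norm_ge_zero order_trans)
  have \<phi>_le: "cmod (\<phi> h) \<le> C" if "h \<in> carrier G" for h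
    using schur_factor_bound[OF fac, of "{\<one>, h}" \<one> h] that by simp
  define L where "L = (\<Union>s\<in>F. snd ` set s)"
  have L: "finite L" "\<And>h. h \<in> L \<Longrightarrow> h \<in> carrier G \<and> h \<noteq> \<one>" "\<And>s. s \<in> F \<Longrightarrow> snd ` set s \<subseteq> L"
  proof -
    show "finite L" using F(1) by (simp add: L_def)
    show "h \<in> carrier G \<and> h \<noteq> \<one>" if h: "h \<in> L" for h
    proof -
      from h obtain s where s: "s \<in> F" "h \<in> snd ` set s" unfolding L_def by blast
      show ?thesis by (rule fp_red_letter[OF F(2)[OF s(1)] s(2)])
    qed
  qed (auto simp: L_def)
  have \<psi>1: "\<psi> \<one> = 1" by (simp add: \<psi>_def unit_scale_def)
  have \<psi>_le: "cmod (\<psi> h) \<le> \<rho>" if "h \<in> carrier G" "h \<noteq> \<one>" for h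
    using that mult_left_mono[OF \<phi>_le[OF that(1)], of "cmod z"] z by (simp add: \<psi>_def unit_scale_def norm_mult)
  have \<psi>2: "(cmod (\<psi> h))\<^sup>2 \<le> 1" if "h \<in> carrier G" "h \<noteq> \<one>" for h
    using \<psi>_le[OF that] z by (simp add: power_le_one)
  have "schur_factor L (cmod z * C + cmod (1 - z)) (\<lambda>x y. \<psi> (inv x \<otimes> y))"
    unfolding \<psi>_def by (rule unit_scale_schur_factor[OF _ _ one fac C(1)]) (use L in auto)
  moreover have "schur_factor L 1 (\<lambda>x y. - \<psi> (inv x) * \<psi> y)"
    by (rule schur_factor_rank_one) (use L \<psi>2 in \<open>auto simp: inv_eq_1_iff\<close>)
  ultimately have "schur_factor L ((cmod z * C + cmod (1 - z)) + 1) (\<lambda>x y. \<psi> (inv x \<otimes> y) + - \<psi> (inv x) * \<psi> y)"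
    by (rule schur_factor_add)
  \<comment> \<open>The summands are below 1, at most 2, and equal to 1, so 11 is a generous
    bound.\<close>
  moreover have "(cmod z * C + cmod (1 - z)) + 1 \<le> 11"
    using z norm_triangle_ineq4[of 1 z] by simp
  ultimately have "schur_factor L 11 (\<lambda>x y. \<psi> (inv x \<otimes> y) + - \<psi> (inv x) * \<psi> y)"
    by (rule schur_factor_mono) simp
  then obtain n a b where "schur_rep L 11 (\<lambda>x y. \<psi> (inv x \<otimes> y) + - \<psi> (inv x) * \<psi> y) n a b"
    unfolding schur_factor_def by blast
  note rep = schur_repD[OF this]
  have "schur_factor F (1 + 11 / (1 - \<rho>\<^sup>2)) (fp_ker G \<psi>)"
  proof (rule fp_ker_schur_factor[where W=L and \<alpha>=a and \<beta>=b and n=n])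
    fix h h' assume h: "h \<in> L" "h' \<in> L"
    show "\<psi> (inv h \<otimes> h') - \<psi> (inv h) * \<psi> h' = (\<Sum>k<n. a h k * b h' k)"
      using rep(1)[OF h] by simp
  next
    fix h assume h: "h \<in> L"
    then have c: "h \<in> carrier G" "h \<noteq> \<one>" "inv h \<noteq> \<one>" using L by (auto simp: inv_eq_1_iff)
    show "(\<Sum>k<n. (cmod (a h k))\<^sup>2) + (cmod (\<psi> (inv h)))\<^sup>2 \<le> 1 + 11"
      using rep(2)[OF h] \<psi>2[of "inv h"] c by simp
    show "(\<Sum>k<n. (cmod (b h k))\<^sup>2) + (cmod (\<psi> h))\<^sup>2 \<le> 1 + 11"
      using rep(3)[OF h] \<psi>2[of h] c by simp
    show "cmod (\<psi> h) \<le> \<rho>" "cmod (\<psi> (inv h)) \<le> \<rho>" using \<psi>_le c by auto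
    show "inv h \<otimes> h = \<one>" using c by simp
  qed (use F L \<psi>1 \<rho>0 z in auto)
  then show ?thesis
    by (rule schur_factor_cong) (use F in \<open>simp add: fp_val_inv_mul \<psi>_def\<close>)
qed

end

section \<open>Truncation by word length\<close>

definition fp_trunc :: "real \<Rightarrow> nat \<Rightarrow> ('h \<Rightarrow> complex) \<Rightarrow> ('c \<times> 'h) list \<Rightarrow> complex" where
  "fp_trunc r d \<phi> s = (if length s \<le> d then of_real r ^ length s * fp_val \<phi> s else 0)"

lemma sum_powers_ge_le:
  fixes q :: real
  assumes "0 < q" "q < 1"
  shows "(\<Sum>n\<in>{m..<N}. q ^ n) \<le> q ^ m / (1 - q)"
proof -
  have "(\<Sum>n\<in>{m..<N}. q ^ n) = q ^ m * (\<Sum>i<N - m. q ^ i)"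
    by (subst sum.atLeastLessThan_shift_0) (simp add: power_add sum_distrib_left atLeast0LessThan)
  also have "\<dots> \<le> q ^ m * (1 / (1 - q))"
    using assms geometric_sum_less[of q "{..<N - m}"] by (intro mult_left_mono) auto
  finally show ?thesis by simp
qed

context group
begin

text \<open>On a finite set the lengths are bounded, so averaging over roots of unity isolates the part of a given length.\<close>

lemma fp_length_schur_factor:
  assumes F: "finite F" and len: "\<And>s t. s \<in> F \<Longrightarrow> t \<in> F \<Longrightarrow> length (u s t) < N" and "n < N"
    and fac: "\<And>z. cmod z = R \<Longrightarrow> schur_factor F M (\<lambda>s t. z ^ length (u s t) * v s t)"
    and R: "R > 0" and M: "M \<ge> 0" and r: "r \<ge> 0"
  shows "schur_factor F ((r / R) ^ n * M) (\<lambda>s t. if length (u s t) = n then of_real r ^ n * v s t else 0)"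
proof -
  have N: "N > 0" using \<open>n < N\<close> by simp
  define \<omega> where "\<omega> k = cis (2 * pi * real k / real N)" for k
  \<comment> \<open>These are discrete Fourier weights for degree \<open>n\<close>, with
    \<open>(r / R) ^ n\<close> passing from radius \<open>R\<close> to radius \<open>r\<close>. As
    all lengths are below \<open>N\<close>, different lengths are not confused modulo
    \<open>N\<close>.\<close>
  define c where "c k = of_real ((r / R) ^ n / real N) * cnj (\<omega> k) ^ n" for k
  have nc: "cmod (c k) \<le> (r / R) ^ n / real N" for k
    using R r by (simp add: c_def \<omega>_def norm_mult norm_power norm_divide)
  have "schur_factor F ((r / R) ^ n / real N * M) (\<lambda>s t. c k * ((of_real R * \<omega> k) ^ length (u s t) * v s t))" for k
    by (rule schur_factor_scale[OF fac M nc]) (use R in \<open>simp add: \<omega>_def norm_mult\<close>)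
  then have "schur_factor F (\<Sum>k<N. (r / R) ^ n / real N * M) (\<lambda>s t. \<Sum>k<N. c k * ((of_real R * \<omega> k) ^ length (u s t) * v s t))"
    by (intro schur_factor_sum) auto
  then have "schur_factor F ((r / R) ^ n * M) (\<lambda>s t. \<Sum>k<N. c k * ((of_real R * \<omega> k) ^ length (u s t) * v s t))"
    using N by simp
  then show ?thesis
  proof (rule schur_factor_cong)
    fix s t assume "s \<in> F" "t \<in> F"
    define m where "m = length (u s t)"
    have m: "m < N" using len \<open>s \<in> F\<close> \<open>t \<in> F\<close> by (simp add: m_def)
    have "(\<Sum>k<N. c k * ((of_real R * \<omega> k) ^ m * v s t)) =
        of_real ((r / R) ^ n / real N) * of_real R ^ m * v s t * (\<Sum>k<N. \<omega> k ^ m * cnj (\<omega> k) ^ n)"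
      unfolding sum_distrib_left by (intro sum.cong refl) (simp add: c_def power_mult_distrib mult_ac)
    also have "\<dots> = of_real ((r / R) ^ n / real N) * of_real R ^ m * v s t * (if m = n then of_nat N else 0)"
      unfolding \<omega>_def roots_of_unity_orthogonal[OF m \<open>n < N\<close>] ..
    also have "\<dots> = (if m = n then of_real r ^ n * v s t else 0)"
      using N R by (simp add: power_divide)
    finally show "(\<Sum>k<N. c k * ((of_real R * \<omega> k) ^ length (u s t) * v s t)) =
        (if length (u s t) = n then of_real r ^ n * v s t else 0)" unfolding m_def .
  qed
qed

text \<open>The truncation is the full multiplier at \<open>r\<close> minus its parts of length
  above \<open>d\<close>. The part of length \<open>n\<close> costs \<open>(r / R) ^ n\<close> times
  a constant, and summing the whole geometric tail makes the bound independent of the longest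
  quotient, hence of \<open>F\<close>.\<close>

lemma fp_trunc_schur_factor:
  assumes F: "finite F" "\<And>s. s \<in> F \<Longrightarrow> fp_red G s" and one: "\<phi> \<one> = 1"
    and \<tau>: "0 < \<tau>" "\<tau> \<le> 1"
    and fac: "\<And>W. finite W \<Longrightarrow> W \<subseteq> carrier G \<Longrightarrow> schur_factor W (1 + \<tau>\<^sup>2) (\<lambda>x y. \<phi> (inv x \<otimes> y))"
    and r: "0 < r" "r < R" "R * (1 + \<tau>\<^sup>2) \<le> \<rho>" "\<rho> < 1"
  shows "schur_factor F (1 + 27 * \<tau> / (1 - \<rho>\<^sup>2) + (1 + 11 / (1 - \<rho>\<^sup>2)) * ((r / R) ^ Suc d / (1 - r / R)))
    (\<lambda>s t. fp_trunc r d \<phi> (fp_mul G (fp_inv G s) t))"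
proof -
  define u where "u s t = fp_mul G (fp_inv G s) t" for s t :: "('c \<times> 'a) list"
  define M where "M = 1 + 11 / (1 - \<rho>\<^sup>2)"
  have "R * 1 \<le> R * (1 + \<tau>\<^sup>2)" by (rule mult_left_mono) (use r in auto)
  with r have R: "R > 0" "R \<le> \<rho>" by linarith+
  have \<rho>2: "\<rho>\<^sup>2 < 1" using R r by (simp add: abs_square_less_1)
  have M: "M \<ge> 0" using \<rho>2 by (simp add: M_def)
  have red: "fp_red G (u s t)" if "s \<in> F" "t \<in> F" for s t
    unfolding u_def using F(2) that by (intro fp_mul_red fp_inv_carrier fp_red_carrier)
  have val: "fp_val (unit_scale G z \<phi>) (u s t) = z ^ length (u s t) * fp_val \<phi> (u s t)" if "s \<in> F" "t \<in> F" for s t z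
    by (rule fp_val_unit_scale[OF red[OF that]])
  have "finite ((\<lambda>(s, t). length (u s t)) ` (F \<times> F))" using F(1) by simp
  then obtain N where "\<forall>x\<in>(\<lambda>(s, t). length (u s t)) ` (F \<times> F). x < N"
    using finite_nat_set_iff_bounded by metis
  then have N: "length (u s t) < N" if "s \<in> F" "t \<in> F" for s t using that by auto
  have \<tau>2: "\<tau>\<^sup>2 \<le> 1" using \<tau> by (simp add: power_le_one)
  have cplx: "schur_factor F M (\<lambda>s t. z ^ length (u s t) * fp_val \<phi> (u s t))" if z: "cmod z = R" for z
  proof -
    have "schur_factor F M (\<lambda>s t. fp_val (unit_scale G z \<phi>) (fp_mul G (fp_inv G s) t))"
      unfolding M_def using fp_val_schur_factor_complex[OF F one _ _ fac] z r R \<tau>2 by simp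
    then show ?thesis by (rule schur_factor_cong) (use val in \<open>simp add: u_def\<close>)
  qed
  have "r * (1 + \<tau>\<^sup>2) \<le> \<rho>" using r mult_right_mono[of r R "1 + \<tau>\<^sup>2"] by simp
  then have "schur_factor F (1 + 27 * \<tau> / (1 - \<rho>\<^sup>2)) (\<lambda>s t. fp_val (unit_scale G (of_real r) \<phi>) (fp_mul G (fp_inv G s) t))"
    using fp_val_schur_factor_real[OF F one \<tau> fac] r by simp
  then have 1: "schur_factor F (1 + 27 * \<tau> / (1 - \<rho>\<^sup>2)) (\<lambda>s t. of_real r ^ length (u s t) * fp_val \<phi> (u s t))"
    by (rule schur_factor_cong) (use val in \<open>simp add: u_def\<close>)
  let ?p = "\<lambda>n s t. if length (u s t) = n then of_real r ^ n * fp_val \<phi> (u s t) else 0"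
  have "schur_factor F ((r / R) ^ n * M) (?p n)" if "n \<in> {Suc d..<N}" for n
    by (rule fp_length_schur_factor[OF F(1) N _ cplx R(1) M]) (use that r in auto)
  then have "schur_factor F (\<Sum>n\<in>{Suc d..<N}. (r / R) ^ n * M) (\<lambda>s t. \<Sum>n\<in>{Suc d..<N}. ?p n s t)"
    by (intro schur_factor_sum) auto
  moreover have "(\<Sum>n\<in>{Suc d..<N}. (r / R) ^ n * M) \<le> M * ((r / R) ^ Suc d / (1 - r / R))"
    using sum_powers_ge_le[of "r / R" "Suc d" N] r R M
    by (subst sum_distrib_right[symmetric], subst mult.commute) (intro mult_left_mono; simp)
  ultimately have "schur_factor F (M * ((r / R) ^ Suc d / (1 - r / R))) (\<lambda>s t. \<Sum>n\<in>{Suc d..<N}. ?p n s t)"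
    by (rule schur_factor_mono) simp
  moreover have "M * ((r / R) ^ Suc d / (1 - r / R)) \<ge> 0"
    using M r R by (intro mult_nonneg_nonneg divide_nonneg_nonneg) auto
  ultimately have 2: "schur_factor F (1 * (M * ((r / R) ^ Suc d / (1 - r / R)))) (\<lambda>s t. (-1) * (\<Sum>n\<in>{Suc d..<N}. ?p n s t))"
    by (rule schur_factor_scale) simp
  have "schur_factor F (1 + 27 * \<tau> / (1 - \<rho>\<^sup>2) + 1 * (M * ((r / R) ^ Suc d / (1 - r / R))))
    (\<lambda>s t. of_real r ^ length (u s t) * fp_val \<phi> (u s t) + (-1) * (\<Sum>n\<in>{Suc d..<N}. ?p n s t))"
    by (rule schur_factor_add[OF 1 2])
  then have "schur_factor F (1 + 27 * \<tau> / (1 - \<rho>\<^sup>2) + M * ((r / R) ^ Suc d / (1 - r / R)))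
    (\<lambda>s t. of_real r ^ length (u s t) * fp_val \<phi> (u s t) + (-1) * (\<Sum>n\<in>{Suc d..<N}. ?p n s t))"
    by simp
  then show ?thesis unfolding M_def
  proof (rule schur_factor_cong)
    fix s t assume st: "s \<in> F" "t \<in> F"
    then show "of_real r ^ length (u s t) * fp_val \<phi> (u s t) + (-1) * (\<Sum>n\<in>{Suc d..<N}. ?p n s t) =
      fp_trunc r d \<phi> (fp_mul G (fp_inv G s) t)"
      using N[OF st] by (auto simp: fp_trunc_def u_def[symmetric])
  qed
qed

text \<open>The approximants of the net are near 1 at the identity; dividing by that value makes it
  exactly 1 at a small cost in norm.\<close>

lemma weakly_amenable_CH1_approx:
  assumes wa: "weakly_amenable_CH1 G" and S: "finite S" "S \<subseteq> carrier G" and \<tau>: "0 < \<tau>" "\<tau> \<le> 1"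
  obtains \<phi> where "fin_supp G \<phi>" "\<phi> \<one> = 1" "\<And>g. g \<in> S \<Longrightarrow> cmod (\<phi> g - 1) < \<tau>"
    "\<And>W. finite W \<Longrightarrow> W \<subseteq> carrier G \<Longrightarrow> schur_factor W (1 + \<tau>\<^sup>2) (\<lambda>x y. \<phi> (inv x \<otimes> y))"
proof -
  \<comment> \<open>Chosen so that \<open>(1 + 2 * \<eta>) / (1 - \<eta>)\<close> is at most
    \<open>1 + \<tau>\<^sup>2\<close> and \<open>2 * \<eta> / (1 - \<eta>)\<close> at most
    \<open>\<tau>\<close>. One \<open>\<eta>\<close> in the first numerator is the excess of the
    cb-norm, the other the loss in factorizing on a finite set; the denominators come from dividing
    by \<open>c\<close>.\<close>
  define \<eta> where "\<eta> = \<tau>\<^sup>2 / (4 + \<tau>\<^sup>2)"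
  have pos: "4 + \<tau>\<^sup>2 > 0" by (simp add: add_pos_nonneg)
  have \<eta>: "0 < \<eta>" "\<eta> < 1" using \<tau> pos by (auto simp: \<eta>_def)
  have \<eta>1: "1 - \<eta> = 4 / (4 + \<tau>\<^sup>2)" using pos by (simp add: \<eta>_def field_simps)
  from wa obtain F where F: "F \<noteq> bot" "\<forall>\<^sub>F phi in F. fin_supp G phi \<and> completely_bounded G phi"
    "\<forall>g\<in>carrier G. ((\<lambda>phi. phi g) \<longlongrightarrow> 1) F" "Limsup F (cb_norm G) \<le> 1"
    unfolding weakly_amenable_CH1_def by blast
  have "Limsup F (cb_norm G) < ereal (1 + \<eta>)" using F(4) \<eta> by (rule_tac le_less_trans) (auto simp: one_ereal_def)
  then have "\<forall>\<^sub>F phi in F. cb_norm G phi < ereal (1 + \<eta>)" by (rule Limsup_lessD)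
  moreover have "\<forall>\<^sub>F phi in F. \<forall>g\<in>insert \<one> S. dist (phi g) 1 < \<eta>"
    using S F(3) \<eta> by (intro eventually_ball_finite ballI) (auto intro: tendstoD)
  ultimately have "\<forall>\<^sub>F phi in F. fin_supp G phi \<and> cb_norm G phi < ereal (1 + \<eta>) \<and> (\<forall>g\<in>insert \<one> S. dist (phi g) 1 < \<eta>)"
    using F(2) by eventually_elim auto
  from eventually_happens'[OF F(1) this]
  obtain \<phi>0 where "fin_supp G \<phi>0 \<and> cb_norm G \<phi>0 < ereal (1 + \<eta>) \<and> (\<forall>g\<in>insert \<one> S. dist (\<phi>0 g) 1 < \<eta>)" ..
  then have \<phi>0: "fin_supp G \<phi>0" "cb_norm G \<phi>0 < ereal (1 + \<eta>)" "\<And>g. g \<in> insert \<one> S \<Longrightarrow> cmod (\<phi>0 g - 1) < \<eta>"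
    unfolding dist_norm by blast+
  define c where "c = \<phi>0 \<one>"
  have c: "cmod c \<ge> 1 - \<eta>" using \<phi>0(3)[of \<one>] norm_triangle_ineq2[of 1 "1 - c"] by (simp add: c_def norm_minus_commute)
  then have c0: "c \<noteq> 0" using \<eta> by auto
  show thesis
  proof (rule that[of "\<lambda>g. inverse c * \<phi>0 g"])
    show "fin_supp G (\<lambda>g. inverse c * \<phi>0 g)" using \<phi>0(1) c0 by (simp add: fin_supp_def)
    show "inverse c * \<phi>0 \<one> = 1" using c0 by (simp add: c_def)
    fix g assume "g \<in> S"
    have "cmod (\<phi>0 g - c) < 2 * \<eta>"
      using \<phi>0(3)[of g] \<phi>0(3)[of \<one>] norm_triangle_ineq4[of "\<phi>0 g - 1" "c - 1"] \<open>g \<in> S\<close> by (simp add: c_def)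
    also have "2 * \<eta> \<le> \<tau> * (1 - \<eta>)"
    proof -
      have "2 * \<tau>\<^sup>2 \<le> 4 * \<tau>" using \<tau> by (simp add: power2_eq_square)
      then show ?thesis unfolding \<eta>1 using pos by (simp add: \<eta>_def divide_right_mono)
    qed
    also have "\<dots> \<le> \<tau> * cmod c" using c \<tau> by (intro mult_left_mono) auto
    finally have "cmod (\<phi>0 g - c) < \<tau> * cmod c" .
    moreover have "inverse c * \<phi>0 g - 1 = (\<phi>0 g - c) / c" using c0 by (simp add: field_simps)
    ultimately show "cmod (inverse c * \<phi>0 g - 1) < \<tau>" using c0 by (simp add: norm_divide field_simps)
  next
    fix W assume W: "finite W" "W \<subseteq> carrier G"
    have "schur_factor W ((1 + \<eta>) + \<eta>) (\<lambda>x y. \<phi>0 (inv x \<otimes> y))"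
      by (rule schur_factor_if_cb_norm[OF is_group less_imp_le[OF \<phi>0(2)] _ \<eta>(1) W]) (use \<eta> in simp)
    then have "schur_factor W (1 / (1 - \<eta>) * ((1 + \<eta>) + \<eta>)) (\<lambda>x y. inverse c * \<phi>0 (inv x \<otimes> y))"
    proof (rule schur_factor_scale)
      show "cmod (inverse c) \<le> 1 / (1 - \<eta>)" 
        unfolding norm_inverse unfolding inverse_eq_divide by (rule frac_le) (use c \<eta> in auto)
    qed (use \<eta> in simp)
    moreover have "1 / (1 - \<eta>) * ((1 + \<eta>) + \<eta>) \<le> 1 + \<tau>\<^sup>2"
    proof -
      have "1 + \<eta> + \<eta> \<le> (1 + \<tau>\<^sup>2) * (1 - \<eta>)"
      proof -
        have "\<eta> * (3 + \<tau>\<^sup>2) \<le> \<eta> * (4 + \<tau>\<^sup>2)" using \<eta> by (intro mult_left_mono) auto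
        also have "\<dots> = \<tau>\<^sup>2" using pos by (simp add: \<eta>_def)
        finally show ?thesis by (simp add: algebra_simps)
      qed
      then show ?thesis using \<eta> by (simp add: field_simps)
    qed
    ultimately show "schur_factor W (1 + \<tau>\<^sup>2) (\<lambda>x y. inverse c * \<phi>0 (inv x \<otimes> y))"
      by (rule schur_factor_mono) simp
  qed
qed

end

lemma fp_val_near_one:
  assumes "\<And>h. h \<in> snd ` set s \<Longrightarrow> cmod (\<phi> h - 1) < \<tau>" "\<tau> \<ge> 0"
  shows "cmod (fp_val \<phi> s - 1) \<le> (1 + \<tau>) ^ length s - 1"
  using assms(1)
proof (induction s)
  case (Cons x s)
  have 1: "cmod (\<phi> (snd x) - 1) \<le> \<tau>" using Cons.prems[of "snd x"] by auto
  have 2: "cmod (\<phi> (snd x)) \<le> 1 + \<tau>" using 1 norm_triangle_ineq[of 1 "\<phi> (snd x) - 1"] by simp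
  have IH: "cmod (fp_val \<phi> s - 1) \<le> (1 + \<tau>) ^ length s - 1" using Cons by auto
  have "fp_val \<phi> (x # s) - 1 = \<phi> (snd x) * (fp_val \<phi> s - 1) + (\<phi> (snd x) - 1)" by (simp add: algebra_simps)
  then have "cmod (fp_val \<phi> (x # s) - 1) \<le> cmod (\<phi> (snd x)) * cmod (fp_val \<phi> s - 1) + cmod (\<phi> (snd x) - 1)"
    by (metis norm_mult norm_triangle_ineq)
  also have "\<dots> \<le> (1 + \<tau>) * ((1 + \<tau>) ^ length s - 1) + \<tau>"
    using 1 2 IH assms(2) by (intro add_mono mult_mono) auto
  finally show ?case by (simp add: algebra_simps)
qed simp

context group
begin

text \<open>The order of choices matters: \<open>r\<close> depends on the lengths in
  \<open>S\<close>, then \<open>R\<close> and \<rho> are put between \<open>r\<close> and 1, then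
  \<open>d\<close> makes the tail small and is large enough not to cut any word of \<open>S\<close>.
  Only then is \<tau>, and with it \<phi>, chosen; this is possible because the tail bound involves
  neither.\<close>

lemma fp_trunc_approx:
  assumes wa: "weakly_amenable_CH1 G" and S: "finite S" "\<And>s. s \<in> S \<Longrightarrow> fp_red G s" and e: "0 < e"
  obtains r d \<phi> where "fin_supp G \<phi>"
    "\<And>s. s \<in> S \<Longrightarrow> cmod (fp_trunc r d \<phi> s - 1) < e"
    "\<And>F. finite F \<Longrightarrow> (\<And>s. s \<in> F \<Longrightarrow> fp_red G s) \<Longrightarrow>
      schur_factor F (1 + e) (\<lambda>s t. fp_trunc r d \<phi> (fp_mul G (fp_inv G s) t :: ('c \<times> 'a) list))"
proof -
  obtain l where l: "\<And>s. s \<in> S \<Longrightarrow> length s \<le> l"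
    using finite_nat_set_iff_bounded_le[of "length ` S"] S by auto
  have "((\<lambda>r::real. r ^ l) \<longlongrightarrow> 1 ^ l) (at_left 1)" by (intro tendsto_intros)
  then have "\<forall>\<^sub>F r in at_left (1::real). r ^ l > 1 - e / 2" using e by (intro order_tendstoD(1)) auto
  moreover have "\<forall>\<^sub>F r in at_left (1::real). r \<in> {0<..<1}" by (rule eventually_at_left_real) simp
  ultimately have "\<forall>\<^sub>F r in at_left (1::real). r ^ l > 1 - e / 2 \<and> r \<in> {0<..<1}" by (rule eventually_conj)
  then obtain r :: real where r: "r ^ l > 1 - e / 2" "0 < r" "r < 1"
    using eventually_happens'[OF trivial_limit_at_left_real] by auto
  define R where "R = (1 + r) / 2"
  define \<rho> where "\<rho> = (1 + R) / 2"
  define q where "q = r / R"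
  have R: "r < R" "R < \<rho>" "\<rho> < 1" "R > 0" using r by (auto simp: R_def \<rho>_def)
  have q: "0 < q" "q < 1" using r R by (auto simp: q_def)
  define M where "M = (1 + 11 / (1 - \<rho>\<^sup>2)) / (1 - q)"
  have "((\<lambda>d. M * q ^ Suc d) \<longlongrightarrow> M * 0) sequentially"
    using q by (intro tendsto_mult tendsto_const LIMSEQ_Suc LIMSEQ_power_zero) auto
  then have "\<forall>\<^sub>F d in sequentially. M * q ^ Suc d < e / 2" using e by (intro order_tendstoD(2)) auto
  then have "\<forall>\<^sub>F d in sequentially. M * q ^ Suc d < e / 2 \<and> d \<ge> l" using eventually_ge_at_top by (rule eventually_conj)
  then obtain d where d: "M * q ^ Suc d < e / 2" "d \<ge> l" using eventually_happens'[OF trivial_limit_sequentially] by auto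
  have t1: "\<forall>\<^sub>F \<tau> in at_right (0::real). 27 * \<tau> / (1 - \<rho>\<^sup>2) < e / 2"
  proof (rule order_tendstoD(2))
    show "((\<lambda>\<tau>. 27 * \<tau> / (1 - \<rho>\<^sup>2)) \<longlongrightarrow> 27 * 0 / (1 - \<rho>\<^sup>2)) (at_right 0)"
      unfolding divide_inverse by (intro tendsto_intros)
  qed (use e in simp)
  have t2: "\<forall>\<^sub>F \<tau> in at_right (0::real). R * (1 + \<tau>\<^sup>2) < \<rho>"
  proof (rule order_tendstoD(2))
    show "((\<lambda>\<tau>. R * (1 + \<tau>\<^sup>2)) \<longlongrightarrow> R * (1 + 0\<^sup>2)) (at_right 0)" by (intro tendsto_intros)
  qed (use R in simp)
  have t3: "\<forall>\<^sub>F \<tau> in at_right (0::real). (1 + \<tau>) ^ l - 1 < e / 2"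
  proof (rule order_tendstoD(2))
    show "((\<lambda>\<tau>::real. (1 + \<tau>) ^ l - 1) \<longlongrightarrow> (1 + 0) ^ l - 1) (at_right 0)" by (intro tendsto_intros)
  qed (use e in simp)
  have t4: "\<forall>\<^sub>F \<tau> in at_right (0::real). \<tau> \<in> {0<..<1}" by (rule eventually_at_right_real) simp
  have "\<forall>\<^sub>F \<tau> in at_right (0::real). 27 * \<tau> / (1 - \<rho>\<^sup>2) < e / 2 \<and> R * (1 + \<tau>\<^sup>2) < \<rho> \<and> (1 + \<tau>) ^ l - 1 < e / 2 \<and> \<tau> \<in> {0<..<1}"
    using t1 t2 t3 t4 by eventually_elim auto
  from eventually_happens'[OF trivial_limit_at_right_real this]
  obtain \<tau> where "27 * \<tau> / (1 - \<rho>\<^sup>2) < e / 2 \<and> R * (1 + \<tau>\<^sup>2) < \<rho> \<and> (1 + \<tau>) ^ l - 1 < e / 2 \<and> \<tau> \<in> {0<..<1}" ..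
  then have \<tau>: "27 * \<tau> / (1 - \<rho>\<^sup>2) < e / 2" "R * (1 + \<tau>\<^sup>2) < \<rho>" "(1 + \<tau>) ^ l - 1 < e / 2" "0 < \<tau>" "\<tau> \<le> 1"
    by auto
  have "finite (\<Union>s\<in>S. snd ` set s)" "(\<Union>s\<in>S. snd ` set s) \<subseteq> carrier G"
    using S fp_red_carrier by auto
  then obtain \<phi> where \<phi>: "fin_supp G \<phi>" "\<phi> \<one> = 1" "\<And>g. g \<in> (\<Union>s\<in>S. snd ` set s) \<Longrightarrow> cmod (\<phi> g - 1) < \<tau>"
    "\<And>W. finite W \<Longrightarrow> W \<subseteq> carrier G \<Longrightarrow> schur_factor W (1 + \<tau>\<^sup>2) (\<lambda>x y. \<phi> (inv x \<otimes> y))"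
    by (rule weakly_amenable_CH1_approx[OF wa _ _ \<tau>(4,5)]) (rule that)
  show thesis
  proof (rule that[of \<phi> r d])
    show "fin_supp G \<phi>" by (rule \<phi>(1))
  next
    fix s assume s: "s \<in> S"
    let ?n = "length s"
    have "cmod (fp_val \<phi> s - 1) \<le> (1 + \<tau>) ^ ?n - 1"
      by (rule fp_val_near_one) (use \<phi>(3) s \<tau> in auto)
    also have "\<dots> \<le> (1 + \<tau>) ^ l - 1" using l[OF s] \<tau> by (simp add: power_increasing)
    finally have v: "cmod (fp_val \<phi> s - 1) < e / 2" using \<tau>(3) by linarith
    have "r ^ l \<le> r ^ ?n" by (rule power_decreasing[OF l[OF s]]) (use r in auto)
    with r(1) have rn: "1 - e / 2 < r ^ ?n" by linarith
    have rn': "r ^ ?n \<le> 1" "r ^ ?n \<ge> 0" using r by (auto simp: power_le_one)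
    have "fp_trunc r d \<phi> s - 1 = of_real (r ^ ?n) * (fp_val \<phi> s - 1) + of_real (r ^ ?n - 1)"
      using l[OF s] d(2) by (simp add: fp_trunc_def algebra_simps)
    then have "cmod (fp_trunc r d \<phi> s - 1) \<le> cmod (of_real (r ^ ?n)) * cmod (fp_val \<phi> s - 1) + cmod (of_real (r ^ ?n - 1))"
      by (metis norm_mult norm_triangle_ineq)
    also have "\<dots> = r ^ ?n * cmod (fp_val \<phi> s - 1) + (1 - r ^ ?n)"
      unfolding norm_of_real using rn' by simp
    also have "\<dots> \<le> 1 * cmod (fp_val \<phi> s - 1) + (1 - r ^ ?n)"
      using rn' by (intro add_mono mult_right_mono) auto
    also have "\<dots> < e" using v rn by linarith
    finally show "cmod (fp_trunc r d \<phi> s - 1) < e" .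
  next
    fix F :: "('c \<times> 'a) list set"
    assume F: "finite F" "\<And>s. s \<in> F \<Longrightarrow> fp_red G s"
    have "schur_factor F (1 + 27 * \<tau> / (1 - \<rho>\<^sup>2) + (1 + 11 / (1 - \<rho>\<^sup>2)) * (q ^ Suc d / (1 - q)))
      (\<lambda>s t. fp_trunc r d \<phi> (fp_mul G (fp_inv G s) t))"
      unfolding q_def by (rule fp_trunc_schur_factor[OF F \<phi>(2) \<tau>(4,5) \<phi>(4) r(2) R(1) less_imp_le[OF \<tau>(2)] R(3)])
    moreover have "1 + 27 * \<tau> / (1 - \<rho>\<^sup>2) + (1 + 11 / (1 - \<rho>\<^sup>2)) * (q ^ Suc d / (1 - q)) \<le> 1 + e"
    proof -
      have "(1 + 11 / (1 - \<rho>\<^sup>2)) * (q ^ Suc d / (1 - q)) = M * q ^ Suc d" by (simp add: M_def)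
      then show ?thesis using \<tau>(1) d(1) by linarith
    qed
    ultimately show "schur_factor F (1 + e) (\<lambda>s t. fp_trunc r d \<phi> (fp_mul G (fp_inv G s) t))"
      by (rule schur_factor_mono) simp
  qed
qed

end

section \<open>Graph products\<close>

locale graph_product_groups =
  fixes V :: "'v set" and E :: "'v \<Rightarrow> 'v \<Rightarrow> bool" and G :: "'v \<Rightarrow> ('g, 'c) monoid_scheme"
  assumes graph: "simplicial_graph V E"
    and groups: "v \<in> V \<Longrightarrow> group (G v)"
begin

abbreviation eqv (infix "\<doteq>" 50) where "x \<doteq> y \<equiv> gp_equiv V E G x y"
abbreviation "wds \<equiv> gp_words V G"
abbreviation "cls \<equiv> gp_class V E G"
abbreviation "GP \<equiv> graph_product V E G"

lemma edge: "E v w \<Longrightarrow> v \<in> V" "E v w \<Longrightarrow> w \<in> V" "E v w \<Longrightarrow> v \<noteq> w" "E v w \<Longrightarrow> E w v"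
  using graph unfolding simplicial_graph_def by blast+

lemma eqv_refl [simp]: "x \<doteq> x"
  by (simp add: gp_equiv_def)

lemma eqv_sym: "x \<doteq> y \<Longrightarrow> y \<doteq> x"
  unfolding gp_equiv_def by (erule rtranclp_induct) (auto intro: converse_rtranclp_into_rtranclp)

lemma eqv_trans [trans]: "x \<doteq> y \<Longrightarrow> y \<doteq> z \<Longrightarrow> x \<doteq> z"
  unfolding gp_equiv_def by (rule rtranclp_trans)

lemma step_eqv: "gp_step V E G x y \<Longrightarrow> x \<doteq> y"
  unfolding gp_equiv_def by auto

lemma eqv_induct [consumes 1, case_names refl step]:
  assumes "x \<doteq> y" "P x" "\<And>y z. x \<doteq> y \<Longrightarrow> gp_step V E G y z \<or> gp_step V E G z y \<Longrightarrow> P y \<Longrightarrow> P z"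
  shows "P y"
  using assms(1) unfolding gp_equiv_def
  by (induction rule: rtranclp_induct) (use assms(2,3) in \<open>auto simp: gp_equiv_def\<close>)

lemma step_append:
  assumes "gp_step V E G x y"
  shows "gp_step V E G (p @ x @ q) (p @ y @ q)"
  using assms
proof cases
  case (drop_one v xs ys)
  then show ?thesis using gp_step.drop_one[of v V E G "p @ xs" "ys @ q"] by simp
next
  case (merge v a b xs ys)
  then show ?thesis using gp_step.merge[of v V a G b E "p @ xs" "ys @ q"] by simp
next
  case (swap v w a b xs ys)
  then show ?thesis using gp_step.swap[of E v w a G b V "p @ xs" "ys @ q"] by simp
qed

lemma eqv_context: "x \<doteq> y \<Longrightarrow> p @ x @ q \<doteq> p @ y @ q"
proof (induction rule: eqv_induct)
  case (step y z)
  then have "p @ y @ q \<doteq> p @ z @ q" using step_append step_eqv eqv_sym by blast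
  with step.IH show ?case by (rule eqv_trans)
qed simp

lemma eqv_append: "x \<doteq> x' \<Longrightarrow> y \<doteq> y' \<Longrightarrow> x @ y \<doteq> x' @ y'"
  using eqv_context[of x x' "[]" y] eqv_context[of y y' x' "[]"] by (auto intro: eqv_trans)

lemma step_words: "gp_step V E G x y \<Longrightarrow> x \<in> wds \<longleftrightarrow> y \<in> wds"
proof (induction rule: gp_step.induct)
  case (drop_one v xs ys)
  interpret group "G v" by (rule groups[OF drop_one])
  show ?case using drop_one by (auto simp: gp_words_def)
next
  case (merge v a b xs ys)
  interpret group "G v" by (rule groups[OF merge(1)])
  show ?case using merge by (auto simp: gp_words_def)
next
  case (swap v w a b xs ys)
  then show ?case using edge by (auto simp: gp_words_def)
qed

lemma eqv_words: "x \<doteq> y \<Longrightarrow> x \<in> wds \<longleftrightarrow> y \<in> wds"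
proof (induction rule: eqv_induct)
  case (step y z)
  then show ?case using step_words[of y z] step_words[of z y] by blast
qed simp

lemma words_append [simp]: "x @ y \<in> wds \<longleftrightarrow> x \<in> wds \<and> y \<in> wds"
  and words_Nil [simp]: "[] \<in> wds"
  and words_Cons [simp]: "(v, a) # x \<in> wds \<longleftrightarrow> v \<in> V \<and> a \<in> carrier (G v) \<and> x \<in> wds"
  by (auto simp: gp_words_def)

lemma cls_eq_iff: "cls x = cls y \<longleftrightarrow> x \<doteq> y"
proof
  assume "cls x = cls y"
  moreover have "y \<in> cls y" by (simp add: gp_class_def)
  ultimately show "x \<doteq> y" by (simp add: gp_class_def set_eq_iff)
next
  assume "x \<doteq> y"
  then show "cls x = cls y" unfolding gp_class_def by (blast intro: eqv_trans eqv_sym)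
qed

lemma some_cls: "x \<doteq> (SOME y. y \<in> cls x)"
proof -
  have "(SOME y. y \<in> cls x) \<in> cls x" by (rule someI[of _ x]) (simp add: gp_class_def)
  then show ?thesis by (simp add: gp_class_def)
qed

lemma carrier_GP: "carrier GP = cls ` wds"
  and one_GP: "\<one>\<^bsub>GP\<^esub> = cls []"
  by (simp_all add: graph_product_def)

lemma mult_GP: "cls x \<otimes>\<^bsub>GP\<^esub> cls y = cls (x @ y)"
proof -
  have "x @ y \<doteq> (SOME z. z \<in> cls x) @ (SOME z. z \<in> cls y)" by (intro eqv_append some_cls)
  then show ?thesis by (simp add: graph_product_def cls_eq_iff eqv_sym)
qed

definition winv :: "('v \<times> 'g) list \<Rightarrow> ('v \<times> 'g) list" where
  "winv w = rev (map (\<lambda>(v, a). (v, inv\<^bsub>G v\<^esub> a)) w)"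

lemma winv_simps [simp]: "winv [] = []" "winv ((v, a) # w) = winv w @ [(v, inv\<^bsub>G v\<^esub> a)]"
  by (simp_all add: winv_def)

lemma winv_words: "w \<in> wds \<Longrightarrow> winv w \<in> wds"
proof (induction w)
  case (Cons x w)
  obtain v a where x: "x = (v, a)" by force
  then show ?case using Cons groups group.inv_closed by fastforce
qed simp

lemma letter_inv_eqv:
  assumes "v \<in> V" "a \<in> carrier (G v)" "b \<in> carrier (G v)" "b \<otimes>\<^bsub>G v\<^esub> a = \<one>\<^bsub>G v\<^esub>"
  shows "[(v, b), (v, a)] \<doteq> []"
proof -
  have "[(v, b), (v, a)] \<doteq> [(v, b \<otimes>\<^bsub>G v\<^esub> a)]"
    using step_eqv[OF gp_step.merge[of v V b G a E "[]" "[]"]] assms by simp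
  also have "[(v, b \<otimes>\<^bsub>G v\<^esub> a)] \<doteq> []"
    using step_eqv[OF gp_step.drop_one[of v V E G "[]" "[]"]] assms by simp
  finally show ?thesis .
qed

lemma winv_left: "w \<in> wds \<Longrightarrow> winv w @ w \<doteq> []"
proof (induction w)
  case (Cons x w)
  obtain v a where x: "x = (v, a)" by force
  have v: "v \<in> V" "a \<in> carrier (G v)" "w \<in> wds" using Cons.prems x by auto
  interpret group "G v" by (rule groups[OF v(1)])
  have "[(v, inv\<^bsub>G v\<^esub> a), (v, a)] \<doteq> []" by (rule letter_inv_eqv) (use v in auto)
  from eqv_context[OF this, of "winv w" w] have "winv (x # w) @ x # w \<doteq> winv w @ w" by (simp add: x)
  also have "\<dots> \<doteq> []" by (rule Cons.IH[OF v(3)])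
  finally show ?case .
qed simp

lemma winv_right: "w \<in> wds \<Longrightarrow> w @ winv w \<doteq> []"
proof (induction w)
  case (Cons x w)
  obtain v a where x: "x = (v, a)" by force
  have v: "v \<in> V" "a \<in> carrier (G v)" "w \<in> wds" using Cons.prems x by auto
  interpret group "G v" by (rule groups[OF v(1)])
  have "x # w @ winv (x # w) \<doteq> [x] @ [] @ [(v, inv\<^bsub>G v\<^esub> a)]"
    using eqv_context[OF Cons.IH[OF v(3)], of "[x]" "[(v, inv\<^bsub>G v\<^esub> a)]"] by (simp add: x)
  also have "\<dots> \<doteq> []" using letter_inv_eqv[of v "inv\<^bsub>G v\<^esub> a" a] v by (simp add: x)
  finally show ?case by simp
qed simp

lemma group_GP: "group GP"
proof (rule groupI)
  fix X Y assume "X \<in> carrier GP" "Y \<in> carrier GP"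
  then obtain x y where "x \<in> wds" "y \<in> wds" "X = cls x" "Y = cls y" by (auto simp: carrier_GP)
  then show "X \<otimes>\<^bsub>GP\<^esub> Y \<in> carrier GP" by (simp add: mult_GP carrier_GP)
next
  fix X Y Z assume "X \<in> carrier GP" "Y \<in> carrier GP" "Z \<in> carrier GP"
  then obtain x y z where "X = cls x" "Y = cls y" "Z = cls z" by (auto simp: carrier_GP)
  then show "X \<otimes>\<^bsub>GP\<^esub> Y \<otimes>\<^bsub>GP\<^esub> Z = X \<otimes>\<^bsub>GP\<^esub> (Y \<otimes>\<^bsub>GP\<^esub> Z)" by (simp add: mult_GP)
next
  fix X assume "X \<in> carrier GP"
  then obtain x where x: "x \<in> wds" "X = cls x" by (auto simp: carrier_GP)
  then show "\<one>\<^bsub>GP\<^esub> \<otimes>\<^bsub>GP\<^esub> X = X" by (simp add: mult_GP one_GP)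
  show "\<exists>Y\<in>carrier GP. Y \<otimes>\<^bsub>GP\<^esub> X = \<one>\<^bsub>GP\<^esub>"
    using x winv_words[OF x(1)] winv_left[OF x(1)]
    by (intro bexI[of _ "cls (winv x)"]) (auto simp: mult_GP one_GP cls_eq_iff carrier_GP)
qed (simp add: carrier_GP one_GP)

lemma inv_GP: "x \<in> wds \<Longrightarrow> inv\<^bsub>GP\<^esub> (cls x) = cls (winv x)"
proof -
  assume x: "x \<in> wds"
  interpret GP: group GP by (rule group_GP)
  show ?thesis
    by (rule GP.inv_equality) (use x winv_words[OF x] winv_left[OF x] in \<open>auto simp: mult_GP one_GP cls_eq_iff carrier_GP\<close>)
qed

lemma eqv_cancel:
  assumes "p \<in> wds" "p @ x \<doteq> p @ y"
  shows "x \<doteq> y"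
proof -
  have c: "winv p @ p @ z \<doteq> z" for z
    using eqv_context[OF winv_left[OF assms(1)], of "[]" z] by simp
  have "x \<doteq> winv p @ p @ x" by (rule eqv_sym[OF c])
  also have "\<dots> \<doteq> winv p @ p @ y" using eqv_context[OF assms(2), of "winv p" "[]"] by simp
  also have "\<dots> \<doteq> y" by (rule c)
  finally show ?thesis .
qed

text \<open>Deleting the letters outside \<open>T\<close> is the retraction onto the graph product
  over \<open>T\<close>: a rewriting step either survives or becomes trivial.\<close>

lemma filter_step:
  assumes "gp_step V E G x y"
  shows "filter (\<lambda>z. fst z \<in> T) x \<doteq> filter (\<lambda>z. fst z \<in> T) y"
  using assms
proof cases
  case (drop_one v xs ys)
  then show ?thesis
    using step_eqv[OF gp_step.drop_one[of v V E G "filter (\<lambda>z. fst z \<in> T) xs" "filter (\<lambda>z. fst z \<in> T) ys"]] by auto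
next
  case (merge v a b xs ys)
  then show ?thesis
    using step_eqv[OF gp_step.merge[of v V a G b E "filter (\<lambda>z. fst z \<in> T) xs" "filter (\<lambda>z. fst z \<in> T) ys"]] by auto
next
  case (swap v w a b xs ys)
  then show ?thesis
    using step_eqv[OF gp_step.swap[of E v w a G b V "filter (\<lambda>z. fst z \<in> T) xs" "filter (\<lambda>z. fst z \<in> T) ys"]] by auto
qed

lemma filter_eqv: "x \<doteq> y \<Longrightarrow> filter (\<lambda>z. fst z \<in> T) x \<doteq> filter (\<lambda>z. fst z \<in> T) y"
proof (induction rule: eqv_induct)
  case (step y z)
  then have "filter (\<lambda>z. fst z \<in> T) y \<doteq> filter (\<lambda>z. fst z \<in> T) z" using filter_step eqv_sym by blast
  with step.IH show ?case by (rule eqv_trans)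
qed simp

section \<open>Components in free products\<close>

text \<open>For a vertex \<open>v\<close>, the graph product is a semidirect product of a free product of copies of \<open>G v\<close> with the
  graph product over the other vertices. The copies are indexed by the cosets of the subgroup generated by the
  star of \<open>v\<close>; \<open>lab v p\<close> is the coset of \<open>p\<close>, and \<open>nf v [] w\<close> is the component of \<open>w\<close> in this free product.\<close>

definition star_words :: "'v \<Rightarrow> ('v \<times> 'g) list set" where
  "star_words v = {l \<in> wds. fst ` set l \<subseteq> insert v {u. E v u}}"

definition lab :: "'v \<Rightarrow> ('v \<times> 'g) list \<Rightarrow> ('v \<times> 'g) list set" where
  "lab v p = {q. \<exists>l\<in>star_words v. p @ l \<doteq> q}"

lemma lab_cong: "p \<doteq> p' \<Longrightarrow> lab v p = lab v p'"
  unfolding lab_def using eqv_append[OF _ eqv_refl] eqv_sym eqv_trans by blast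

lemma lab_absorb:
  assumes "u = v \<or> E v u" "u \<in> V" "a \<in> carrier (G u)"
  shows "lab v (p @ [(u, a)]) = lab v p"
proof (intro equalityI subsetI)
  fix q assume "q \<in> lab v (p @ [(u, a)])"
  then obtain l where l: "l \<in> star_words v" "(p @ [(u, a)]) @ l \<doteq> q" by (auto simp: lab_def)
  have "(u, a) # l \<in> star_words v" using l(1) assms by (auto simp: star_words_def)
  then show "q \<in> lab v p" using l(2) unfolding lab_def by (intro CollectI bexI[of _ "(u, a) # l"]) auto
next
  fix q assume "q \<in> lab v p"
  then obtain l where l: "l \<in> star_words v" "p @ l \<doteq> q" by (auto simp: lab_def)
  interpret group "G u" by (rule groups[OF assms(2)])
  have 1: "(u, inv\<^bsub>G u\<^esub> a) # l \<in> star_words v" using l(1) assms by (auto simp: star_words_def)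
  have "[(u, a), (u, inv\<^bsub>G u\<^esub> a)] \<doteq> []" by (rule letter_inv_eqv) (use assms in auto)
  from eqv_context[OF this, of p l] have "(p @ [(u, a)]) @ (u, inv\<^bsub>G u\<^esub> a) # l \<doteq> p @ l" by simp
  also note l(2)
  finally show "q \<in> lab v (p @ [(u, a)])" unfolding lab_def using 1 by blast
qed

lemma lab_absorb_star: "l \<in> star_words v \<Longrightarrow> lab v (p @ l) = lab v p"
proof (induction l arbitrary: p)
  case (Cons x l)
  obtain u a where x: "x = (u, a)" by force
  have "lab v (p @ x # l) = lab v ((p @ [x]) @ l)" by simp
  also have "\<dots> = lab v (p @ [x])" by (rule Cons.IH) (use Cons.prems in \<open>auto simp: star_words_def x\<close>)
  also have "\<dots> = lab v p" unfolding x by (rule lab_absorb) (use Cons.prems in \<open>auto simp: star_words_def x\<close>)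
  finally show ?case .
qed simp

lemma lab_eq_iff: "lab v p = lab v p' \<longleftrightarrow> (\<exists>l\<in>star_words v. p @ l \<doteq> p')"
proof
  assume eq: "lab v p = lab v p'"
  have "[] \<in> star_words v" by (simp add: star_words_def)
  then have "p' \<in> lab v p'" unfolding lab_def by (intro CollectI bexI[of _ "[]"]) auto
  then have "p' \<in> lab v p" by (simp add: eq)
  then show "\<exists>l\<in>star_words v. p @ l \<doteq> p'" by (simp add: lab_def)
next
  assume "\<exists>l\<in>star_words v. p @ l \<doteq> p'"
  then show "lab v p = lab v p'" using lab_absorb_star lab_cong by metis
qed

lemma lab_left: "x \<in> wds \<Longrightarrow> lab v (x @ p) = lab v (x @ p') \<longleftrightarrow> lab v p = lab v p'"
  unfolding lab_eq_iff using eqv_cancel eqv_append[OF eqv_refl] by (metis append_assoc)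

text \<open>The argument \<open>p\<close> is the group element read so far. Letting it vary exhibits
  the crossed homomorphism: starting at \<open>p\<close> instead of \<open>[]\<close> translates all
  labels by \<open>p\<close> on the left.\<close>

fun syll :: "'v \<Rightarrow> ('v \<times> 'g) list \<Rightarrow> ('v \<times> 'g) list \<Rightarrow> (('v \<times> 'g) list set \<times> 'g) list" where
  "syll v p [] = []"
| "syll v p ((u, a) # w) = (if u = v then [(lab v p, a)] else []) @ syll v (p @ [(u, a)]) w"

definition nf :: "'v \<Rightarrow> ('v \<times> 'g) list \<Rightarrow> ('v \<times> 'g) list \<Rightarrow> (('v \<times> 'g) list set \<times> 'g) list" where
  "nf v p w = fp_mul (G v) (syll v p w) []"

lemma syll_append: "syll v p (x @ y) = syll v p x @ syll v (p @ x) y"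
  by (induction v p x rule: syll.induct) auto

lemma syll_cong: "p \<doteq> p' \<Longrightarrow> syll v p w = syll v p' w"
proof (induction w arbitrary: p p')
  case (Cons x w)
  obtain u a where x: "x = (u, a)" by force
  show ?case using Cons.IH[OF eqv_append[OF Cons.prems eqv_refl]] lab_cong[OF Cons.prems] by (simp add: x)
qed simp

lemma syll_set: "snd ` set (syll v p w) = {a. (v, a) \<in> set w}"
  by (induction v p w rule: syll.induct) auto

lemma syll_carrier: "w \<in> wds \<Longrightarrow> snd ` set (syll v p w) \<subseteq> carrier (G v)"
  unfolding syll_set by (auto simp: gp_words_def)

lemma syll_length: "length (syll v p w) = length (filter (\<lambda>z. fst z = v) w)"
  by (induction v p w rule: syll.induct) auto

lemma syll_label: "fst ` set (syll v p w) \<subseteq> range (lab v)"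
  by (induction v p w rule: syll.induct) auto

lemma nf_red:
  assumes "v \<in> V" "w \<in> wds"
  shows "fp_red (G v) (nf v p w)"
proof -
  interpret group "G v" by (rule groups[OF assms(1)])
  show ?thesis unfolding nf_def by (rule fp_mul_red[OF syll_carrier[OF assms(2)]]) simp
qed

text \<open>Labels are cosets of the whole star for this reason: merging letters at \<open>v\<close>
  have equal labels because \<open>v\<close> itself is absorbed, and a letter at \<open>v\<close>
  keeps its label when swapped past a neighbour because neighbours are absorbed. All later labels
  depend on the prefix only up to equivalence.\<close>

lemma nf_step:
  assumes st: "gp_step V E G x y" and x: "x \<in> wds" and v: "v \<in> V"
  shows "nf v p x = nf v p y"
proof -
  interpret group "G v" by (rule groups[OF v])
  have red: "fp_red (G v) (fp_mul (G v) (syll v q w) [])" if "w \<in> wds" for q w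
    by (rule fp_mul_red[OF syll_carrier[OF that]]) simp
  have ctx: "nf v p (xs @ m @ ys) = nf v p (xs @ m' @ ys)"
    if "m \<doteq> m'" "ys \<in> wds"
      "\<And>X. fp_red (G v) X \<Longrightarrow> fp_mul (G v) (syll v (p @ xs) m) X = fp_mul (G v) (syll v (p @ xs) m') X" for xs m m' ys
  proof -
    have "syll v (p @ xs @ m) ys = syll v (p @ xs @ m') ys"
      using eqv_context[OF that(1), of "p @ xs" "[]"] by (intro syll_cong) simp
    then show ?thesis using that(3)[OF red[OF that(2)]] by (simp add: nf_def syll_append)
  qed
  show ?thesis using st
  proof cases
    case (drop_one u xs ys)
    have "nf v p (xs @ [(u, \<one>\<^bsub>G u\<^esub>)] @ ys) = nf v p (xs @ [] @ ys)"
    proof (rule ctx)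
      show "[(u, \<one>\<^bsub>G u\<^esub>)] \<doteq> []" using step_eqv[OF gp_step.drop_one[of u V E G "[]" "[]"]] drop_one by simp
    qed (use drop_one x fp_act_one in auto)
    then show ?thesis using drop_one by simp
  next
    case (merge u a b xs ys)
    have "nf v p (xs @ [(u, a), (u, b)] @ ys) = nf v p (xs @ [(u, a \<otimes>\<^bsub>G u\<^esub> b)] @ ys)"
    proof (rule ctx)
      show "[(u, a), (u, b)] \<doteq> [(u, a \<otimes>\<^bsub>G u\<^esub> b)]"
        using step_eqv[OF gp_step.merge[of u V a G b E "[]" "[]"]] merge by simp
      fix X :: "(('v \<times> 'g) list set \<times> 'g) list" assume "fp_red (G v) X"
      then show "fp_mul (G v) (syll v (p @ xs) [(u, a), (u, b)]) X = fp_mul (G v) (syll v (p @ xs) [(u, a \<otimes>\<^bsub>G u\<^esub> b)]) X"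
        using merge lab_absorb[of v v a "p @ xs"] fp_act_act by auto
    qed (use merge x in auto)
    then show ?thesis using merge by simp
  next
    case (swap u w a b xs ys)
    have c: "[(u, a), (w, b)] \<doteq> [(w, b), (u, a)]"
      using step_eqv[OF gp_step.swap[of E u w a G b V "[]" "[]"]] swap by simp
    have "nf v p (xs @ [(u, a), (w, b)] @ ys) = nf v p (xs @ [(w, b), (u, a)] @ ys)"
    proof (rule ctx[OF c])
      show "fp_mul (G v) (syll v (p @ xs) [(u, a), (w, b)]) X = fp_mul (G v) (syll v (p @ xs) [(w, b), (u, a)]) X" for X
        using swap edge(1,2,4) edge(3)[OF swap(3)] lab_absorb[of u w a "p @ xs"] lab_absorb[of w u b "p @ xs"] by auto
    qed (use swap x in auto)
    then show ?thesis using swap by simp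
  qed
qed

lemma nf_eqv:
  assumes "x \<doteq> y" "x \<in> wds" "v \<in> V"
  shows "nf v p x = nf v p y"
  using assms(1)
proof (induction rule: eqv_induct)
  case (step y z)
  have "y \<in> wds" "z \<in> wds" using step eqv_words assms(2) step_words by blast+
  then have "nf v p y = nf v p z" using step(2) nf_step assms(3) by metis
  then show ?case using step.IH by simp
qed simp

lemma nf_relabel:
  assumes "x \<in> wds" "v \<in> V" "w \<in> wds"
  obtains f where "nf v x w = map (\<lambda>(c, a). (f c, a)) (nf v [] w)"
proof -
  \<comment> \<open>Left translation by \<open>x\<close> on cosets; by \<open>lab_left\<close> it
    does not depend on the chosen representative and is injective.\<close>
  define f where "f c = lab v (x @ (SOME q. lab v q = c))" for c
  have f: "f (lab v p) = lab v (x @ p)" for p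
  proof -
    have "lab v (SOME q. lab v q = lab v p) = lab v p" by (rule someI) (rule refl)
    then show ?thesis unfolding f_def using lab_left[OF assms(1)] by simp
  qed
  have s: "syll v (x @ p) w = map (\<lambda>(c, a). (f c, a)) (syll v p w)" for p
  proof (induction w arbitrary: p)
    case (Cons z w)
    then show ?case using Cons.IH[of "p @ [z]"] by (cases z) (simp add: f)
  qed simp
  have "inj_on f (fst ` set (syll v [] w @ []))"
  proof (rule inj_on_subset)
    show "inj_on f (range (lab v))" by (auto simp: inj_on_def f lab_left[OF assms(1)])
    show "fst ` set (syll v [] w @ []) \<subseteq> range (lab v)" using syll_label by simp
  qed
  from fp_mul_map_label[OF this, of "G v"] have "nf v x w = map (\<lambda>(c, a). (f c, a)) (nf v [] w)"
    using s[of "[]"] by (simp add: nf_def)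
  then show thesis by (rule that)
qed

text \<open>Reading \<open>x @ winv x @ y\<close>, which is equivalent to \<open>y\<close>, splits
  the component of \<open>y\<close> into that of \<open>x\<close> followed by that of the quotient
  read from \<open>x\<close>; the former is then cancelled.\<close>

lemma nf_left_quotient:
  assumes x: "x \<in> wds" and y: "y \<in> wds" and v: "v \<in> V"
  shows "nf v x (winv x @ y) = fp_mul (G v) (fp_inv (G v) (nf v [] x)) (nf v [] y)"
proof -
  interpret group "G v" by (rule groups[OF v])
  let ?X = "nf v x (winv x @ y)"
  have X: "fp_red (G v) ?X" by (rule nf_red[OF v]) (use x y winv_words in auto)
  have "x @ winv x @ y \<doteq> y" using eqv_context[OF winv_right[OF x], of "[]" y] by simp
  then have "nf v [] y = nf v [] (x @ winv x @ y)"
    using x y winv_words by (intro nf_eqv[symmetric] v) auto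
  also have "\<dots> = fp_mul (G v) (syll v [] x) ?X" by (simp add: nf_def syll_append)
  also have "\<dots> = fp_mul (G v) (nf v [] x) ?X"
    unfolding nf_def[of v "[]" x] using fp_mul_assoc[OF syll_carrier[OF x] _ X, of "[]"] by simp
  finally show ?thesis
    using fp_mul_inv_cancel[OF fp_red_carrier[OF nf_red[OF v x]] X] by simp
qed

text \<open>The truncated multiplier sees only lengths and group letters, so the relabelling in the
  crossed homomorphism is invisible to it. Hence the kernel on the graph product is the pullback of
  the one on the free product.\<close>

lemma fp_trunc_nf_quotient:
  assumes "x \<in> wds" "y \<in> wds" "v \<in> V"
  shows "fp_trunc r d \<phi> (nf v [] (winv x @ y)) =
    fp_trunc r d \<phi> (fp_mul (G v) (fp_inv (G v) (nf v [] x)) (nf v [] y))"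
proof -
  obtain f where f: "nf v x (winv x @ y) = map (\<lambda>(c, a). (f c, a)) (nf v [] (winv x @ y))"
    by (rule nf_relabel[of x v "winv x @ y"]) (use assms winv_words in auto)
  have "fp_trunc r d \<phi> (map (\<lambda>(c, a). (f c, a)) s) = fp_trunc r d \<phi> s" for s
    by (simp add: fp_trunc_def fp_val_def comp_def case_prod_unfold)
  then show ?thesis unfolding nf_left_quotient[OF assms, symmetric] f by simp
qed

lemma syll_first:
  assumes "syll v p w \<noteq> []"
  obtains g b q where "w = g @ (v, b) # q" "v \<notin> fst ` set g" "fst (hd (syll v p w)) = lab v (p @ g)"
  using assms
proof (induction w arbitrary: p thesis)
  case (Cons x w)
  obtain u a where x: "x = (u, a)" by force
  show ?case
  proof (cases "u = v")
    case True
    then show ?thesis using Cons.prems(1)[of "[]" a w] x by simp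
  next
    case False
    then have "syll v (p @ [(u, a)]) w \<noteq> []" using Cons.prems(2) x by simp
    then obtain g b q where "w = g @ (v, b) # q" "v \<notin> fst ` set g"
      "fst (hd (syll v (p @ [(u, a)]) w)) = lab v ((p @ [(u, a)]) @ g)"
      using Cons.IH[of "p @ [(u, a)]"] by metis
    then show ?thesis using Cons.prems(1)[of "(u, a) # g" b q] False x by auto
  qed
qed simp

text \<open>Consecutive letters at \<open>v\<close> become adjacent syllables whatever lies between
  them, so besides nontrivial letters only the labels of such pairs have to be compared.\<close>

lemma syll_red:
  assumes "w \<in> wds"
    and "\<And>p1 a q. w = p1 @ (v, a) # q \<Longrightarrow> a \<noteq> \<one>\<^bsub>G v\<^esub>"
    and "\<And>p1 a g b q. w = p1 @ (v, a) # g @ (v, b) # q \<Longrightarrow> v \<notin> fst ` set g \<Longrightarrow>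
      lab v (p @ p1) \<noteq> lab v (p @ p1 @ (v, a) # g)"
  shows "fp_red (G v) (syll v p w)"
  using assms
proof (induction w arbitrary: p)
  case (Cons x w)
  obtain u a where x: "x = (u, a)" by force
  have IH: "fp_red (G v) (syll v (p @ [(u, a)]) w)"
  proof (rule Cons.IH)
    show "w \<in> wds" using Cons.prems(1) x by simp
    show "b \<noteq> \<one>\<^bsub>G v\<^esub>" if "w = p1 @ (v, b) # q" for p1 b q
      using Cons.prems(2)[of "(u, a) # p1" b q] that x by simp
    show "lab v ((p @ [(u, a)]) @ p1) \<noteq> lab v ((p @ [(u, a)]) @ p1 @ (v, h) # g)"
      if "w = p1 @ (v, h) # g @ (v, b) # q" "v \<notin> fst ` set g" for p1 h g b q
      using Cons.prems(3)[of "(u, a) # p1" h g b q] that x by simp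
  qed
  show ?case
  proof (cases "u = v")
    case True
    have "a \<noteq> \<one>\<^bsub>G v\<^esub>" using Cons.prems(2)[of "[]" a w] x True by simp
    moreover have "a \<in> carrier (G v)" using Cons.prems(1) x True by simp
    moreover have "fst (hd (syll v (p @ [(v, a)]) w)) \<noteq> lab v p" if ne: "syll v (p @ [(v, a)]) w \<noteq> []"
    proof -
      obtain g b q where g: "w = g @ (v, b) # q" "v \<notin> fst ` set g"
        "fst (hd (syll v (p @ [(v, a)]) w)) = lab v ((p @ [(v, a)]) @ g)" by (rule syll_first[OF ne])
      then show ?thesis using Cons.prems(3)[of "[]" a g b q] x True by simp
    qed
    ultimately show ?thesis using IH x True by simp
  qed (use IH x in simp)
qed simp

lemma commute_word:
  assumes "g \<in> wds" "fst ` set g \<subseteq> {u. E v u}" "a \<in> carrier (G v)"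
  shows "(v, a) # g \<doteq> g @ [(v, a)]"
  using assms
proof (induction g)
  case (Cons x g)
  obtain u b where x: "x = (u, b)" by force
  have "(v, a) # x # g \<doteq> x # (v, a) # g"
    using step_eqv[OF gp_step.swap[of E v u a G b V "[]" g]] Cons.prems x by simp
  also have "\<dots> \<doteq> x # g @ [(v, a)]" using eqv_append[OF eqv_refl Cons.IH, of "[x]"] Cons.prems x by simp
  finally show ?case by simp
qed simp

text \<open>The retraction killing all vertices outside the star of \<open>v\<close> does not lengthen words. So if two consecutive
  \<open>v\<close>-letters of \<open>w\<close> had the same label, the word between them could be replaced by one commuting with \<open>v\<close>.\<close>

lemma minimal_word_syll_red:
  assumes w: "w \<in> wds" and min: "\<And>w'. w \<doteq> w' \<Longrightarrow> length w \<le> length w'"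
  shows "fp_red (G v) (syll v [] w)"
proof (rule syll_red[OF w])
  fix p1 a q assume eq: "w = p1 @ (v, a) # q"
  show "a \<noteq> \<one>\<^bsub>G v\<^esub>"
  proof
    assume "a = \<one>\<^bsub>G v\<^esub>"
    then have "w \<doteq> p1 @ q" using step_eqv[OF gp_step.drop_one[of v V E G p1 q]] w eq by simp
    from min[OF this] eq show False by simp
  qed
next
  fix p1 a g b q assume eq: "w = p1 @ (v, a) # g @ (v, b) # q" and vg: "v \<notin> fst ` set g"
  have c: "p1 \<in> wds" "v \<in> V" "a \<in> carrier (G v)" "b \<in> carrier (G v)" "g \<in> wds" "q \<in> wds" using w eq by auto
  let ?P = "\<lambda>z. fst z \<in> insert v {u. E v u}"
  define g' where "g' = filter ?P g"
  have g': "g' \<in> wds" "fst ` set g' \<subseteq> {u. E v u}" using c(5) vg by (auto simp: g'_def gp_words_def)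
  show "lab v ([] @ p1) \<noteq> lab v ([] @ p1 @ (v, a) # g)"
  proof
    assume "lab v ([] @ p1) = lab v ([] @ p1 @ (v, a) # g)"
    then obtain l where l: "l \<in> star_words v" "p1 @ l \<doteq> p1 @ (v, a) # g" unfolding lab_eq_iff by auto
    have 1: "l \<doteq> (v, a) # g" by (rule eqv_cancel[OF c(1) l(2)])
    have "filter ?P l = l" using l(1) by (auto simp: star_words_def intro!: filter_True)
    then have "l \<doteq> (v, a) # g'" using filter_eqv[OF 1, of "insert v {u. E v u}"] by (simp add: g'_def)
    then have "[(v, a)] @ g \<doteq> [(v, a)] @ g'" using eqv_trans[OF eqv_sym[OF 1]] by simp
    then have "g \<doteq> g'" by (rule eqv_cancel[rotated]) (use c in simp)
    from eqv_context[OF this, of "p1 @ [(v, a)]" "(v, b) # q"]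
    have "w \<doteq> p1 @ ((v, a) # g') @ (v, b) # q" by (simp add: eq)
    also have "\<dots> \<doteq> p1 @ (g' @ [(v, a)]) @ (v, b) # q"
      by (rule eqv_context[OF commute_word[OF g' c(3)]])
    also have "\<dots> \<doteq> (p1 @ g') @ [(v, a \<otimes>\<^bsub>G v\<^esub> b)] @ q"
      using step_eqv[OF gp_step.merge[of v V a G b E "p1 @ g'" q]] c by simp
    finally have "length w \<le> length ((p1 @ g') @ [(v, a \<otimes>\<^bsub>G v\<^esub> b)] @ q)" by (rule min)
    moreover have "length g' \<le> length g" unfolding g'_def by (rule length_filter_le)
    ultimately show False by (simp add: eq)
  qed
qed

lemma length_word_eq_sum:
  assumes "w \<in> wds"
  shows "length w = (\<Sum>v\<in>V. length (syll v p w))"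
  using assms
proof (induction w)
  case (Cons x w)
  obtain u a where x: "x = (u, a)" by force
  have fin: "finite V" using graph by (simp add: simplicial_graph_def)
  have "(\<Sum>v\<in>V. length (syll v p (x # w))) = (\<Sum>v\<in>V. (if v = u then 1 else 0) + length (syll v p w))"
    by (intro sum.cong refl) (auto simp: syll_length x)
  also have "\<dots> = 1 + length w" using Cons fin x by (simp add: sum.distrib)
  finally show ?case by simp
qed simp

end

section \<open>Combining the vertices\<close>

lemma cmod_prod_minus_one_le:
  fixes f :: "'i \<Rightarrow> complex"
  assumes "finite I" "\<And>i. i \<in> I \<Longrightarrow> cmod (f i - 1) \<le> e" "e \<ge> 0"
  shows "cmod ((\<Prod>i\<in>I. f i) - 1) \<le> (1 + e) ^ card I - 1"
  using assms(1,2)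
proof (induction I)
  case (insert i I)
  have 1: "cmod (f i - 1) \<le> e" using insert.prems by simp
  have 2: "cmod (f i) \<le> 1 + e" using 1 norm_triangle_ineq[of 1 "f i - 1"] by simp
  have IH: "cmod ((\<Prod>i\<in>I. f i) - 1) \<le> (1 + e) ^ card I - 1" using insert by auto
  have "(\<Prod>i\<in>insert i I. f i) - 1 = f i * ((\<Prod>i\<in>I. f i) - 1) + (f i - 1)"
    using insert.hyps by (simp add: algebra_simps)
  then have "cmod ((\<Prod>i\<in>insert i I. f i) - 1) \<le> cmod (f i) * cmod ((\<Prod>i\<in>I. f i) - 1) + cmod (f i - 1)"
    by (metis norm_mult norm_triangle_ineq)
  also have "\<dots> \<le> (1 + e) * ((1 + e) ^ card I - 1) + e"
    using 1 2 IH assms(3) by (intro add_mono mult_mono) auto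
  finally show ?case using insert.hyps by (simp add: algebra_simps)
qed simp

text \<open>The net is indexed by pairs of a finite set increasing to the whole group and a
  tolerance decreasing to 0; its filter is the image of the product of these two filters.\<close>

lemma weakly_amenable_CH1I:
  assumes approx: "\<And>S e. finite S \<Longrightarrow> S \<subseteq> carrier H \<Longrightarrow> e > 0 \<Longrightarrow>
    \<exists>f. fin_supp H f \<and> cb_norm H f \<le> ereal (1 + e) \<and> (\<forall>g\<in>S. cmod (f g - 1) < e)"
  shows "weakly_amenable_CH1 H"
proof -
  obtain f where f: "\<And>S e. finite S \<Longrightarrow> S \<subseteq> carrier H \<Longrightarrow> e > 0 \<Longrightarrow>
      fin_supp H (f S e) \<and> cb_norm H (f S e) \<le> ereal (1 + e) \<and> (\<forall>g\<in>S. cmod (f S e g - 1) < e)"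
    using approx by metis
  define B where "B = finite_subsets_at_top (carrier H) \<times>\<^sub>F at_right (0::real)"
  define F where "F = filtermap (\<lambda>(S, e). f S e) B"
  have B_fst: "\<forall>\<^sub>F x in B. P (fst x)" if "\<forall>\<^sub>F S in finite_subsets_at_top (carrier H). P S" for P
    unfolding B_def using eventually_prodI[OF that eventually_True] by simp
  have B_snd: "\<forall>\<^sub>F x in B. P (snd x)" if "\<forall>\<^sub>F e in at_right 0. P e" for P
    unfolding B_def using eventually_prodI[OF eventually_True that] by simp
  have good: "\<forall>\<^sub>F x in B. finite (fst x) \<and> fst x \<subseteq> carrier H \<and> 0 < snd x"
    using B_fst[OF eventually_finite_subsets_at_top_weakI[of "carrier H" "\<lambda>S. finite S \<and> S \<subseteq> carrier H"]]
      B_snd[OF eventually_at_right_less[of 0]]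
    by (auto elim: eventually_elim2)
  have evF: "eventually P F" if "\<forall>\<^sub>F x in B. P (f (fst x) (snd x))" for P
    using that by (simp add: F_def eventually_filtermap case_prod_unfold)
  have small: "\<forall>\<^sub>F x in B. snd x < e" if "e > 0" for e
    by (rule B_snd) (use eventually_at_right_real[OF that] in \<open>auto elim: eventually_mono\<close>)
  show ?thesis
    unfolding weakly_amenable_CH1_def
  proof (intro exI[of _ F] conjI ballI)
    show "F \<noteq> bot"
      by (simp add: F_def B_def filtermap_bot_iff prod_filter_eq_bot)
    show "\<forall>\<^sub>F phi in F. fin_supp H phi \<and> completely_bounded H phi"
    proof (rule evF, rule eventually_mono[OF good])
      fix x :: "'a set \<times> real" assume x: "finite (fst x) \<and> fst x \<subseteq> carrier H \<and> 0 < snd x"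
      have "fin_supp H (f (fst x) (snd x))" "cb_norm H (f (fst x) (snd x)) \<le> ereal (1 + snd x)"
        using f[of "fst x" "snd x"] x by auto
      then show "fin_supp H (f (fst x) (snd x)) \<and> completely_bounded H (f (fst x) (snd x))"
        unfolding completely_bounded_def by (auto intro: le_less_trans)
    qed
    show "((\<lambda>phi. phi g) \<longlongrightarrow> 1) F" if g: "g \<in> carrier H" for g
    proof (rule tendstoI)
      fix e :: real assume e: "e > 0"
      have "\<forall>\<^sub>F x in B. g \<in> fst x"
        by (rule B_fst) (use g in \<open>auto simp: eventually_finite_subsets_at_top intro!: exI[of _ "{g}"]\<close>)
      then show "\<forall>\<^sub>F phi in F. dist (phi g) 1 < e"
        using good small[OF e]
      proof (intro evF, eventually_elim)
        case (elim x)
        then show ?case using f[of "fst x" "snd x"] by (force simp: dist_norm)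
      qed
    qed
    show "Limsup F (cb_norm H) \<le> 1"
    proof (rule ereal_le_epsilon2)
      fix e :: real assume e: "0 < e"
      show "Limsup F (cb_norm H) \<le> 1 + ereal e"
      proof (rule Limsup_bounded, rule evF)
        show "\<forall>\<^sub>F x in B. cb_norm H (f (fst x) (snd x)) \<le> 1 + ereal e"
          using good small[OF e]
        proof eventually_elim
          case (elim x)
          then have "cb_norm H (f (fst x) (snd x)) \<le> ereal (1 + snd x)" using f[of "fst x" "snd x"] by auto
          also have "\<dots> \<le> 1 + ereal e" using elim by (simp add: one_ereal_def)
          finally show ?case .
        qed
      qed
    qed
  qed
qed

context graph_product_groups
begin

lemma nf_rep: "x \<in> wds \<Longrightarrow> v \<in> V \<Longrightarrow> nf v [] (SOME y. y \<in> cls x) = nf v [] x"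
  by (rule nf_eqv[symmetric]) (auto simp: some_cls)

lemma rep_words: "X \<in> carrier GP \<Longrightarrow> (SOME y. y \<in> X) \<in> wds \<and> cls (SOME y. y \<in> X) = X"
  using some_cls eqv_words cls_eq_iff unfolding carrier_GP by fastforce

lemma minimal_word_exists:
  assumes "X \<in> carrier GP"
  obtains w where "w \<in> wds" "cls w = X" "\<And>w'. w \<doteq> w' \<Longrightarrow> length w \<le> length w'"
proof -
  let ?P = "\<lambda>w. w \<in> wds \<and> cls w = X"
  have "?P (SOME y. y \<in> X)" by (rule rep_words[OF assms])
  then obtain w where w: "?P w" "\<And>w'. ?P w' \<Longrightarrow> length w \<le> length w'"
    using ex_has_least_nat[of ?P _ length] by blast
  show thesis
  proof (rule that[of w])
    fix w' assume "w \<doteq> w'"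
    then have "?P w'" using w(1) eqv_words cls_eq_iff by metis
    then show "length w \<le> length w'" by (rule w(2))
  qed (use w in auto)
qed

text \<open>The choice of a representative is immaterial, since the components are invariant under
  equivalence.\<close>

definition product_multiplier ::
  "('v \<Rightarrow> real) \<Rightarrow> ('v \<Rightarrow> nat) \<Rightarrow> ('v \<Rightarrow> 'g \<Rightarrow> complex) \<Rightarrow> ('v \<times> 'g) list set \<Rightarrow> complex" where
  "product_multiplier r d \<phi> X = (\<Prod>v\<in>V. fp_trunc (r v) (d v) (\<phi> v) (nf v [] (SOME y. y \<in> X)))"

text \<open>In a shortest word the syllables at every vertex are already reduced, so a nonzero
  factor at \<open>v\<close> limits the number of letters at \<open>v\<close> and confines them to
  the finite support of \<open>\<phi> v\<close>. Taken over all vertices, this leaves finitely many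
  words.\<close>

lemma fin_supp_product_multiplier:
  assumes supp: "\<And>v. v \<in> V \<Longrightarrow> fin_supp (G v) (\<phi> v)"
  shows "fin_supp GP (product_multiplier r d \<phi>)"
proof -
  have finV: "finite V" using graph by (simp add: simplicial_graph_def)
  define L where "L = Sigma V (\<lambda>v. {a \<in> carrier (G v). \<phi> v a \<noteq> 0})"
  have "finite L" unfolding L_def using finV supp by (auto simp: fin_supp_def)
  then have "finite (cls ` {w. set w \<subseteq> L \<and> length w \<le> (\<Sum>v\<in>V. d v)})"
    by (intro finite_imageI finite_lists_length_le)
  moreover have "{X \<in> carrier GP. product_multiplier r d \<phi> X \<noteq> 0} \<subseteq> cls ` {w. set w \<subseteq> L \<and> length w \<le> (\<Sum>v\<in>V. d v)}"
  proof
    fix X assume "X \<in> {X \<in> carrier GP. product_multiplier r d \<phi> X \<noteq> 0}"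
    then have X: "X \<in> carrier GP" and nz: "product_multiplier r d \<phi> X \<noteq> 0" by auto
    obtain w where w: "w \<in> wds" "cls w = X" "\<And>w'. w \<doteq> w' \<Longrightarrow> length w \<le> length w'"
      by (rule minimal_word_exists[OF X]) (rule that)
    have t: "fp_trunc (r v) (d v) (\<phi> v) (syll v [] w) \<noteq> 0" if v: "v \<in> V" for v
    proof -
      interpret group "G v" by (rule groups[OF v])
      have "nf v [] (SOME y. y \<in> X) = nf v [] w" using nf_rep[OF w(1) v] w(2) by simp
      also have "\<dots> = syll v [] w"
        unfolding nf_def by (rule fp_red_mul_Nil[OF minimal_word_syll_red[OF w(1,3)]])
      finally show ?thesis using nz v finV by (auto simp: product_multiplier_def)
    qed
    have len: "length (syll v [] w) \<le> d v" and val: "fp_val (\<phi> v) (syll v [] w) \<noteq> 0" if "v \<in> V" for v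
      using t[OF that] by (auto simp: fp_trunc_def split: if_splits)
    have "(v, a) \<in> L" if va: "(v, a) \<in> set w" for v a
    proof -
      have v: "v \<in> V" "a \<in> carrier (G v)" using w(1) va by (auto simp: gp_words_def)
      have "a \<in> snd ` set (syll v [] w)" using va by (simp add: syll_set)
      then have "\<phi> v a \<noteq> 0" using val[OF v(1)] by (auto simp: fp_val_def prod_list_zero_iff image_iff)
      then show ?thesis using v by (simp add: L_def)
    qed
    moreover have "length w \<le> (\<Sum>v\<in>V. d v)"
      unfolding length_word_eq_sum[OF w(1), of "[]"] by (intro sum_mono len)
    ultimately show "X \<in> cls ` {w. set w \<subseteq> L \<and> length w \<le> (\<Sum>v\<in>V. d v)}"
      using w(2) by auto
  qed
  ultimately show ?thesis unfolding fin_supp_def by (rule finite_subset[rotated])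
qed

text \<open>On a finite set of classes the kernel is a product over \<open>V\<close> of free product
  kernels, each pulled back along the component map of its vertex, so the constants
  multiply.\<close>

lemma cb_norm_product_multiplier:
  assumes e: "e \<ge> 0"
    and fac: "\<And>v F. v \<in> V \<Longrightarrow> finite F \<Longrightarrow> (\<And>s. s \<in> F \<Longrightarrow> fp_red (G v) s) \<Longrightarrow>
      schur_factor F (1 + e) (\<lambda>s t. fp_trunc (r v) (d v) (\<phi> v)
        (fp_mul (G v) (fp_inv (G v) s) t :: (('v \<times> 'g) list set \<times> 'g) list))"
  shows "cb_norm GP (product_multiplier r d \<phi>) \<le> ereal ((1 + e) ^ card V)"
proof (rule cb_norm_le_if_schur_factor[OF group_GP])
  fix F assume F: "finite F" "F \<subseteq> carrier GP"
  define rep where "rep X = (SOME y. y \<in> X)" for X :: "('v \<times> 'g) list set"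
  have rep: "rep X \<in> wds" "cls (rep X) = X" if "X \<in> F" for X
    using rep_words F that by (auto simp: rep_def)
  have finV: "finite V" using graph by (simp add: simplicial_graph_def)
  let ?K = "\<lambda>v s t. fp_trunc (r v) (d v) (\<phi> v) (fp_mul (G v) (fp_inv (G v) s) t)"
  have "schur_factor F (1 + e) (\<lambda>X Y. ?K v (nf v [] (rep X)) (nf v [] (rep Y)))" if v: "v \<in> V" for v
    by (rule schur_factor_pullback[where f="\<lambda>X. nf v [] (rep X)" and K="?K v"], rule fac[OF v])
      (use F rep nf_red[OF v] in auto)
  then have "schur_factor F (\<Prod>v\<in>V. 1 + e) (\<lambda>X Y. \<Prod>v\<in>V. ?K v (nf v [] (rep X)) (nf v [] (rep Y)))"
    using finV e by (intro schur_factor_prod) auto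
  then have "schur_factor F ((1 + e) ^ card V) (\<lambda>X Y. \<Prod>v\<in>V. ?K v (nf v [] (rep X)) (nf v [] (rep Y)))" by simp
  then show "schur_factor F ((1 + e) ^ card V) (\<lambda>X Y. product_multiplier r d \<phi> (inv\<^bsub>GP\<^esub> X \<otimes>\<^bsub>GP\<^esub> Y))"
  proof (rule schur_factor_cong)
    fix X Y assume XY: "X \<in> F" "Y \<in> F"
    let ?w = "winv (rep X) @ rep Y"
    have w: "?w \<in> wds" using rep XY winv_words by simp
    have "inv\<^bsub>GP\<^esub> X \<otimes>\<^bsub>GP\<^esub> Y = cls ?w"
      using inv_GP[OF rep(1)[OF XY(1)]] mult_GP[of "winv (rep X)" "rep Y"] rep XY by simp
    then have "product_multiplier r d \<phi> (inv\<^bsub>GP\<^esub> X \<otimes>\<^bsub>GP\<^esub> Y) =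
        (\<Prod>v\<in>V. fp_trunc (r v) (d v) (\<phi> v) (nf v [] ?w))"
      unfolding product_multiplier_def using nf_rep[OF w] by (intro prod.cong) auto
    also have "\<dots> = (\<Prod>v\<in>V. ?K v (nf v [] (rep X)) (nf v [] (rep Y)))"
      using fp_trunc_nf_quotient rep XY by (intro prod.cong) auto
    finally show "(\<Prod>v\<in>V. ?K v (nf v [] (rep X)) (nf v [] (rep Y))) =
        product_multiplier r d \<phi> (inv\<^bsub>GP\<^esub> X \<otimes>\<^bsub>GP\<^esub> Y)" by simp
  qed
qed (use e in simp)

lemma weakly_amenable_CH1_GP:
  assumes wa: "\<And>v. v \<in> V \<Longrightarrow> weakly_amenable_CH1 (G v)"
  shows "weakly_amenable_CH1 GP"
proof (rule weakly_amenable_CH1I)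
  fix S and \<epsilon> :: real
  assume S: "finite S" "S \<subseteq> carrier GP" and \<epsilon>: "\<epsilon> > 0"
  have finV: "finite V" using graph by (simp add: simplicial_graph_def)
  \<comment> \<open>One tolerance per vertex serves both purposes: \<open>(1 + e) ^ card V\<close>
    bounds the norm of the product, and \<open>(1 + e) ^ card V - 1\<close> its distance from
    1.\<close>
  have "((\<lambda>e::real. (1 + e) ^ card V) \<longlongrightarrow> (1 + 0) ^ card V) (at_right 0)" by (intro tendsto_intros)
  then have "\<forall>\<^sub>F e in at_right (0::real). (1 + e) ^ card V < 1 + \<epsilon>" using \<epsilon> by (intro order_tendstoD(2)) auto
  moreover have "\<forall>\<^sub>F e in at_right (0::real). 0 < e" by (rule eventually_at_right_less)
  ultimately have "\<forall>\<^sub>F e in at_right (0::real). (1 + e) ^ card V < 1 + \<epsilon> \<and> 0 < e" by (rule eventually_conj)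
  from eventually_happens'[OF trivial_limit_at_right_real this]
  obtain e :: real where e: "(1 + e) ^ card V < 1 + \<epsilon>" "0 < e" by blast
  define rep where "rep X = (SOME y. y \<in> X)" for X :: "('v \<times> 'g) list set"
  have rep: "rep X \<in> wds" if "X \<in> S" for X using rep_words S that by (auto simp: rep_def)
  have "\<exists>r d \<phi>. fin_supp (G v) \<phi> \<and> (\<forall>X\<in>S. cmod (fp_trunc r d \<phi> (nf v [] (rep X)) - 1) < e) \<and>
      (\<forall>F. finite F \<longrightarrow> (\<forall>s\<in>F. fp_red (G v) s) \<longrightarrow>
        schur_factor F (1 + e) (\<lambda>s t. fp_trunc r d \<phi> (fp_mul (G v) (fp_inv (G v) s) t :: (('v \<times> 'g) list set \<times> 'g) list)))"
    if v: "v \<in> V" for v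
  proof -
    interpret group "G v" by (rule groups[OF v])
    have "finite ((\<lambda>X. nf v [] (rep X)) ` S)" "\<And>s. s \<in> (\<lambda>X. nf v [] (rep X)) ` S \<Longrightarrow> fp_red (G v) s"
      using S nf_red[OF v] rep by auto
    from fp_trunc_approx[OF wa[OF v] this e(2)] show ?thesis by (smt (verit) image_eqI)
  qed
  then obtain r d \<phi> where *: "\<And>v. v \<in> V \<Longrightarrow> fin_supp (G v) (\<phi> v) \<and>
      (\<forall>X\<in>S. cmod (fp_trunc (r v) (d v) (\<phi> v) (nf v [] (rep X)) - 1) < e) \<and>
      (\<forall>F. finite F \<longrightarrow> (\<forall>s\<in>F. fp_red (G v) s) \<longrightarrow>
        schur_factor F (1 + e) (\<lambda>s t. fp_trunc (r v) (d v) (\<phi> v) (fp_mul (G v) (fp_inv (G v) s) t :: (('v \<times> 'g) list set \<times> 'g) list)))"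
    by metis
  have "cb_norm GP (product_multiplier r d \<phi>) \<le> ereal ((1 + e) ^ card V)"
    by (rule cb_norm_product_multiplier) (use * e in auto)
  also have "\<dots> \<le> ereal (1 + \<epsilon>)" using e by simp
  finally have 1: "cb_norm GP (product_multiplier r d \<phi>) \<le> ereal (1 + \<epsilon>)" .
  have 2: "cmod (product_multiplier r d \<phi> X - 1) < \<epsilon>" if "X \<in> S" for X
  proof -
    have "cmod (product_multiplier r d \<phi> X - 1) \<le> (1 + e) ^ card V - 1"
      unfolding product_multiplier_def rep_def[symmetric]
      by (rule cmod_prod_minus_one_le[OF finV]) (use * e that in \<open>auto intro: less_imp_le\<close>)
    then show ?thesis using e by linarith
  qed
  have "fin_supp GP (product_multiplier r d \<phi>)" using * by (intro fin_supp_product_multiplier) auto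
  with 1 2 show "\<exists>f. fin_supp GP f \<and> cb_norm GP f \<le> ereal (1 + \<epsilon>) \<and> (\<forall>g\<in>S. cmod (f g - 1) < \<epsilon>)" by blast
qed

end

theorem mainTheorem1:
  fixes V :: "'v set" and E :: "'v \<Rightarrow> 'v \<Rightarrow> bool"
    and G :: "'v \<Rightarrow> ('g, 'c) monoid_scheme"
  assumes "simplicial_graph V E"
    and "\<And>v. v \<in> V \<Longrightarrow> group (G v)"
    and "\<And>v. v \<in> V \<Longrightarrow> weakly_amenable_CH1 (G v)"
  shows "weakly_amenable_CH1 (graph_product V E G)"
proof -
  interpret graph_product_groups V E G
    by (rule graph_product_groups.intro) (use assms in auto)
  show ?thesis by (rule weakly_amenable_CH1_GP[OF assms(3)])
qed

end
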